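(* Let $\mathcal{D} = (\Gamma, (g_i)_{1 \le i \le \theta}, (\chi_i)_{1 \le i \le \theta}, (\lambda_{ij})_{1 \le i<j \le \theta}, (\mu_i)_{1 \le i \le \theta})$ be a datum as described in the context and let $U(\mathcal{D})$ be the associated Hopf algebra. Then every right coideal subalgebra $A \subset U(\mathcal{D})$ is generated, as an algebra, by $$A \cap \mathrm{span}_{\Bbbk}\{ g,\ g x_i \mid g \in \Gamma,\ i \in \{1,\dots,\theta\} \}.$$
   Context: $\Bbbk$ is an algebraically closed field of characteristic zero. A right coideal subalgebra of a Hopf algebra $H$ is a (unital) subalgebra $A$ with $\Delta(A) \subset A \otimes H$. Datum: $\theta$ is a positive integer; $\Gamma$ is a finite abelian group with identity $e$; $g_i \in \Gamma$ and $\chi_i \in \hat\Gamma := \mathrm{Hom}(\Gamma, \Bbbk^\times)$ ($1 \le i \le \theta$) satisfy $\chi_i(g_i) \ne 1$ and $\chi_i(g_j)\chi_j(g_i) = 1$ for $i \ne j$; $N_i$ denotes the order of $\chi_i(g_i)$; $\lambda_{ij} \in \Bbbk$ ($i<j$) is such that $\lambda_{ij} = 0$ if $g_i g_j = e$ or $\chi_i\chi_j \ne \varepsilon$ (with $\varepsilon$ the trivial character); $\mu_i \in \{0,1\}$ is such that $\mu_i = 0$ if $g_i^{N_i} = e$ or $\chi_i^{N_i} \ne \varepsilon$. $U(\mathcal{D})$ is the algebra generated by the elements $g \in \Gamma$ (satisfying the multiplication relations of $\Gamma$, with $e=1$) and $x_1,\dots,x_\theta$ subject to $g x_i = \chi_i(g)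 x_i g$, $x_j x_i = \chi_i(g_j) x_i x_j + \lambda_{ij}(1 - g_i g_j)$ ($i<j$), $x_i^{N_i} = \mu_i(1 - g_i^{N_i})$. It is a Hopf algebra with $\Delta(g) = g \otimes g$ ($g\in\Gamma$) and $\Delta(x_i) = x_i \otimes g_i + 1 \otimes x_i$. It is known that $\{ g x_1^{m_1}\cdots x_\theta^{m_\theta} \mid g \in \Gamma,\ 0 \le m_i < N_i\}$ is a basis of $U(\mathcal{D})$. *)

theory Defs
  imports "HOL-Algebra.Algebraic_Closure_Type" "HOL-Algebra.QuotRing"
    "HOL-Library.Poly_Mapping"
begin

section \<open>Algebras over a field\<close>

text \<open>
  The ground field is a type \<open>'k\<close>.  A (not necessarily commutative) \<open>'k\<close>-algebra is a
  \<^type>\<open>module\<close> record, i.e. a ring record extended by a scalar multiplication.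
  \<open>KK\<close> is the ground field viewed as a ring record.
\<close>

abbreviation KK :: "'k::field ring"
  where "KK \<equiv> ring_of_type_algebra"

definition lin_span :: "('k::field, 'a, 'e) module_scheme \<Rightarrow> 'a set \<Rightarrow> 'a set"
  where "lin_span M S = (\<lambda>W. submodule W (KK :: 'k ring) M) hull S"

definition is_subalgebra :: "'a set \<Rightarrow> ('k::field, 'a, 'e) module_scheme \<Rightarrow> bool"
  where "is_subalgebra A M \<longleftrightarrow> subring A M \<and> submodule A (KK :: 'k ring) M"

definition gen_subalgebra :: "('k::field, 'a, 'e) module_scheme \<Rightarrow> 'a set \<Rightarrow> 'a set"
  where "gen_subalgebra M S = (\<lambda>A. is_subalgebra A M) hull S"

text \<open>The algebra of finite formal \<open>'k\<close>-linear combinations of elements of a monoid.\<close>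

definition monoid_algebra :: "('m, 'e) monoid_scheme \<Rightarrow> ('k::field, 'm \<Rightarrow>\<^sub>0 'k) module"
  where "monoid_algebra G =
    \<lparr>carrier = {p. Poly_Mapping.keys p \<subseteq> carrier G},
     monoid.mult = (\<lambda>p q. \<Sum>s\<in>Poly_Mapping.keys p. \<Sum>t\<in>Poly_Mapping.keys q.
        Poly_Mapping.single (s \<otimes>\<^bsub>G\<^esub> t) (Poly_Mapping.lookup p s * Poly_Mapping.lookup q t)),
     one = Poly_Mapping.single \<one>\<^bsub>G\<^esub> 1,
     zero = 0,
     add = (+),
     module.smult = (\<lambda>c. Poly_Mapping.map (\<lambda>a. c * a))\<rparr>"

text \<open>The quotient ring \<^term>\<open>R Quot I\<close> with the induced scalar multiplication.\<close>

definition quot_algebra :: "('k::field, 'a, 'e) module_scheme \<Rightarrow> 'a set \<Rightarrow> ('k, 'a set) module"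
  where "quot_algebra R I =
    \<lparr>carrier = carrier (R Quot I),
     monoid.mult = monoid.mult (R Quot I),
     one = one (R Quot I),
     zero = zero (R Quot I),
     add = add (R Quot I),
     module.smult = (\<lambda>c C. \<Union>x\<in>C. I +>\<^bsub>R\<^esub> (c \<odot>\<^bsub>R\<^esub> x))\<rparr>"


section \<open>Free algebras\<close>

definition free_monoid :: "'x set \<Rightarrow> 'x list monoid"
  where "free_monoid S = \<lparr>carrier = lists S, monoid.mult = (@), one = []\<rparr>"

definition free_algebra :: "'x set \<Rightarrow> ('k::field, 'x list \<Rightarrow>\<^sub>0 'k) module"
  where "free_algebra S = monoid_algebra (free_monoid S)"

definition free_gen :: "'x \<Rightarrow> ('x list \<Rightarrow>\<^sub>0 'k::field)"
  where "free_gen x = Poly_Mapping.single [x] 1"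

text \<open>The algebra homomorphism from a free algebra to \<open>T\<close> that sends each generator \<open>x\<close>
  to \<open>f x\<close>.\<close>

definition free_lift ::
    "('k::field, 'b, 'e) module_scheme \<Rightarrow> ('x \<Rightarrow> 'b) \<Rightarrow> ('x list \<Rightarrow>\<^sub>0 'k) \<Rightarrow> 'b"
  where "free_lift T f p = (\<Oplus>\<^bsub>T\<^esub>w\<in>Poly_Mapping.keys p.
     Poly_Mapping.lookup p w \<odot>\<^bsub>T\<^esub> foldr (\<lambda>x r. f x \<otimes>\<^bsub>T\<^esub> r) w \<one>\<^bsub>T\<^esub>)"


section \<open>Tensor products of algebras\<close>

text \<open>
  \<open>M \<otimes> N\<close> is the free vector space on \<^term>\<open>carrier M \<times> carrier N\<close> modulo the bilinearity
  relations.  The free vector space carries the componentwise multiplication of basis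
  elements (it is the monoid algebra of the product of the multiplicative monoids), and the
  relations span a two-sided ideal, so that the quotient is an algebra with
  \<open>(a \<otimes> b) (a' \<otimes> b') = a a' \<otimes> b b'\<close>.
\<close>

definition pre_tensor ::
    "('k::field, 'a, 'e) module_scheme \<Rightarrow> ('k, 'b, 'f) module_scheme
     \<Rightarrow> ('k, 'a \<times> 'b \<Rightarrow>\<^sub>0 'k) module"
  where "pre_tensor M N = monoid_algebra (M \<times>\<times> N)"

definition bilin_rels ::
    "('k::field, 'a, 'e) module_scheme \<Rightarrow> ('k, 'b, 'f) module_scheme \<Rightarrow> ('a \<times> 'b \<Rightarrow>\<^sub>0 'k) set"
  where "bilin_rels M N =
    (let e = (\<lambda>a b. Poly_Mapping.single (a, b) (1::'k)) in
     {e (a \<oplus>\<^bsub>M\<^esub> a') b - e a b - e a' b | a a' b.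
        a \<in> carrier M \<and> a' \<in> carrier M \<and> b \<in> carrier N} \<union>
     {e a (b \<oplus>\<^bsub>N\<^esub> b') - e a b - e a b' | a b b'.
        a \<in> carrier M \<and> b \<in> carrier N \<and> b' \<in> carrier N} \<union>
     {e (c \<odot>\<^bsub>M\<^esub> a) b - Poly_Mapping.single (a, b) c | c a b.
        a \<in> carrier M \<and> b \<in> carrier N} \<union>
     {e a (c \<odot>\<^bsub>N\<^esub> b) - Poly_Mapping.single (a, b) c | c a b.
        a \<in> carrier M \<and> b \<in> carrier N})"

definition bilin_ideal ::
    "('k::field, 'a, 'e) module_scheme \<Rightarrow> ('k, 'b, 'f) module_scheme \<Rightarrow> ('a \<times> 'b \<Rightarrow>\<^sub>0 'k) set"
  where "bilin_ideal M N = lin_span (pre_tensor M N) (bilin_rels M N)"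

definition tensor_algebra ::
    "('k::field, 'a, 'e) module_scheme \<Rightarrow> ('k, 'b, 'f) module_scheme
     \<Rightarrow> ('k, ('a \<times> 'b \<Rightarrow>\<^sub>0 'k) set) module"
  where "tensor_algebra M N = quot_algebra (pre_tensor M N) (bilin_ideal M N)"

definition pure_tensor ::
    "('k::field, 'a, 'e) module_scheme \<Rightarrow> ('k, 'b, 'f) module_scheme
     \<Rightarrow> 'a \<Rightarrow> 'b \<Rightarrow> ('a \<times> 'b \<Rightarrow>\<^sub>0 'k) set"
  where "pure_tensor M N a b =
    bilin_ideal M N +>\<^bsub>pre_tensor M N\<^esub> Poly_Mapping.single (a, b) 1"

text \<open>The image of \<open>V \<otimes> W\<close> in \<open>M \<otimes> N\<close> for subspaces \<open>V\<close> of \<open>M\<close> and \<open>W\<close> of \<open>N\<close>.\<close>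

definition tensor_subspace ::
    "('k::field, 'a, 'e) module_scheme \<Rightarrow> ('k, 'b, 'f) module_scheme
     \<Rightarrow> 'a set \<Rightarrow> 'b set \<Rightarrow> ('a \<times> 'b \<Rightarrow>\<^sub>0 'k) set set"
  where "tensor_subspace M N V W =
    lin_span (tensor_algebra M N) {pure_tensor M N v w | v w. v \<in> V \<and> w \<in> W}"


section \<open>The Hopf algebra of a datum\<close>

text \<open>Only the values of \<open>gel\<close>, \<open>chi\<close> and \<open>mu\<close> at \<open>i \<in> {1..theta}\<close>, the values of \<open>chi i\<close> on the
  carrier of the group, and the values of \<open>lam i j\<close> for \<open>1 \<le> i < j \<le> theta\<close> matter.\<close>

record ('g, 'k) datum =
  grp :: "'g monoid"
  theta :: nat
  gel :: "nat \<Rightarrow> 'g"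
  chi :: "nat \<Rightarrow> 'g \<Rightarrow> 'k"
  lam :: "nat \<Rightarrow> nat \<Rightarrow> 'k"
  mu :: "nat \<Rightarrow> 'k"

text \<open>The order \<open>N\<^sub>i\<close> of \<open>\<chi>\<^sub>i(g\<^sub>i)\<close> in the multiplicative group of the field.\<close>

definition NN :: "('g, 'k::field) datum \<Rightarrow> nat \<Rightarrow> nat"
  where "NN D i = group.ord (mult_of (KK :: 'k ring)) (chi D i (gel D i))"

definition is_datum :: "('g, 'k::field) datum \<Rightarrow> bool"
  where "is_datum D \<longleftrightarrow>
    comm_group (grp D) \<and> finite (carrier (grp D)) \<and> theta D \<ge> 1 \<and>
    (\<forall>i\<in>{1..theta D}.
       gel D i \<in> carrier (grp D) \<and>
       chi D i \<in> hom (grp D) (mult_of (KK :: 'k ring)) \<and>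
       chi D i (gel D i) \<noteq> 1) \<and>
    (\<forall>i\<in>{1..theta D}. \<forall>j\<in>{1..theta D}. i \<noteq> j \<longrightarrow>
       chi D i (gel D j) * chi D j (gel D i) = 1) \<and>
    (\<forall>i\<in>{1..theta D}. \<forall>j\<in>{1..theta D}. i < j \<longrightarrow>
       gel D i \<otimes>\<^bsub>grp D\<^esub> gel D j = \<one>\<^bsub>grp D\<^esub> \<or>
       (\<exists>h\<in>carrier (grp D). chi D i h * chi D j h \<noteq> 1) \<longrightarrow>
       lam D i j = 0) \<and>
    (\<forall>i\<in>{1..theta D}. mu D i \<in> {0, 1} \<and>
       (gel D i [^]\<^bsub>grp D\<^esub> NN D i = \<one>\<^bsub>grp D\<^esub> \<or>
        (\<exists>h\<in>carrier (grp D). chi D i h ^ NN D i \<noteq> 1) \<longrightarrow>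
        mu D i = 0))"

text \<open>Letters \<open>Inl h\<close> stand for group elements \<open>h\<close> and letters \<open>Inr i\<close> for \<open>x\<^sub>i\<close>.\<close>

definition FF :: "('g, 'k::field) datum \<Rightarrow> ('k, ('g + nat) list \<Rightarrow>\<^sub>0 'k) module"
  where "FF D = free_algebra (Inl ` carrier (grp D) \<union> Inr ` {1..theta D})"

definition U_rels :: "('g, 'k::field) datum \<Rightarrow> (('g + nat) list \<Rightarrow>\<^sub>0 'k) set"
  where "U_rels D =
    (let F = FF D; G = grp D; g = gel D;
         gr = (\<lambda>h. free_gen (Inl h)); x = (\<lambda>i. free_gen (Inr i)) in
     {gr h \<otimes>\<^bsub>F\<^esub> gr h' \<ominus>\<^bsub>F\<^esub> gr (h \<otimes>\<^bsub>G\<^esub> h') | h h'. h \<in> carrier G \<and> h' \<in> carrier G} \<union>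
     {gr \<one>\<^bsub>G\<^esub> \<ominus>\<^bsub>F\<^esub> \<one>\<^bsub>F\<^esub>} \<union>
     {gr h \<otimes>\<^bsub>F\<^esub> x i \<ominus>\<^bsub>F\<^esub> chi D i h \<odot>\<^bsub>F\<^esub> (x i \<otimes>\<^bsub>F\<^esub> gr h) | h i.
        h \<in> carrier G \<and> i \<in> {1..theta D}} \<union>
     {x j \<otimes>\<^bsub>F\<^esub> x i \<ominus>\<^bsub>F\<^esub>
        (chi D i (g j) \<odot>\<^bsub>F\<^esub> (x i \<otimes>\<^bsub>F\<^esub> x j) \<oplus>\<^bsub>F\<^esub>
         lam D i j \<odot>\<^bsub>F\<^esub> (\<one>\<^bsub>F\<^esub> \<ominus>\<^bsub>F\<^esub> gr (g i \<otimes>\<^bsub>G\<^esub> g j))) | i j.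
        i \<in> {1..theta D} \<and> j \<in> {1..theta D} \<and> i < j} \<union>
     {x i [^]\<^bsub>F\<^esub> NN D i \<ominus>\<^bsub>F\<^esub>
        mu D i \<odot>\<^bsub>F\<^esub> (\<one>\<^bsub>F\<^esub> \<ominus>\<^bsub>F\<^esub> gr (g i [^]\<^bsub>G\<^esub> NN D i)) | i.
        i \<in> {1..theta D}})"

definition U_ideal :: "('g, 'k::field) datum \<Rightarrow> (('g + nat) list \<Rightarrow>\<^sub>0 'k) set"
  where "U_ideal D = Idl\<^bsub>FF D\<^esub> (U_rels D)"

definition UU :: "('g, 'k::field) datum \<Rightarrow> ('k, (('g + nat) list \<Rightarrow>\<^sub>0 'k) set) module"
  where "UU D = quot_algebra (FF D) (U_ideal D)"

definition U_grp :: "('g, 'k::field) datum \<Rightarrow> 'g \<Rightarrow> (('g + nat) list \<Rightarrow>\<^sub>0 'k) set"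
  where "U_grp D h = U_ideal D +>\<^bsub>FF D\<^esub> free_gen (Inl h)"

definition U_x :: "('g, 'k::field) datum \<Rightarrow> nat \<Rightarrow> (('g + nat) list \<Rightarrow>\<^sub>0 'k) set"
  where "U_x D i = U_ideal D +>\<^bsub>FF D\<^esub> free_gen (Inr i)"

fun comult_gen ::
    "('g, 'k::field) datum \<Rightarrow> 'g + nat
     \<Rightarrow> ((('g + nat) list \<Rightarrow>\<^sub>0 'k) set \<times> (('g + nat) list \<Rightarrow>\<^sub>0 'k) set \<Rightarrow>\<^sub>0 'k) set"
  where
    "comult_gen D (Inl h) = pure_tensor (UU D) (UU D) (U_grp D h) (U_grp D h)"
  | "comult_gen D (Inr i) =
       pure_tensor (UU D) (UU D) (U_x D i) (U_grp D (gel D i))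
       \<oplus>\<^bsub>tensor_algebra (UU D) (UU D)\<^esub>
       pure_tensor (UU D) (UU D) \<one>\<^bsub>UU D\<^esub> (U_x D i)"

text \<open>
  The comultiplication \<open>\<Delta> : U \<rightarrow> U \<otimes> U\<close>: the homomorphism on the free algebra given by the
  values on generators is constant on the cosets of the ideal of relations, and \<open>\<Delta>\<close> maps a
  coset to that constant.
\<close>

definition comult ::
    "('g, 'k::field) datum \<Rightarrow> (('g + nat) list \<Rightarrow>\<^sub>0 'k) set
     \<Rightarrow> ((('g + nat) list \<Rightarrow>\<^sub>0 'k) set \<times> (('g + nat) list \<Rightarrow>\<^sub>0 'k) set \<Rightarrow>\<^sub>0 'k) set"
  where "comult D C =
    the_elem (free_lift (tensor_algebra (UU D) (UU D)) (comult_gen D) ` C)"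

definition right_coideal_subalgebra ::
    "('g, 'k::field) datum \<Rightarrow> (('g + nat) list \<Rightarrow>\<^sub>0 'k) set set \<Rightarrow> bool"
  where "right_coideal_subalgebra D A \<longleftrightarrow>
    is_subalgebra A (UU D) \<and>
    comult D ` A \<subseteq> tensor_subspace (UU D) (UU D) A (carrier (UU D))"

end

(*
Write D_f = (id (x) f) Delta for the operator attached to a linear functional f on U; it maps every
right coideal subalgebra A into itself.  Filter U by the degree in the x_i.  If f vanishes in degrees
below n - 1, then D_f of a monomial g x^m of degree n is f(g x^m) g plus a combination of the elements
g x_i with coefficients f(g g_i x^(m - e_i)) times a nonzero q-integer.

No PBW theorem is needed.  Choose a minimal set I of indices such that the x_i with i in I generate
U over the group.  Applying the operators D_f to a linear relation lowers its degree, so minimality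
of I forces the monomials g x^m with m supported on I (and m_i < N_i) to be linearly independent.

Choose then a maximal P contained in I such that A contains elements v_p = x_p + (terms in the x_j
with j in I - P, and in the group) for p in P.  Subtracting multiples of g v^m one can remove
from an element of A all leading monomials supported on P.  If a leading monomial is left over,
a suitable D_f turns the element into an element of degree one that would enlarge P.  Hence, by
induction on the degree, A is generated by its elements of degree at most one.
*)
theory Submission
  imports Defs
begin

section \<open>Linear functionals and independent families\<close>

text \<open>The q-integer in D_f(g x^m) is 1 + q + ... + q^(m_i - 1), where q is the inverse of
  chi_i(g_i) and so has order N_i; m_i < N_i keeps it nonzero.

  Two obstacles shape the argument. First, a pivot is obtained only after division by a group
  element, and A need not be stable under the antipode. But the group part g of each leading
  monomial of an element of A lies in A (take f dual to the monomial), and the group elements of A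
  form a finite cancellative monoid, hence a group. Second, for f dual to g g_i x^(m - e_i) the
  operator does not single out g x_i: every letter j in I may enter, through the monomial in which j
  replaces i. For j in P this is ruled out by induction on the number of letters outside P, which
  drops when i is traded for j; letters outside P may stay, as a pivot element may contain them.

  Since U is not known in advance to be nonzero, the case 1 = 0 is treated separately. That the
  coproduct is well defined is also proved; for the power relations this is the q-binomial theorem
  at a root of unity.\<close>

definition linear_functional :: "('k::field \<Rightarrow> 'v::ab_group_add \<Rightarrow> 'v) \<Rightarrow> ('v \<Rightarrow> 'k) \<Rightarrow> bool"
  where "linear_functional s f \<longleftrightarrow> (\<forall>a b. f (a + b) = f a + f b) \<and>
      (\<forall>c a. f (s c a) = c * f a)"

text \<open>Independence of a family, not of a set: it forces the members to be distinct, so that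
  different indices \<open>(g, w)\<close> give different monomials. Over an infinite index set the
  sum is 0 by convention; \<open>B\<close> is meant to be finite.\<close>

definition indep_family :: "('k::field \<Rightarrow> 'v::ab_group_add \<Rightarrow> 'v) \<Rightarrow> 'i set \<Rightarrow> ('i \<Rightarrow> 'v) \<Rightarrow> bool"
  where "indep_family s B h \<longleftrightarrow> (\<forall>c. (\<Sum>b\<in>B. s (c b) (h b)) = 0 \<longrightarrow> (\<forall>b\<in>B. c b = 0))"

context vector_space
begin

lemma linear_functional_add: "linear_functional scale f \<Longrightarrow> f (a + b) = f a + f b"
  and linear_functional_scale: "linear_functional scale f \<Longrightarrow> f (c *s a) = c * f a"
  by (auto simp: linear_functional_def)

lemma linear_functional_zero: "linear_functional scale f \<Longrightarrow> f 0 = 0"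
  using linear_functional_scale[of f 0 0] by simp

lemma linear_functional_sum: "linear_functional scale f \<Longrightarrow> f (sum h B) = (\<Sum>b\<in>B. f (h b))"
  by (induction B rule: infinite_finite_induct) (auto simp: linear_functional_zero linear_functional_add)

lemma linear_functional_span_zero:
  assumes "linear_functional scale f" "\<And>b. b \<in> B \<Longrightarrow> f b = 0" "a \<in> span B"
  shows "f a = 0"
  using assms(3)
  by (induction rule: span_induct_alt) (auto
      simp: linear_functional_zero linear_functional_add linear_functional_scale assms)

text \<open>Since \<open>v\<close> extends a basis of \<open>span B\<close> to an independent set,
  the values 0 on that basis and 1 at \<open>v\<close> can be prescribed.\<close>

lemma linear_functional_separating:
  assumes "v \<notin> span B"
  obtains f where "linear_functional scale f" "\<And>b. b \<in> span B \<Longrightarrow> f b = 0" "f v = 1"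
proof -
  interpret K: vector_space "(*) :: 'a \<Rightarrow> 'a \<Rightarrow> 'a"
    by unfold_locales (auto simp: algebra_simps)
  interpret P: vector_space_pair scale "(*) :: 'a \<Rightarrow> 'a \<Rightarrow> 'a"
    by unfold_locales
  obtain B' where B': "B' \<subseteq> B" "independent B'" "B \<subseteq> span B'"
    using maximal_independent_subset[of B] by auto
  have sp: "span B' = span B"
    using B' span_mono span_minimal subspace_span by (metis subset_antisym)
  have "independent (insert v B')"
    using assms sp B' by (simp add: independent_insertI)
  then obtain g where g: "Vector_Spaces.linear scale (*) g"
      "\<forall>b\<in>insert v B'. g b = (if b = v then 1 else 0)"
    using P.linear_independent_extend[of "insert v B'" "\<lambda>b. if b = v then 1 else 0"] by metis
  have lin: "linear_functional scale g"
    using g(1) by (simp add: linear_functional_def Vector_Spaces.linear_iff)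
  have "v \<notin> B'" using assms sp span_superset by blast
  then have "g b = 0" if "b \<in> B'" for b using g(2) that by auto
  then have "g b = 0" if "b \<in> span B" for b
    using linear_functional_span_zero[OF lin] that sp by metis
  then show ?thesis using that lin g(2) by simp
qed

lemma span_family:
  assumes "finite B"
  shows "a \<in> span (h ` B) \<longleftrightarrow> (\<exists>c. a = (\<Sum>b\<in>B. c b *s h b))"
proof
  assume "a \<in> span (h ` B)"
  then show "\<exists>c. a = (\<Sum>b\<in>B. c b *s h b)"
  proof (induction rule: span_induct_alt)
    case base
    then show ?case by (rule exI[of _ "\<lambda>_. 0"]) simp
  next
    case (step r v w)
    then obtain c b where c: "w = (\<Sum>b\<in>B. c b *s h b)" and b: "b \<in> B" "v = h b" by auto
    have "r *s v = (\<Sum>b'\<in>B. (if b' = b then r else 0) *s h b')"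
      using b assms by (simp add: if_distrib[of "\<lambda>r. r *s _"] cong: if_cong)
    then show ?case
      by (intro exI[of _ "\<lambda>b'. (if b' = b then r else 0) + c b'"])
        (simp add: c scale_left_distrib sum.distrib)
  qed
next
  assume "\<exists>c. a = (\<Sum>b\<in>B. c b *s h b)"
  then show "a \<in> span (h ` B)" by (auto intro!: span_sum span_scale intro: span_base)
qed

text \<open>A member of the dual basis: \<open>h b0\<close> is separated from the span of the other
  members. The operators \<open>D f\<close> are later applied with \<open>f\<close> dual to a
  monomial in this sense.\<close>

lemma indep_family_dual:
  fixes h :: "'i \<Rightarrow> 'b"
  assumes "finite B" "indep_family scale B h" "b0 \<in> B"
  obtains f where "linear_functional scale f" "\<And>b. b \<in> B \<Longrightarrow> f (h b) = (if b = b0 then 1 else 0)"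
proof -
  have "h b0 \<notin> span (h ` (B - {b0}))"
  proof
    assume "h b0 \<in> span (h ` (B - {b0}))"
    then obtain c where c: "h b0 = (\<Sum>b\<in>B - {b0}. c b *s h b)"
      using span_family[of "B - {b0}"] assms(1) by auto
    \<comment> \<open>The coefficient -1 at \<open>b0\<close> makes this relation
      nontrivial.\<close>
    have "(\<Sum>b\<in>B. (if b = b0 then -1 else c b) *s h b) = 0"
      using assms by (simp add: sum.remove[of B b0] c)
    then show False
      using assms(2,3) unfolding indep_family_def by fastforce
  qed
  then obtain f where f: "linear_functional scale f" "\<And>b. b \<in> span (h ` (B - {b0})) \<Longrightarrow>
      f b = 0" "f (h b0) = 1"
    by (rule linear_functional_separating) blast
  show ?thesis
  proof (rule that[OF f(1)])
    fix b assume "b \<in> B"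
    then show "f (h b) = (if b = b0 then 1 else 0)"
      using f by (auto intro: span_base)
  qed
qed

end

section \<open>Right coideal subalgebras in a vector space with operators\<close>

text \<open>\<open>D f\<close> stands for \<open>(id \<otimes> f) \<Delta>\<close>; the three recursion rules
  for it replace the coproduct.  The product \<open>\<star>\<close> is defined on the whole type, but \<open>e\<close>
  is a unit only on the subspace \<open>C\<close> generated by the group and the \<open>x i\<close>.\<close>

locale coideal_setting = vector_space scale
  for scale :: "'k::field \<Rightarrow> 'v::ab_group_add \<Rightarrow> 'v" (infixr "*s" 75) +
  fixes mul :: "'v \<Rightarrow> 'v \<Rightarrow> 'v" (infixl "\<star>" 76)
    and e :: 'v and G :: "'v set" and J :: "nat set"
    and x gl :: "nat \<Rightarrow> 'v" and N :: "nat \<Rightarrow> nat" and comm :: "nat \<Rightarrow> nat \<Rightarrow> 'k"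
    and D :: "('v \<Rightarrow> 'k) \<Rightarrow> 'v \<Rightarrow> 'v" and C :: "'v set"
  assumes mul_add_left: "(a + b) \<star> c = a \<star> c + b \<star> c"
    and mul_add_right: "a \<star> (b + c) = a \<star> b + a \<star> c"
    and mul_scale_left: "(r *s a) \<star> b = r *s (a \<star> b)"
    and mul_scale_right: "a \<star> (r *s b) = r *s (a \<star> b)"
    and mul_assoc: "a \<star> b \<star> c = a \<star> (b \<star> c)"
    and finite_G: "finite G"
    and e_in_G: "e \<in> G"
    and mul_in_G: "\<And>g h. g \<in> G \<Longrightarrow> h \<in> G \<Longrightarrow> g \<star> h \<in> G"
    and inverse_in_G: "\<And>g. g \<in> G \<Longrightarrow> \<exists>h\<in>G. h \<star> g = e \<and> g \<star> h = e"
    and e_mul_G: "\<And>g. g \<in> G \<Longrightarrow> e \<star> g = g"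
    and G_mul_e: "\<And>g. g \<in> G \<Longrightarrow> g \<star> e = g"
    and finite_J: "finite J"
    and e_mul_x: "\<And>i. i \<in> J \<Longrightarrow> e \<star> x i = x i"
    and x_mul_e: "\<And>i. i \<in> J \<Longrightarrow> x i \<star> e = x i"
    and gl_in_G: "\<And>i. i \<in> J \<Longrightarrow> gl i \<in> G"
    and N_ge_2: "\<And>i. i \<in> J \<Longrightarrow> N i \<ge> 2"
    and x_mul_g: "\<And>i g. i \<in> J \<Longrightarrow> g \<in> G \<Longrightarrow>
        \<exists>c. x i \<star> g = c *s (g \<star> x i)"
    and x_mul_gl: "\<And>i j. i \<in> J \<Longrightarrow> j \<in> J \<Longrightarrow>
        x j \<star> gl i = comm j i *s (gl i \<star> x j)"
    and comm_nonzero: "\<And>i j. i \<in> J \<Longrightarrow> j \<in> J \<Longrightarrow> comm j i \<noteq> 0"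
    and comm_order: "\<And>i m. i \<in> J \<Longrightarrow> 0 < m \<Longrightarrow> m < N i \<Longrightarrow>
        (\<Sum>a<m. comm i i ^ a) \<noteq> 0"
    and x_swap: "\<And>i j. i \<in> J \<Longrightarrow> j \<in> J \<Longrightarrow> i \<noteq> j \<Longrightarrow>
        \<exists>c. x j \<star> x i - c *s (x i \<star> x j) \<in> span G"
    and x_power: "\<And>i. i \<in> J \<Longrightarrow> ((\<lambda>a. x i \<star> a) ^^ N i) e \<in> span G"
    and D_add: "\<And>f a b. linear_functional scale f \<Longrightarrow> D f (a + b) = D f a + D f b"
    and D_scale: "\<And>f r a. linear_functional scale f \<Longrightarrow> D f (r *s a) = r *s D f a"
    and D_e: "\<And>f. linear_functional scale f \<Longrightarrow> D f e = f e *s e"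
    and D_g: "\<And>f g a. linear_functional scale f \<Longrightarrow> g \<in> G \<Longrightarrow>
        D f (g \<star> a) = g \<star> D (\<lambda>b. f (g \<star> b)) a"
    and D_x: "\<And>f i a. linear_functional scale f \<Longrightarrow> i \<in> J \<Longrightarrow>
      D f (x i \<star> a) = x i \<star> D (\<lambda>b. f (gl i \<star> b)) a + D (\<lambda>b. f (x i \<star> b)) a"
    and C_induct: "\<And>W a. subspace W \<Longrightarrow> e \<in> W \<Longrightarrow> (\<And>g a. g \<in> G \<Longrightarrow>
        a \<in> W \<Longrightarrow> g \<star> a \<in> W) \<Longrightarrow>
      (\<And>i a. i \<in> J \<Longrightarrow> a \<in> W \<Longrightarrow> x i \<star> a \<in> W) \<Longrightarrow>
          a \<in> C \<Longrightarrow> a \<in> W"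
begin

lemma mul_zero_right [simp]: "a \<star> 0 = 0"
  using mul_scale_right[of a 0 0] by simp

lemma mul_zero_left [simp]: "0 \<star> a = 0"
  using mul_scale_left[of 0 0 a] by simp

lemma mul_sum_right: "a \<star> sum h B = (\<Sum>b\<in>B. a \<star> h b)"
  by (induction B rule: infinite_finite_induct) (auto simp: mul_add_right)

lemma mul_diff_right: "a \<star> (b - c) = a \<star> b - a \<star> c"
  by (metis add_diff_cancel diff_add_cancel mul_add_right)

lemma mul_diff_left: "(b - c) \<star> a = b \<star> a - c \<star> a"
  by (metis add_diff_cancel diff_add_cancel mul_add_left)

lemma linear_functional_mul: "linear_functional scale f \<Longrightarrow>
    linear_functional scale (\<lambda>b. f (a \<star> b))"
  by (simp add: linear_functional_def mul_add_right mul_scale_right)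

lemma D_zero: "linear_functional scale f \<Longrightarrow> D f 0 = 0"
  using D_scale[of f 0 0] by simp

lemma D_sum: "linear_functional scale f \<Longrightarrow> D f (sum h B) = (\<Sum>b\<in>B. D f (h b))"
  by (induction B rule: infinite_finite_induct) (auto simp: D_zero D_add)

section \<open>Words in the letters and the filtration by degree\<close>

definition word_prod :: "nat list \<Rightarrow> 'v"
  where "word_prod w = foldr (\<lambda>i a. x i \<star> a) w e"

lemma word_prod_Nil [simp]: "word_prod [] = e" and word_prod_Cons [simp]: "word_prod (i # w) = x i \<star> word_prod w"
  by (auto simp: word_prod_def)

lemma e_mul_word_prod: "set w \<subseteq> J \<Longrightarrow> e \<star> word_prod w = word_prod w"
  by (cases w) (auto simp: e_mul_G e_in_G mul_assoc[symmetric] e_mul_x)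

lemma word_prod_append: "set v \<subseteq> J \<Longrightarrow> word_prod (w @ v) = word_prod w \<star> word_prod v"
  by (induction w) (auto simp: mul_assoc e_mul_word_prod)

text \<open>For the final reduction: what may remain in degree at most \<open>n\<close> once the
  words of length \<open>n\<close> over \<open>P\<close> have been cancelled. With
  \<open>P = I\<close> the second alternative is impossible, and the same definition yields the
  filtration by degree.\<close>

definition Fil_mod :: "nat set \<Rightarrow> nat set \<Rightarrow> nat \<Rightarrow> 'v set"
  where "Fil_mod I P n = span {g \<star> word_prod w | g w. g \<in> G \<and> set w \<subseteq> I \<and>
    (length w < n \<or> length w = n \<and> \<not> set w \<subseteq> P)}"

lemma subspace_Fil_mod: "subspace (Fil_mod I P n)"
  by (simp add: Fil_mod_def)

lemma Fil_mod_base: "g \<in> G \<Longrightarrow> set w \<subseteq> I \<Longrightarrow>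
    length w < n \<or> length w = n \<and> \<not> set w \<subseteq> P \<Longrightarrow>
    g \<star> word_prod w \<in> Fil_mod I P n"
  unfolding Fil_mod_def by (rule span_base) blast

lemma Fil_mod_minimal:
  assumes "subspace W" "\<And>g w. g \<in> G \<Longrightarrow> set w \<subseteq> I \<Longrightarrow>
    length w < n \<or> length w = n \<and> \<not> set w \<subseteq> P \<Longrightarrow> g \<star> word_prod w \<in> W"
  shows "Fil_mod I P n \<subseteq> W"
  unfolding Fil_mod_def using assms by (intro span_minimal) auto

text \<open>Words of length \<open>n\<close> are excluded: \<open>Fil I n\<close> consists of the elements of degree less than \<open>n\<close>.\<close>

abbreviation Fil :: "nat set \<Rightarrow> nat \<Rightarrow> 'v set"
  where "Fil I n \<equiv> Fil_mod I I n"

lemma Fil_0 [simp]: "Fil I 0 = {0}"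
proof -
  have "{g \<star> word_prod w | g w. g \<in> G \<and> set w \<subseteq> I \<and>
      (length w < 0 \<or> length w = 0 \<and> \<not> set w \<subseteq> I)} = {}" by auto
  then show ?thesis unfolding Fil_mod_def by (simp only: span_empty)
qed

lemmas subspace_Fil = subspace_Fil_mod

lemma Fil_base: "g \<in> G \<Longrightarrow> set w \<subseteq> I \<Longrightarrow> length w < n \<Longrightarrow>
    g \<star> word_prod w \<in> Fil I n"
  by (simp add: Fil_mod_base)

lemma Fil_add: "a \<in> Fil I n \<Longrightarrow> b \<in> Fil I n \<Longrightarrow> a + b \<in> Fil I n"
  and Fil_diff: "a \<in> Fil I n \<Longrightarrow> b \<in> Fil I n \<Longrightarrow> a - b \<in> Fil I n"
  and Fil_scale: "a \<in> Fil I n \<Longrightarrow> r *s a \<in> Fil I n"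
  by (auto simp: Fil_mod_def span_add span_diff span_scale)

lemma Fil_minimal:
  assumes "subspace W" "\<And>g w. g \<in> G \<Longrightarrow> set w \<subseteq> I \<Longrightarrow> length w < n \<Longrightarrow>
      g \<star> word_prod w \<in> W"
  shows "Fil I n \<subseteq> W"
  using assms by (intro Fil_mod_minimal) auto

lemma Fil_mono: "n \<le> m \<Longrightarrow> Fil I n \<subseteq> Fil I m"
  by (rule Fil_minimal[OF subspace_Fil]) (simp add: Fil_base)

lemma Fil_1: "Fil I 1 = span G"
proof
  show "Fil I 1 \<subseteq> span G"
    by (rule Fil_minimal) (auto simp: G_mul_e intro: span_base)
  have "g \<in> Fil I 1" if "g \<in> G" for g
    using Fil_base[OF that, of "[]" I 1] that by (simp add: G_mul_e)
  then show "span G \<subseteq> Fil I 1" by (intro span_minimal subspace_Fil) auto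
qed

lemma subspace_mul_preimage: "subspace W \<Longrightarrow> subspace {b. a \<star> b \<in> W}"
  and subspace_mul_preimage': "subspace W \<Longrightarrow> subspace {b. b \<star> a \<in> W}"
  by (auto simp: subspace_def mul_add_left mul_add_right mul_scale_left mul_scale_right)

lemma g_mul_Fil_mod:
  assumes "g \<in> G" "a \<in> Fil_mod I P n"
  shows "g \<star> a \<in> Fil_mod I P n"
proof -
  have "Fil_mod I P n \<subseteq> {b. g \<star> b \<in> Fil_mod I P n}"
    using assms(1)
    by (intro Fil_mod_minimal subspace_mul_preimage subspace_Fil_mod)
      (simp add: mul_assoc[symmetric] Fil_mod_base mul_in_G)
  then show ?thesis using assms(2) by auto
qed

text \<open>The letter moves to the right of \<open>g\<close> at the cost of a scalar, and a word
  that leaves \<open>P\<close> still does so with one more letter.\<close>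

lemma x_mul_Fil_mod:
  assumes "I \<subseteq> J" "i \<in> I" "a \<in> Fil_mod I P n"
  shows "x i \<star> a \<in> Fil_mod I P (Suc n)"
proof -
  have "x i \<star> (g \<star> word_prod w) \<in> Fil_mod I P (Suc n)"
    if w: "g \<in> G" "set w \<subseteq> I" "length w < n \<or> length w = n \<and> \<not> set w \<subseteq> P" for g w
  proof -
    obtain c where "x i \<star> g = c *s (g \<star> x i)" using x_mul_g w assms by blast
    then have "x i \<star> (g \<star> word_prod w) = c *s (g \<star> word_prod (i # w))"
      by (simp add: mul_assoc[symmetric] mul_scale_left)
    moreover have "g \<star> word_prod (i # w) \<in> Fil_mod I P (Suc n)"
      using w assms(2) by (intro Fil_mod_base) auto
    ultimately show ?thesis by (simp add: subspace_scale[OF subspace_Fil_mod])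
  qed
  then have "Fil_mod I P n \<subseteq> {b. x i \<star> b \<in> Fil_mod I P (Suc n)}"
    by (intro Fil_mod_minimal subspace_mul_preimage subspace_Fil_mod) auto
  then show ?thesis using assms(3) by auto
qed

lemmas g_mul_Fil = g_mul_Fil_mod and x_mul_Fil = x_mul_Fil_mod

lemma spanG_mul_Fil:
  assumes "u \<in> span G" "a \<in> Fil I n"
  shows "u \<star> a \<in> Fil I n"
proof -
  have "span G \<subseteq> {b. b \<star> a \<in> Fil I n}"
    using assms(2) by (intro span_minimal subspace_mul_preimage' subspace_Fil) (auto simp: g_mul_Fil)
  then show ?thesis using assms(1) by auto
qed

lemma word_prod_mul_Fil:
  assumes "I \<subseteq> J" "set w \<subseteq> I" "a \<in> Fil I n"
  shows "word_prod w \<star> a \<in> Fil I (n + length w)"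
  using assms(2)
proof (induction w)
  case Nil
  then show ?case using g_mul_Fil[OF e_in_G] assms by auto
next
  case (Cons i w)
  then show ?case using x_mul_Fil[OF assms(1)] by (auto simp: mul_assoc)
qed

section \<open>Straightening of words\<close>

lemma word_prod_in_Fil: "I \<subseteq> J \<Longrightarrow> set w \<subseteq> I \<Longrightarrow> length w < n \<Longrightarrow>
    word_prod w \<in> Fil I n"
  using Fil_base[OF e_in_G, of w I n] e_mul_word_prod[of w] by simp

text \<open>By \<open>x_swap\<close>, exchanging two letters costs a term in which both are replaced
  by an element of \<open>span G\<close>. So the errors lose two degrees: elements of
  \<open>Fil I (length s)\<close> have degree less than \<open>length s\<close>, while
  \<open>i # s\<close> has length \<open>length s + 1\<close>.\<close>

lemma word_prod_insort:
  assumes "I \<subseteq> J" "i \<in> I" "set s \<subseteq> I"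
  shows "\<exists>c. word_prod (i # s) - c *s word_prod (insort i s) \<in> Fil I (length s)"
  using assms(2,3)
proof (induction s arbitrary: i)
  case Nil
  show ?case by (rule exI[of _ 1]) simp
next
  case (Cons j s)
  show ?case
  proof (cases "i \<le> j")
    case True
    then show ?thesis
      by (intro exI[of _ 1]) (simp add: subspace_0[OF subspace_Fil])
  next
    case False
    then have "i \<in> J" "j \<in> J" "i \<noteq> j" using Cons.prems assms by auto
    then obtain c where c: "x i \<star> x j - c *s (x j \<star> x i) \<in> span G"
      using x_swap[of j i] by auto
    obtain c' where c': "word_prod (i # s) - c' *s word_prod (insort i s) \<in> Fil I (length s)"
      using Cons by fastforce
    have "(x i \<star> x j - c *s (x j \<star> x i)) \<star> word_prod s \<in> Fil I (Suc (length s))"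
      by (rule spanG_mul_Fil[OF c word_prod_in_Fil]) (use assms Cons.prems in auto)
    moreover have "c *s (x j \<star> (word_prod (i # s) - c' *s word_prod (insort i s))) \<in> Fil I (Suc (length s))"
      using Cons.prems by (intro Fil_scale x_mul_Fil[OF assms(1) _ c']) auto
    ultimately have "(x i \<star> x j - c *s (x j \<star> x i)) \<star> word_prod s
        + c *s (x j \<star> (word_prod (i # s) - c' *s word_prod (insort i s))) \<in> Fil I (Suc (length s))"
      by (rule Fil_add)
    also have "(x i \<star> x j - c *s (x j \<star> x i)) \<star> word_prod s
        + c *s (x j \<star> (word_prod (i # s) - c' *s word_prod (insort i s)))
        = word_prod (i # j # s) - (c * c') *s word_prod (insort i (j # s))"
      using False by (simp add: mul_diff_left mul_diff_right mul_scale_left mul_scale_right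
          mul_assoc scale_right_diff_distrib)
    finally show ?thesis by auto
  qed
qed

lemma word_prod_sort:
  assumes "I \<subseteq> J" "set w \<subseteq> I"
  shows "\<exists>c. word_prod w - c *s word_prod (sort w) \<in> Fil I (length w)"
  using assms(2)
proof (induction w)
  case Nil
  show ?case by (rule exI[of _ 1]) simp
next
  case (Cons i w)
  then obtain c where c: "word_prod w - c *s word_prod (sort w) \<in> Fil I (length w)" by auto
  obtain c' where c': "word_prod (i # sort w) - c' *s word_prod (insort i (sort w)) \<in> Fil I (length w)"
    using word_prod_insort[OF assms(1), of i "sort w"] Cons.prems by auto
  have "x i \<star> (word_prod w - c *s word_prod (sort w)) \<in> Fil I (Suc (length w))"
    using x_mul_Fil[OF assms(1) _ c] Cons.prems by auto
  moreover have "c *s (word_prod (i # sort w) - c' *s word_prod (insort i (sort w))) \<in> Fil I (Suc (length w))"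
    using c' Fil_mono[of "length w" "Suc (length w)"] by (intro Fil_scale) auto
  ultimately have "x i \<star> (word_prod w - c *s word_prod (sort w))
      + c *s (word_prod (i # sort w) - c' *s word_prod (insort i (sort w))) \<in> Fil I (Suc (length w))"
    by (rule Fil_add)
  also have "x i \<star> (word_prod w - c *s word_prod (sort w))
      + c *s (word_prod (i # sort w) - c' *s word_prod (insort i (sort w)))
      = word_prod (i # w) - (c * c') *s word_prod (sort (i # w))"
    by (simp add: mul_diff_right mul_scale_right scale_right_diff_distrib)
  finally show ?case by auto
qed

text \<open>Exponent vectors \<open>m\<close> on \<open>I\<close> with \<open>m_i < N i\<close>,
  encoded as sorted words: lowering or raising an exponent by one becomes \<open>remove1\<close> or
  \<open>insort\<close>.\<close>

definition good :: "nat set \<Rightarrow> nat list \<Rightarrow> bool"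
  where "good I w \<longleftrightarrow> sorted w \<and> set w \<subseteq> I \<and>
      (\<forall>i. i \<in> set w \<longrightarrow> count_list w i < N i)"

lemma word_prod_replicate: "word_prod (replicate m i) = ((\<lambda>a. x i \<star> a) ^^ m) e"
  by (induction m) auto

lemma sorted_block:
  fixes w :: "nat list"
  assumes "sorted w"
  shows "filter (\<lambda>j. j < i) w @ replicate (count_list w i) i @ filter (\<lambda>j. i < j) w = w"
  using assms
proof (induction w)
  case (Cons j w)
  then have "filter (\<lambda>j. j < i) w = []" if "j \<ge> i"
    using that by (auto simp: filter_empty_conv)
  moreover have "count_list w i = 0" if "j > i"
    using that Cons.prems by (auto simp: count_list_0_iff)
  ultimately show ?case using Cons by (cases j i rule: linorder_cases) auto
qed simp

text \<open>A sorted word that is not good has a full block of \<open>N i\<close> equal letters,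
  which \<open>x_power\<close> turns into an element of \<open>span G\<close>; at least two letters
  disappear.\<close>

lemma word_prod_bad:
  assumes I: "I \<subseteq> J" and w: "sorted w" "set w \<subseteq> I" "\<not> good I w"
  shows "word_prod w \<in> Fil I (length w)"
proof -
  obtain i where i: "i \<in> set w" "N i \<le> count_list w i"
    using w by (auto simp: good_def not_less)
  then have iI: "i \<in> I" "i \<in> J" using w I by auto
  define u v where "u = filter (\<lambda>j. j < i) w" and "v = filter (\<lambda>j. i < j) w"
  have uv: "u @ replicate (count_list w i) i @ v = w"
    unfolding u_def v_def by (rule sorted_block[OF w(1)])
  \<comment> \<open>Surplus copies of \<open>i\<close> go to the right, so that exactly
    \<open>N i\<close> of them form the block to be replaced.\<close>
  define v' where "v' = replicate (count_list w i - N i) i @ v"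
  have w': "w = u @ replicate (N i) i @ v'"
    unfolding v'_def using uv i(2) by (metis append.assoc le_add_diff_inverse replicate_add)
  have sets: "set u \<subseteq> I" "set v' \<subseteq> I"
    using w(2) iI(1) by (auto simp: u_def v_def v'_def)
  have sv: "set v' \<subseteq> J" "set (replicate (N i) i @ v') \<subseteq> J" using sets I iI by auto
  have "word_prod w = word_prod u \<star> (word_prod (replicate (N i) i) \<star> word_prod v')"
    using sv by (subst w', subst word_prod_append, simp, subst word_prod_append) auto
  moreover have "word_prod (replicate (N i) i) \<star> word_prod v' \<in> Fil I (Suc (length v'))"
    using iI x_power[of i] sets I
    by (intro spanG_mul_Fil word_prod_in_Fil) (auto simp: word_prod_replicate)
  ultimately have "word_prod w \<in> Fil I (Suc (length v') + length u)"
    using word_prod_mul_Fil[OF I sets(1)] by metis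
  moreover have "Suc (length v') + length u \<le> length w"
    using N_ge_2[OF iI(2)] by (subst w') simp
  ultimately show ?thesis using Fil_mono by blast
qed

section \<open>Ordered monomials as a spanning set\<close>

definition mon_index :: "nat set \<Rightarrow> nat \<Rightarrow> ('v \<times> nat list) set"
  where "mon_index I n = {(g, w). g \<in> G \<and> good I w \<and> length w < n}"

definition monomial :: "'v \<times> nat list \<Rightarrow> 'v"
  where "monomial b = fst b \<star> word_prod (snd b)"

lemma finite_idx: "finite I \<Longrightarrow> finite (mon_index I n)"
proof -
  assume "finite I"
  then have "finite {w. set w \<subseteq> I \<and> length w \<le> n}" by (rule finite_lists_length_le)
  then show ?thesis
    using finite_G by (rule_tac finite_subset[of _ "G \<times> {w. set w \<subseteq> I \<and> length w \<le> n}"])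
      (auto simp: mon_index_def good_def)
qed

lemma mon_index_mono: "n \<le> m \<Longrightarrow> mon_index I n \<subseteq> mon_index I m"
  by (auto simp: mon_index_def)

lemma span_idx_subset_Fil: "span (monomial ` mon_index I n) \<subseteq> Fil I n"
  proof (rule span_minimal[OF _ subspace_Fil])
  show "monomial ` mon_index I n \<subseteq> Fil I n"
    by (auto simp: mon_index_def monomial_def good_def intro!: Fil_base)
qed

text \<open>The spanning half of a PBW theorem for the letters in \<open>I\<close>. Up to smaller
  degree a word is a multiple of its sorted form, and a sorted word that is not good is itself of
  smaller degree; the induction covers both errors.\<close>

lemma Fil_eq_span:
  assumes I: "I \<subseteq> J"
  shows "Fil I n = span (monomial ` mon_index I n)"
proof (induction n)
  case 0
  then show ?case by (simp add: mon_index_def)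
next
  case (Suc n)
  have mono: "Fil I n \<subseteq> span (monomial ` mon_index I (Suc n))"
    unfolding Suc.IH by (intro span_mono image_mono mon_index_mono) auto
  have "g \<star> word_prod w \<in> span (monomial ` mon_index I (Suc n))"
      if wgn: "g \<in> G" "set w \<subseteq> I" "length w < Suc n" for g w
  proof (cases "length w < n")
    case True
    then have "g \<star> word_prod w \<in> Fil I n" using wgn by (auto intro!: Fil_base)
    then show ?thesis using mono by auto
  next
    case False
    then have n: "length w = n" using wgn by simp
    obtain c where c: "word_prod w - c *s word_prod (sort w) \<in> Fil I n"
      using word_prod_sort[OF I wgn(2)] n by auto
    have "g \<star> word_prod (sort w) \<in> span (monomial ` mon_index I (Suc n))"
    proof (cases "good I (sort w)")
      case True
      then show ?thesis using wgn n
        by (intro span_base image_eqI[of _ _ "(g, sort w)"]) (auto simp: mon_index_def monomial_def)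
    next
      case False
      then have "word_prod (sort w) \<in> Fil I (length (sort w))"
        using wgn by (intro word_prod_bad[OF I]) auto
      then show ?thesis using g_mul_Fil[OF wgn(1)] mono n by auto
    qed
    moreover have "g \<star> (word_prod w - c *s word_prod (sort w)) \<in> span (monomial ` mon_index I (Suc n))"
      using g_mul_Fil[OF wgn(1) c] mono by auto
    ultimately have "g \<star> (word_prod w - c *s word_prod (sort w)) + c *s (g \<star> word_prod (sort w)) \<in> span (monomial ` mon_index I (Suc n))"
      by (intro span_add span_scale)
    then show ?thesis by (simp add: mul_diff_right mul_scale_right)
  qed
  then have "Fil I (Suc n) \<subseteq> span (monomial ` mon_index I (Suc n))"
    by (intro Fil_minimal) auto
  then show ?case using span_idx_subset_Fil by blast
qed

text \<open>\<open>beta w i\<close> is the coefficient with which the letter \<open>i\<close> is split off the word \<open>w\<close> to the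
  left tensor factor; for a sorted word it is a nonzero multiple of a \<open>q\<close>-integer.\<close>

primrec beta :: "nat list \<Rightarrow> nat \<Rightarrow> 'k"
  where "beta [] i = 0"
  | "beta (j # w) i = (if i = j then 1 else 0) + comm j i * beta w i"

lemma beta_eq_0: "i \<notin> set w \<Longrightarrow> beta w i = 0"
  by (induction w) auto

text \<open>The copies of the least letter \<open>i\<close> form the initial block, so the recursion
  of \<open>beta\<close> is Horner's rule for a geometric sum.\<close>

lemma beta_hd: "sorted (i # w) \<Longrightarrow> beta (i # w) i = (\<Sum>a<count_list (i # w) i. comm i i ^ a)"
proof (induction w)
  case (Cons j w)
  show ?case
  proof (cases "j = i")
    case True
    have "beta (i # j # w) i = 1 + comm i i * (\<Sum>a<count_list (i # w) i. comm i i ^ a)"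
      using Cons True by simp
    also have "\<dots> = (\<Sum>a<Suc (count_list (i # w) i). comm i i ^ a)"
      by (subst sum.lessThan_Suc_shift) (simp add: sum_distrib_left distrib_left)
    finally show ?thesis using True by simp
  next
    case False
    then have "i \<notin> set (j # w)" using Cons.prems by auto
    then show ?thesis
      by (simp add: beta_eq_0 count_list_0_iff[THEN iffD2])
  qed
qed simp

lemma good_Cons: "good I (j # w) \<Longrightarrow> good I w"
  unfolding good_def by (metis (no_types, lifting) count_list.simps(2) insert_subset
      less_Suc_eq list.set_intros(2) list.simps(15) not_less_eq sorted_simps(2) Suc_eq_plus1)

text \<open>Letters in front of the block of \<open>i\<close> contribute only the nonzero factors
  \<open>comm j i\<close>. The block itself gives a geometric sum with at least one and fewer than
  \<open>N i\<close> terms, nonzero by \<open>comm_order\<close>.\<close>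

lemma beta_nonzero: "I \<subseteq> J \<Longrightarrow> good I w \<Longrightarrow> i \<in> set w \<Longrightarrow>
    beta w i \<noteq> 0"
proof (induction w)
  case (Cons j w)
  show ?case
  proof (cases "j = i")
    case True
    then have "sorted (i # w)" "i \<in> J" "count_list (i # w) i < N i"
      using Cons.prems by (auto simp: good_def)
    then show ?thesis
      unfolding True using comm_order[of i "count_list (i # w) i"] by (subst beta_hd) auto
  next
    case False
    then show ?thesis
      using Cons good_Cons[of I j w] comm_nonzero[of i j] by (auto simp: good_def)
  qed
qed simp

text \<open>Each letter that goes to the left tensor factor lowers the degree on the right, where
  \<open>f\<close> then vanishes. Only the term with all letters on the right survives.\<close>

lemma D_word_prod_low:
  assumes "I \<subseteq> J" "linear_functional scale f" "set w \<subseteq> I" "\<And>b. b \<in> Fil I (length w) \<Longrightarrow>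
      f b = 0"
  shows "D f (word_prod w) = f (word_prod w) *s e"
  using assms(2-)
proof (induction w arbitrary: f)
  case Nil
  then show ?case by (simp add: D_e)
next
  case (Cons j w)
  then have j: "j \<in> I" "j \<in> J" and w: "set w \<subseteq> I" using assms(1) by auto
  have "gl j \<star> b \<in> Fil I (length (j # w))" if "b \<in> Fil I (length w)" for b
    using that g_mul_Fil[OF gl_in_G[OF j(2)]] Fil_mono[of "length w" "length (j # w)" I]
    by (auto dest!: subsetD)
  then have "D (\<lambda>b. f (gl j \<star> b)) (word_prod w) = f (gl j \<star> word_prod w) *s e"
    using Cons.prems w by (intro Cons.IH linear_functional_mul) auto
  \<comment> \<open>\<open>word_prod w\<close> is one letter shorter than \<open>j # w\<close>,
    hence in the range where \<open>f\<close> vanishes.\<close>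
  moreover have "f (gl j \<star> word_prod w) = 0"
    by (rule Cons.prems(3)) (use w gl_in_G j in \<open>auto intro: Fil_base\<close>)
  moreover have "D (\<lambda>b. f (x j \<star> b)) (word_prod w) = f (x j \<star> word_prod w) *s e"
    using Cons.prems w x_mul_Fil[OF assms(1) j(1)] by (intro Cons.IH linear_functional_mul) auto
  ultimately show ?case using D_x[OF Cons.prems(1) j(2)] by simp
qed

text \<open>Here the left factor may take one letter. A letter \<open>i\<close> sent to the left
  leaves \<open>gl i\<close> on the right; bringing \<open>gl i\<close> to the front past the
  preceding letters \<open>j\<close> costs the factors \<open>comm j i\<close>, and
  \<open>beta\<close> adds this up over all copies of \<open>i\<close>.\<close>

lemma D_word_prod_top:
  assumes "I \<subseteq> J" "linear_functional scale f" "sorted w" "set w \<subseteq> I"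
    and "\<And>b. b \<in> Fil I (length w - 1) \<Longrightarrow> f b = 0"
  shows "D f (word_prod w) = f (word_prod w) *s e +
    (\<Sum>i\<in>I. (beta w i * f (gl i \<star> word_prod (remove1 i w))) *s x i)"
  using assms(2-)
proof (induction w arbitrary: f)
  case Nil
  then show ?case by (simp add: D_e)
next
  case (Cons j w)
  then have j: "j \<in> I" "j \<in> J" and w: "set w \<subseteq> I" using assms(1) by auto
  have finI: "finite I" using assms(1) finite_J finite_subset by blast
  have "D (\<lambda>b. f (gl j \<star> b)) (word_prod w) = f (gl j \<star> word_prod w) *s e"
    using Cons.prems w g_mul_Fil[OF gl_in_G[OF j(2)]] by (intro D_word_prod_low[OF assms(1)] linear_functional_mul) auto
  then have 1: "x j \<star> D (\<lambda>b. f (gl j \<star> b)) (word_prod w) = f (gl j \<star> word_prod w) *s x j"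
    by (simp add: mul_scale_right x_mul_e j)
  \<comment> \<open>For empty \<open>w\<close> the truncated \<open>length w - 1\<close> is 0, and
    \<open>b\<close> is zero because \<open>Fil I 0\<close> is; otherwise the degree rises by
    one.\<close>
  have "x j \<star> b \<in> Fil I (length (j # w) - 1)" if "b \<in> Fil I (length w - 1)" for b
    using x_mul_Fil[OF assms(1) j(1) that] that by (cases w) (auto simp: subspace_0[OF subspace_Fil])
  then have "D (\<lambda>b. f (x j \<star> b)) (word_prod w) = f (x j \<star> word_prod w) *s e +
      (\<Sum>i\<in>I. (beta w i * f (x j \<star> (gl i \<star> word_prod (remove1 i w)))) *s x i)"
    using Cons.prems w by (intro Cons.IH linear_functional_mul) auto
  also have "(\<Sum>i\<in>I. (beta w i * f (x j \<star> (gl i \<star> word_prod (remove1 i w)))) *s x i)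
      = (\<Sum>i\<in>I. (comm j i * beta w i * f (gl i \<star> word_prod (remove1 i (j # w)))) *s x i)"
  proof (rule sum.cong[OF refl])
    fix i assume i: "i \<in> I"
    show "(beta w i * f (x j \<star> (gl i \<star> word_prod (remove1 i w)))) *s x i =
        (comm j i * beta w i * f (gl i \<star> word_prod (remove1 i (j # w)))) *s x i"
    proof (cases "i \<in> set w")
      case True
      \<comment> \<open>If \<open>i = j\<close>, the right side loses the first letter and the left
        side a later copy. As the word is sorted, \<open>i\<close> in \<open>w\<close> forces
        \<open>w\<close> to begin with \<open>i\<close>, and both words agree.\<close>
      have "word_prod (j # remove1 i w) = word_prod (remove1 i (j # w))"
      proof (cases "i = j")
        case True
        with \<open>i \<in> set w\<close> obtain k v where w: "w = k # v" by (cases w) auto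
        then have "k = i" using \<open>i \<in> set w\<close> Cons.prems(2) True by auto
        then show ?thesis using w True by simp
      qed simp
      moreover have "x j \<star> (gl i \<star> word_prod (remove1 i w)) = comm j i *s (gl i \<star> word_prod (j # remove1 i w))"
        using x_mul_gl[of i j] i j assms(1)
        by (simp add: mul_assoc[symmetric] mul_scale_left subset_iff)
      ultimately show ?thesis using linear_functional_scale[OF Cons.prems(1)] by simp
    qed (simp add: beta_eq_0)
  qed
  finally have 2: "D (\<lambda>b. f (x j \<star> b)) (word_prod w) = f (x j \<star> word_prod w) *s e +
      (\<Sum>i\<in>I. (comm j i * beta w i * f (gl i \<star> word_prod (remove1 i (j # w)))) *s x i)" .
  have "(\<Sum>i\<in>I. (beta (j # w) i * f (gl i \<star> word_prod (remove1 i (j # w)))) *s x i) =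
      (\<Sum>i\<in>I. (if i = j then f (gl j \<star> word_prod w) else 0) *s x i +
        (comm j i * beta w i * f (gl i \<star> word_prod (remove1 i (j # w)))) *s x i)"
    by (intro sum.cong[OF refl]) (auto simp: algebra_simps scale_left_distrib)
  also have "\<dots> = f (gl j \<star> word_prod w) *s x j +
      (\<Sum>i\<in>I. (comm j i * beta w i * f (gl i \<star> word_prod (remove1 i (j # w)))) *s x i)"
    using finI j by (simp add: sum.distrib if_distrib[of "\<lambda>r. r *s _"] cong: if_cong)
  finally show ?case using D_x[OF Cons.prems(1) j(2)] 1 2 by (simp add: algebra_simps)
qed

lemma D_monomial_low:
  assumes "I \<subseteq> J" "linear_functional scale f" "g \<in> G" "set w \<subseteq> I" "\<And>b. b \<in> Fil I (length w) \<Longrightarrow> f b = 0"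
  shows "D f (g \<star> word_prod w) = f (g \<star> word_prod w) *s g"
proof -
  have "D (\<lambda>b. f (g \<star> b)) (word_prod w) = f (g \<star> word_prod w) *s e"
    using assms g_mul_Fil by (intro D_word_prod_low[OF assms(1)] linear_functional_mul) auto
  then show ?thesis using D_g[OF assms(2,3)] by (simp add: mul_scale_right G_mul_e assms)
qed

lemma D_monomial_top:
  assumes "I \<subseteq> J" "linear_functional scale f" "g \<in> G" "sorted w" "set w \<subseteq> I"
    and "\<And>b. b \<in> Fil I (length w - 1) \<Longrightarrow> f b = 0"
  shows "D f (g \<star> word_prod w) = f (g \<star> word_prod w) *s g +
    (\<Sum>i\<in>I. (beta w i * f (g \<star> gl i \<star> word_prod (remove1 i w))) *s (g \<star> x i))"
proof -
  have "D (\<lambda>b. f (g \<star> b)) (word_prod w) = f (g \<star> word_prod w) *s e +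
    (\<Sum>i\<in>I. (beta w i * f (g \<star> (gl i \<star> word_prod (remove1 i w)))) *s x i)"
    using assms g_mul_Fil by (intro D_word_prod_top[OF assms(1)] linear_functional_mul) auto
  then show ?thesis using D_g[OF assms(2,3)]
    by (simp add: mul_scale_right mul_add_right mul_sum_right mul_assoc G_mul_e assms)
qed

section \<open>Operators attached to the functionals dual to monomials\<close>

lemma G_right_cancel:
  assumes "g \<in> G" "g' \<in> G" "h \<in> G" "g \<star> h = g' \<star> h"
  shows "g = g'"
proof -
  obtain k where k: "h \<star> k = e" using inverse_in_G assms by blast
  have "g \<star> h \<star> k = g" "g' \<star> h \<star> k = g'" using assms(1,2) G_mul_e by (simp_all add: mul_assoc k)
  then show ?thesis using assms(4) by metis
qed

text \<open>All monomials of degree below \<open>length s\<close> differ from \<open>(h, s)\<close>.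
  Hence a functional dual to \<open>(h, s)\<close> meets the vanishing hypotheses of the lemmas on
  \<open>D\<close>.\<close>

lemma dual_Fil_zero:
  assumes "I \<subseteq> J" "linear_functional scale f" "\<And>b. b \<in> mon_index I n \<Longrightarrow>
      f (monomial b) = (if b = (h, s) then 1 else 0)"
    and "m \<le> length s" "m \<le> n" "a \<in> Fil I m"
  shows "f a = 0"
proof (rule linear_functional_span_zero[OF assms(2)])
  show "a \<in> span (monomial ` mon_index I m)" using assms Fil_eq_span by simp
  fix b assume "b \<in> monomial ` mon_index I m"
  then show "f b = 0" using assms(3,4) mon_index_mono[OF assms(5), of I] by (fastforce simp: mon_index_def)
qed

lemma good_remove1:
  assumes "good I w"
  shows "good I (remove1 i w)"
proof -
  have "count_list (remove1 i w) j \<le> count_list w j" for j by (induction w) auto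
  then show ?thesis
    using assms set_remove1_subset[of i w] unfolding good_def
    by (auto intro: sorted_remove1 le_less_trans)
qed

text \<open>With \<open>s\<close> of top length, every monomial of \<open>a\<close> falls under
  \<open>D_monomial_low\<close>, and \<open>f\<close> is nonzero only at \<open>(h, s)\<close>. The
  operator thus returns the group part of a leading monomial.\<close>

lemma D_dual_low:
  assumes I: "I \<subseteq> J" and f: "linear_functional scale f"
    and dual: "\<And>b. b \<in> mon_index I n \<Longrightarrow> f (monomial b) = (if b = (h, s) then 1 else 0)"
    and n: "n = Suc (length s)" and hs: "(h, s) \<in> mon_index I n"
    and a: "a = (\<Sum>b\<in>mon_index I n. c b *s monomial b)"
  shows "D f a = c (h, s) *s h"
proof -
  have finI: "finite I" using I finite_J finite_subset by blast
  have "D f (monomial b) = (if b = (h, s) then h else 0)" if b_in: "b \<in> mon_index I n" for b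
  proof -
    obtain g w where b: "b = (g, w)" "g \<in> G" "set w \<subseteq> I" "length w \<le> length s"
      using b_in n by (auto simp: mon_index_def good_def)
    have "D f (g \<star> word_prod w) = f (g \<star> word_prod w) *s g"
      using b n by (intro D_monomial_low[OF I f] dual_Fil_zero[OF I f dual, of n "length w"]) auto
    then show ?thesis using dual[OF b_in] b by (auto simp: monomial_def)
  qed
  then have "D f a = (\<Sum>b\<in>mon_index I n. c b *s (if b = (h, s) then h else 0))"
    unfolding a by (simp add: D_sum[OF f] D_scale[OF f])
  then show ?thesis using hs finite_idx[OF finI]
    by (simp add: if_distrib[of "\<lambda>r. _ *s r"] cong: if_cong)
qed

text \<open>Now \<open>a\<close> may have one degree more than \<open>s\<close>. A top monomial
  \<open>(g, w)\<close> can contribute a multiple of \<open>g \<star> x i\<close> only if removing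
  \<open>i\<close> turns it into \<open>(h, s)\<close>, that is, \<open>w = insort i s\<close> and
  \<open>g = k i\<close>, the quotient of \<open>h\<close> by \<open>gl i\<close>. All other
  contributions lie in \<open>span G\<close>.\<close>

lemma D_dual_top:
  assumes I: "I \<subseteq> J" and f: "linear_functional scale f"
    and dual: "\<And>b. b \<in> mon_index I n \<Longrightarrow> f (monomial b) = (if b = (h, s) then 1 else 0)"
    and n: "n = Suc (length s)" and hs: "(h, s) \<in> mon_index I n"
    and k: "\<And>i. i \<in> I \<Longrightarrow> k i \<in> G \<and> k i \<star> gl i = h"
    and a: "a = (\<Sum>b\<in>mon_index I (Suc n). c b *s monomial b)"
  shows "D f a - (\<Sum>i\<in>{i\<in>I. good I (insort i s)}.
    (c (k i, insort i s) * beta (insort i s) i) *s (k i \<star> x i)) \<in> span G"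
proof -
  have finI: "finite I" using I finite_J finite_subset by blast
  have fin: "finite (mon_index I (Suc n))" by (rule finite_idx[OF finI])
  have zero: "f b = 0" if "b \<in> Fil I m" "m \<le> length s" for b m
    using that n by (intro dual_Fil_zero[OF I f dual, of n m]) auto
  \<comment> \<open>The coefficient of \<open>k i \<star> x i\<close> in
    \<open>D f (monomial b)\<close>.\<close>
  define t where "t b i = (if b = (k i, insort i s) then beta (insort i s) i else 0)" for b i
  have Dev: "D f (monomial b) = f (monomial b) *s fst b + (\<Sum>i\<in>I. t b i *s (k i \<star> x i))"
    if b_in: "b \<in> mon_index I (Suc n)" for b
  proof -
    obtain g w where b: "b = (g, w)" "g \<in> G" "good I w" "sorted w" "set w \<subseteq> I" "length w \<le> n"
      using b_in by (auto simp: mon_index_def good_def)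
    show ?thesis
    proof (cases "length w = n")
      case False
      then have "t b i = 0" for i using b n by (auto simp: t_def)
      moreover have "D f (g \<star> word_prod w) = f (g \<star> word_prod w) *s g"
        using b n False by (intro D_monomial_low[OF I f] zero) auto
      ultimately show ?thesis by (simp add: b monomial_def)
    next
      case True
      have "D f (g \<star> word_prod w) = f (g \<star> word_prod w) *s g +
        (\<Sum>i\<in>I. (beta w i * f (g \<star> gl i \<star> word_prod (remove1 i w))) *s (g \<star> x i))"
        using b n True by (intro D_monomial_top[OF I f] zero) auto
      also have "(\<Sum>i\<in>I. (beta w i * f (g \<star> gl i \<star> word_prod (remove1 i w))) *s (g \<star> x i)) =
        (\<Sum>i\<in>I. t b i *s (k i \<star> x i))"
      proof (rule sum.cong[OF refl])
        fix i assume i: "i \<in> I"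
        show "(beta w i * f (g \<star> gl i \<star> word_prod (remove1 i w))) *s (g \<star> x i) = t b i *s (k i \<star> x i)"
        proof (cases "i \<in> set w")
          case False
          then show ?thesis using b by (auto simp: t_def beta_eq_0 set_insort_key)
        next
          case iw: True
          have gli: "gl i \<in> G" using i I gl_in_G by auto
          have "(g \<star> gl i, remove1 i w) \<in> mon_index I n"
            using b iw True n gli by (auto simp: mon_index_def length_remove1 intro: mul_in_G good_remove1)
          then have "f (g \<star> gl i \<star> word_prod (remove1 i w)) =
              (if g \<star> gl i = h \<and> remove1 i w = s then 1 else 0)"
            using dual by (fastforce simp: monomial_def)
          moreover have "g \<star> gl i = h \<and> remove1 i w = s \<longleftrightarrow> g = k i \<and> w = insort i s"
            using k[OF i] G_right_cancel[of g "k i" "gl i"] b gli iw insort_remove1[of i w]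
              remove1_insort_key[of i "\<lambda>x. x" s] by auto
          ultimately show ?thesis by (auto simp: t_def b)
        qed
      qed
      finally show ?thesis by (simp add: b monomial_def)
    qed
  qed
  have "D f a = (\<Sum>b\<in>mon_index I (Suc n). c b *s (f (monomial b) *s fst b + (\<Sum>i\<in>I. t b i *s (k i \<star> x i))))"
    unfolding a by (simp add: D_sum[OF f] D_scale[OF f] Dev)
  also have "\<dots> = (\<Sum>b\<in>mon_index I (Suc n). c b *s (f (monomial b) *s fst b)) +
      (\<Sum>b\<in>mon_index I (Suc n). \<Sum>i\<in>I. (c b * t b i) *s (k i \<star> x i))"
    by (simp add: scale_right_distrib sum.distrib scale_sum_right)
  also have "(\<Sum>b\<in>mon_index I (Suc n). \<Sum>i\<in>I. (c b * t b i) *s (k i \<star> x i)) =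
      (\<Sum>i\<in>I. (\<Sum>b\<in>mon_index I (Suc n). c b * t b i) *s (k i \<star> x i))"
    by (subst sum.swap) (simp add: scale_sum_left)
  also have "\<dots> = (\<Sum>i\<in>I. (if good I (insort i s) then c (k i, insort i s) * beta (insort i s) i else 0)
      *s (k i \<star> x i))"
  proof (rule sum.cong[OF refl])
    fix i assume i: "i \<in> I"
    \<comment> \<open>If \<open>insort i s\<close> is not good, this pair is no index; the sum over
      \<open>b\<close> is then zero and the letter \<open>i\<close> drops out.\<close>
    have "(k i, insort i s) \<in> mon_index I (Suc n) \<longleftrightarrow> good I (insort i s)"
      using k[OF i] n by (auto simp: mon_index_def)
    moreover have "(\<Sum>b\<in>mon_index I (Suc n). c b * t b i) =
        (\<Sum>b\<in>mon_index I (Suc n). if b = (k i, insort i s) then c b * beta (insort i s) i else 0)"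
      by (intro sum.cong) (auto simp: t_def)
    ultimately show "(\<Sum>b\<in>mon_index I (Suc n). c b * t b i) *s (k i \<star> x i) =
      (if good I (insort i s) then c (k i, insort i s) * beta (insort i s) i else 0) *s (k i \<star> x i)"
      using fin by simp
  qed
  also have "\<dots> = (\<Sum>i\<in>{i\<in>I. good I (insort i s)}.
      (c (k i, insort i s) * beta (insort i s) i) *s (k i \<star> x i))"
    using finI by (intro sum.mono_neutral_cong_right) auto
  finally have "D f a - (\<Sum>i\<in>{i\<in>I. good I (insort i s)}.
      (c (k i, insort i s) * beta (insort i s) i) *s (k i \<star> x i)) =
      (\<Sum>b\<in>mon_index I (Suc n). c b *s (f (monomial b) *s fst b))"
    by simp
  also have "\<dots> \<in> span G"
    by (intro span_sum span_scale span_base) (auto simp: mon_index_def)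
  finally show ?thesis .
qed

section \<open>Elements of degree at most one\<close>

lemma Fil_subset_mono: "I \<subseteq> I' \<Longrightarrow> Fil I n \<subseteq> Fil I' n"
  by (rule Fil_minimal[OF subspace_Fil]) (auto intro: Fil_base)

lemma G_subset_Fil: "span G \<subseteq> Fil I 2"
  using Fil_1[of I] Fil_mono[of 1 2 I] by simp

lemma x_in_Fil: "i \<in> I \<Longrightarrow> I \<subseteq> J \<Longrightarrow> x i \<in> Fil I 2"
  using word_prod_in_Fil[of I "[i]" 2] x_mul_e[of i] by auto

lemma gx_in_Fil: "g \<in> G \<Longrightarrow> i \<in> I \<Longrightarrow> I \<subseteq> J \<Longrightarrow>
    g \<star> x i \<in> Fil I 2"
  by (intro g_mul_Fil x_in_Fil)

lemma Fil_2_minimal: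
  assumes "subspace W" "I \<subseteq> J" "\<And>g. g \<in> G \<Longrightarrow> g \<in> W" "\<And>g i. g \<in> G \<Longrightarrow>
      i \<in> I \<Longrightarrow> g \<star> x i \<in> W"
  shows "Fil I 2 \<subseteq> W"
proof (rule Fil_minimal[OF assms(1)])
  fix g w assume w: "g \<in> G" "set w \<subseteq> I" "length w < 2"
  then consider "w = []" | i where "w = [i]" "i \<in> I"
    by (cases w) (auto simp: less_Suc_eq numeral_2_eq_2)
  then show "g \<star> word_prod w \<in> W"
    using w assms(2-4) by cases (auto simp: G_mul_e x_mul_e subset_iff)
qed

lemma Fil_subset_Fil_mod: "Fil I n \<subseteq> Fil_mod I P n"
  by (rule Fil_minimal[OF subspace_Fil_mod]) (simp add: Fil_mod_base)

lemma Fil_mod_subset_Fil: "Fil_mod I P n \<subseteq> Fil I (Suc n)"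
  by (rule Fil_mod_minimal[OF subspace_Fil]) (auto intro: Fil_base)

lemma Fil_2_mul_Fil_mod:
  assumes "I \<subseteq> J" "b \<in> Fil I 2" "a \<in> Fil_mod I P n"
  shows "b \<star> a \<in> Fil_mod I P (Suc n)"
proof -
  have "Fil I 2 \<subseteq> {b. b \<star> a \<in> Fil_mod I P (Suc n)}"
  proof (rule Fil_2_minimal[OF _ assms(1)])
    fix g i assume "g \<in> G" "i \<in> I"
    then show "g \<star> x i \<in> {b. b \<star> a \<in> Fil_mod I P (Suc n)}"
      using assms by (simp add: mul_assoc g_mul_Fil_mod x_mul_Fil_mod)
  next
    \<comment> \<open>A group element does not raise the degree. What is left is the inclusion of
      \<open>Fil_mod I P n\<close> in \<open>Fil_mod I P (Suc n)\<close>, which passes through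
      \<open>Fil I (Suc n)\<close>.\<close>
    fix g assume "g \<in> G"
    then show "g \<in> {b. b \<star> a \<in> Fil_mod I P (Suc n)}"
      using g_mul_Fil_mod[OF _ assms(3), of g] Fil_mod_subset_Fil[of I P n]
        Fil_subset_Fil_mod[of I "Suc n" P] by auto
  qed (intro subspace_mul_preimage' subspace_Fil_mod)
  then show ?thesis using assms(2) by auto
qed

lemmas Fil_2_mul = Fil_2_mul_Fil_mod

text \<open>Dedekind's argument for group-like elements. Let \<open>f\<close> be dual to
  \<open>g\<close> on \<open>Y\<close>. Applied to the relation, \<open>f\<close> gives
  \<open>c h * f h = - c g\<close>, while \<open>D f\<close>, which scales each group element
  \<open>k\<close> by \<open>f k\<close>, gives \<open>(c h * f h) *s h + c g *s g = 0\<close>.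
  Hence \<open>c g *s (g - h) = 0\<close>.\<close>

lemma G_independent:
  assumes "e \<noteq> 0" "Y \<subseteq> G"
  shows "indep_family scale Y (\<lambda>g. g)"
proof -
  have "finite Y" using assms(2) finite_G finite_subset by blast
  then show ?thesis using assms(2)
  proof (induction Y rule: finite_induct)
    case empty
    then show ?case by (simp add: indep_family_def)
  next
    case (insert h Y)
    then have IH: "indep_family scale Y (\<lambda>g. g)" and h: "h \<in> G" by auto
    show ?case unfolding indep_family_def
    proof (intro allI impI)
      fix c assume "(\<Sum>b\<in>insert h Y. c b *s b) = 0"
      then have c: "c h *s h + (\<Sum>b\<in>Y. c b *s b) = 0" using insert by simp
      have c0: "c g = 0" if g: "g \<in> Y" for g
      proof -
        obtain f where f: "linear_functional scale f" "\<And>b. b \<in> Y \<Longrightarrow> f b = (if b = g then 1 else 0)"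
          using indep_family_dual[OF insert.hyps(1) IH g] by auto
        have Df: "D f k = f k *s k" if "k \<in> G" for k
          using D_g[OF f(1) that, of e] D_e[OF linear_functional_mul[OF f(1), of k]] that
          by (simp add: G_mul_e mul_scale_right)
        have 1: "D f (\<Sum>b\<in>Y. c b *s b) = c g *s g"
        proof -
          have "D f (\<Sum>b\<in>Y. c b *s b) = (\<Sum>b\<in>Y. (if b = g then c g *s g else 0))"
            unfolding D_sum[OF f(1)] using insert.prems
            by (intro sum.cong) (auto simp: D_scale[OF f(1)] Df f(2))
          then show ?thesis using insert.hyps g by simp
        qed
        have "f (\<Sum>b\<in>Y. c b *s b) = c g"
          using insert.hyps g by (simp add: linear_functional_sum[OF f(1)] linear_functional_scale[OF f(1)] f(2)
              if_distrib[of "\<lambda>r. _ * r"] cong: if_cong)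
        then have 2: "c h * f h = - c g"
          using c linear_functional_add[OF f(1)] linear_functional_scale[OF f(1)] linear_functional_zero[OF f(1)]
          by (metis add_eq_0_iff2)
        have "D f (c h *s h) + D f (\<Sum>b\<in>Y. c b *s b) = 0"
          using c D_add[OF f(1)] D_zero[OF f(1)] by metis
        then have "(c h * f h) *s h + c g *s g = 0"
          using Df[OF h] by (simp add: D_scale[OF f(1)] 1)
        then have "c g *s (g - h) = 0" by (simp add: 2 scale_right_diff_distrib)
        then show "c g = 0" using insert.hyps(2) g by auto
      qed
      \<comment> \<open>If \<open>h\<close> were 0, its product with an inverse, which is
        \<open>e\<close>, would be 0 as well.\<close>
      have "h \<noteq> 0"
        using inverse_in_G[OF h] assms(1) by auto
      then have "c h = 0" using c c0 by simp
      then show "\<forall>b\<in>insert h Y. c b = 0" using c0 by simp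
    qed
  qed
qed

section \<open>Minimal generating sets and independence of ordered monomials\<close>

definition minimal_gens :: "nat set \<Rightarrow> bool"
  where "minimal_gens I \<longleftrightarrow> I \<subseteq> J \<and> (\<forall>j\<in>J. x j \<in> Fil I 2) \<and>
    (\<forall>I'. I' \<subset> I \<longrightarrow> \<not> (\<forall>j\<in>J. x j \<in> Fil I' 2))"

lemma minimal_gens_exists: "\<exists>I. minimal_gens I"
proof -
  let ?Y = "{I. I \<subseteq> J \<and> (\<forall>j\<in>J. x j \<in> Fil I 2)}"
  have "finite ?Y" using finite_J by simp
  moreover have "J \<in> ?Y" using x_in_Fil by auto
  ultimately obtain I where "I \<in> ?Y" "\<forall>I'\<in>?Y. I' \<le> I \<longrightarrow> I = I'"
    using finite_has_minimal[of ?Y] by blast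
  then have "minimal_gens I" unfolding minimal_gens_def by blast
  then show ?thesis ..
qed

text \<open>Otherwise, dividing by \<open>k i\<close> and \<open>d i\<close> and solving for
  \<open>x i\<close> would put \<open>x i\<close> into \<open>Fil (I - {i}) 2\<close>, and
  \<open>i\<close> could be dropped from \<open>I\<close>. This is the only place where minimality
  enters.\<close>

lemma minimal_gens_independent:
  assumes I: "minimal_gens I" and I': "I' \<subseteq> I" and k: "\<And>i. i \<in> I' \<Longrightarrow> k i \<in> G"
    and s: "(\<Sum>i\<in>I'. d i *s (k i \<star> x i)) \<in> span G" and i: "i \<in> I'"
  shows "d i = 0"
proof (rule ccontr)
  assume d: "d i \<noteq> 0"
  have IJ: "I \<subseteq> J" using I by (simp add: minimal_gens_def)
  have fin: "finite I'" using I' IJ finite_J by (meson finite_subset)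
  let ?F = "Fil (I - {i}) 2"
  obtain h where h: "h \<in> G" "h \<star> k i = e" using inverse_in_G k i by blast
  have "(\<Sum>i\<in>I' - {i}. d i *s (k i \<star> x i)) \<in> ?F"
  proof (intro subspace_sum subspace_Fil Fil_scale gx_in_Fil)
    fix j assume "j \<in> I' - {i}"
    then show "k j \<in> G" "j \<in> I - {i}" "I - {i} \<subseteq> J" using k I' IJ by auto
  qed
  moreover have "(\<Sum>i\<in>I'. d i *s (k i \<star> x i)) \<in> ?F" using s G_subset_Fil by blast
  ultimately have "(\<Sum>i\<in>I'. d i *s (k i \<star> x i)) - (\<Sum>i\<in>I' - {i}. d i *s (k i \<star> x i)) \<in> ?F"
    by (rule Fil_diff[rotated])
  then have "d i *s (k i \<star> x i) \<in> ?F"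
    by (simp only: sum.remove[OF fin i] add_diff_cancel_right')
  then have "inverse (d i) *s (h \<star> (d i *s (k i \<star> x i))) \<in> ?F"
    by (rule Fil_scale[OF g_mul_Fil[OF h(1)]])
  moreover have "inverse (d i) *s (h \<star> (d i *s (k i \<star> x i))) = x i"
    using d h e_mul_x[of i] i I' IJ by (simp add: mul_scale_right mul_assoc[symmetric] subset_iff)
  ultimately have xi: "x i \<in> ?F" by simp
  \<comment> \<open>Every letter lies in \<open>Fil I 2\<close>, so this inclusion says that
    \<open>I - {i}\<close> generates too.\<close>
  have "Fil I 2 \<subseteq> ?F"
  proof (rule Fil_2_minimal[OF subspace_Fil IJ])
    fix g assume "g \<in> G"
    then show "g \<in> ?F" using G_subset_Fil span_base by blast
  next
    fix g j assume "g \<in> G" "j \<in> I"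
    then show "g \<star> x j \<in> ?F"
      using xi IJ by (cases "j = i") (auto intro: g_mul_Fil gx_in_Fil)
  qed
  then have "\<forall>j\<in>J. x j \<in> ?F" using I by (auto simp: minimal_gens_def)
  moreover have "I - {i} \<subset> I" using i I' by auto
  ultimately show False using I unfolding minimal_gens_def by blast
qed

lemma left_quotients:
  assumes "h \<in> G" "I \<subseteq> J"
  obtains k where "\<And>i. i \<in> I \<Longrightarrow> k i \<in> G \<and> k i \<star> gl i = h"
proof -
  have "\<forall>i\<in>I. \<exists>k. k \<in> G \<and> k \<star> gl i = h"
  proof
    fix i assume "i \<in> I"
    then obtain k where "k \<in> G" "k \<star> gl i = e" using inverse_in_G gl_in_G assms by blast
    then show "\<exists>k. k \<in> G \<and> k \<star> gl i = h"
      using assms by (intro exI[of _ "h \<star> k"]) (simp add: mul_in_G mul_assoc G_mul_e)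
  qed
  then show ?thesis using that by metis
qed

lemma mon_index_1: "mon_index I 1 = (\<lambda>g. (g, [])) ` G"
  by (auto simp: mon_index_def good_def)

text \<open>In a relation of degree \<open>n\<close>, the induction hypothesis supplies a functional
  dual to a monomial of degree \<open>n - 1\<close>. Then \<open>D_dual_top\<close> with
  \<open>a = 0\<close> gives a relation between elements \<open>k i \<star> x i\<close> modulo
  \<open>span G\<close>; its coefficients vanish by minimality, and their factors
  \<open>beta\<close> are nonzero.\<close>

lemma monomials_independent:
  assumes e: "e \<noteq> 0" and I: "minimal_gens I"
  shows "indep_family scale (mon_index I n) monomial"
proof (induction n)
  case 0
  then show ?case by (simp add: indep_family_def mon_index_def)
next
  case (Suc n)
  have IJ: "I \<subseteq> J" and finI: "finite I"
    using I finite_J finite_subset by (auto simp: minimal_gens_def)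
  show ?case
  proof (cases "n = 0")
    case True
    show ?thesis unfolding indep_family_def True
    proof (intro allI impI)
      fix c assume "(\<Sum>b\<in>mon_index I (Suc 0). c b *s monomial b) = 0"
      then have "(\<Sum>g\<in>G. c (g, []) *s g) = 0"
        using mon_index_1[of I] by (simp add: sum.reindex inj_on_def monomial_def G_mul_e)
      then have "\<forall>g\<in>G. c (g, []) = 0"
        using G_independent[OF e order_refl] by (auto simp: indep_family_def)
      then show "\<forall>b\<in>mon_index I (Suc 0). c b = 0" using mon_index_1[of I] by simp
    qed
  next
    case n0: False
    show ?thesis unfolding indep_family_def
    proof (intro allI impI)
      fix c assume c: "(\<Sum>b\<in>mon_index I (Suc n). c b *s monomial b) = 0"
      have top: "c (g, w) = 0" if gw: "(g, w) \<in> mon_index I (Suc n)" "length w = n" for g w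
      proof -
        \<comment> \<open>Any letter of \<open>w\<close> would serve; for the first one,
          \<open>insort i s = w\<close> follows from sortedness.\<close>
        obtain i s where w: "w = i # s" using gw n0 by (cases w) auto
        have i: "i \<in> I" "i \<in> J" "g \<in> G" using gw w IJ by (auto simp: mon_index_def good_def)
        define h where "h = g \<star> gl i"
        have hs: "(h, s) \<in> mon_index I n"
          using gw w i gl_in_G[of i] good_Cons[of I i s] by (auto simp: mon_index_def h_def mul_in_G)
        obtain f where f: "linear_functional scale f" "\<And>b. b \<in> mon_index I n \<Longrightarrow>
            f (monomial b) = (if b = (h, s) then 1 else 0)"
          using indep_family_dual[OF finite_idx[OF finI] Suc.IH hs] by auto
        obtain k where k: "\<And>i. i \<in> I \<Longrightarrow> k i \<in> G \<and> k i \<star> gl i = h"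
          using left_quotients[OF _ IJ, of h] hs by (auto simp: mon_index_def)
        have ins: "insort i s = w" using gw w by (auto simp: mon_index_def good_def intro: insort_is_Cons)
        have ki: "k i = g" using k[OF i(1)] i h_def G_right_cancel gl_in_G by metis
        have "D f 0 - (\<Sum>i\<in>{i\<in>I. good I (insort i s)}.
          (c (k i, insort i s) * beta (insort i s) i) *s (k i \<star> x i)) \<in> span G"
          using D_dual_top[OF IJ f _ hs k c[symmetric]] gw w by simp
        then have "(\<Sum>i\<in>{i\<in>I. good I (insort i s)}.
          (c (k i, insort i s) * beta (insort i s) i) *s (k i \<star> x i)) \<in> span G"
          using span_neg by (fastforce simp: D_zero[OF f(1)])
        then have "c (k i, insort i s) * beta (insort i s) i = 0"
          using minimal_gens_independent[OF I, of "{i\<in>I. good I (insort i s)}" k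
            "\<lambda>i. c (k i, insort i s) * beta (insort i s) i" i] k i gw ins by (auto simp: mon_index_def)
        then show ?thesis using beta_nonzero[OF IJ, of w i] gw by (auto simp: ins ki mon_index_def w)
      qed
      \<comment> \<open>With the coefficients in degree \<open>n\<close> gone, the relation involves
        only \<open>mon_index I n\<close>.\<close>
      then have "(\<Sum>b\<in>mon_index I n. c b *s monomial b) = (\<Sum>b\<in>mon_index I (Suc n). c b *s monomial b)"
        by (intro sum.mono_neutral_left finite_idx finI mon_index_mono ballI)
          (auto simp: mon_index_def less_Suc_eq)
      then have "\<forall>b\<in>mon_index I n. c b = 0" using Suc.IH c by (simp add: indep_family_def)
      then show "\<forall>b\<in>mon_index I (Suc n). c b = 0" using top by (auto simp: mon_index_def less_Suc_eq)
    qed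
  qed
qed

text \<open>A letter outside \<open>I\<close> still lies in \<open>Fil I 2\<close>, and
  multiplication by such an element raises the degree by at most one. So the elements of finite
  degree over \<open>I\<close> are stable under all letters.\<close>

lemma C_subset_Fil:
  assumes I: "minimal_gens I" and a: "a \<in> C"
  shows "\<exists>n. a \<in> Fil I n"
proof -
  have IJ: "I \<subseteq> J" using I by (simp add: minimal_gens_def)
  have "a \<in> (\<Union>n. Fil I n)"
  proof (rule C_induct[OF _ _ _ _ a])
    show "subspace (\<Union>n. Fil I n)"
      unfolding subspace_def
    proof (intro conjI ballI allI)
      show "0 \<in> (\<Union>n. Fil I n)" using Fil_0[of I] by (metis UN_iff UNIV_I singletonI)
    next
      fix a b assume "a \<in> (\<Union>n. Fil I n)" "b \<in> (\<Union>n. Fil I n)"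
      then obtain n m where "a \<in> Fil I n" "b \<in> Fil I m" by auto
      then have "a \<in> Fil I (max n m)" "b \<in> Fil I (max n m)"
        using Fil_mono[of n "max n m" I] Fil_mono[of m "max n m" I] by auto
      then show "a + b \<in> (\<Union>n. Fil I n)" using Fil_add by (meson UN_iff UNIV_I)
    next
      fix r a assume "a \<in> (\<Union>n. Fil I n)"
      then show "r *s a \<in> (\<Union>n. Fil I n)" using Fil_scale by (meson UN_iff UNIV_I)
    qed
    show "e \<in> (\<Union>n. Fil I n)" using word_prod_in_Fil[OF IJ, of "[]" 1] by auto
  next
    fix g a assume "g \<in> G" "a \<in> (\<Union>n. Fil I n)"
    then show "g \<star> a \<in> (\<Union>n. Fil I n)" using g_mul_Fil by (meson UN_iff UNIV_I)
  next
    fix j a assume "j \<in> J" "a \<in> (\<Union>n. Fil I n)"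
    then show "x j \<star> a \<in> (\<Union>n. Fil I n)"
      using Fil_2_mul[OF IJ] I unfolding minimal_gens_def by (meson UN_iff UNIV_I)
  qed
  then show ?thesis by auto
qed

text \<open>A letter from \<open>I - P\<close> in front makes the word leave \<open>P\<close>; a
  group element in front leaves it one letter shorter than the bound. \<open>Fil_mod\<close> admits
  both.\<close>

lemma Fil_2_mul_word_prod:
  assumes "I \<subseteq> J" "b \<in> Fil (I - P) 2" "set w \<subseteq> I"
  shows "b \<star> word_prod w \<in> Fil_mod I P (Suc (length w))"
proof -
  have "Fil (I - P) 2 \<subseteq> {b. b \<star> word_prod w \<in> Fil_mod I P (Suc (length w))}"
  proof (rule Fil_2_minimal)
    fix g i assume "g \<in> G" "i \<in> I - P"
    then show "g \<star> x i \<in> {b. b \<star> word_prod w \<in> Fil_mod I P (Suc (length w))}"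
      using Fil_mod_base[of g "i # w"] assms by (simp add: mul_assoc)
  qed (use assms in \<open>auto intro!: subspace_mul_preimage' subspace_Fil_mod Fil_mod_base\<close>)
  then show ?thesis using assms(2) by auto
qed

section \<open>Leading terms of words in modified generators\<close>

definition word_prod_of :: "(nat \<Rightarrow> 'v) \<Rightarrow> nat list \<Rightarrow> 'v"
  where "word_prod_of v w = foldr (\<lambda>i a. v i \<star> a) w e"

text \<open>If \<open>V\<close> and \<open>W\<close> are the two words before \<open>p\<close> is
  put in front, then \<open>v p \<star> V - x p \<star> W = v p \<star> (V - W) + (v p - x p)
  \<star> W\<close>. Thus replacing \<open>x\<close> by \<open>v\<close> in a leading word over
  \<open>P\<close> creates no other leading word over \<open>P\<close>.\<close>

lemma word_prod_of_minus_word_prod: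
  assumes "I \<subseteq> J" "P \<subseteq> I" "\<And>p. p \<in> P \<Longrightarrow>
      v p - x p \<in> Fil (I - P) 2" "set w \<subseteq> P"
  shows "word_prod_of v w - word_prod w \<in> Fil_mod I P (length w)"
  using assms(4)
proof (induction w)
  case Nil
  then show ?case by (simp add: word_prod_of_def subspace_0[OF subspace_Fil_mod])
next
  case (Cons p w)
  then have p: "p \<in> P" by simp
  have "v p - x p \<in> Fil I 2"
    using assms(3)[OF p] Fil_subset_mono[of "I - P" I 2] by auto
  moreover have "x p \<in> Fil I 2" using p assms by (intro x_in_Fil) auto
  ultimately have "(v p - x p) + x p \<in> Fil I 2" by (rule Fil_add)
  then have "v p \<in> Fil I 2" by simp
  then have "v p \<star> (word_prod_of v w - word_prod w) \<in> Fil_mod I P (Suc (length w))"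
    using Cons by (intro Fil_2_mul_Fil_mod[OF assms(1)]) auto
  moreover have "(v p - x p) \<star> word_prod w \<in> Fil_mod I P (Suc (length w))"
    using Cons.prems assms(2) by (intro Fil_2_mul_word_prod[OF assms(1) assms(3)[OF p]]) auto
  ultimately have "v p \<star> (word_prod_of v w - word_prod w) + (v p - x p) \<star> word_prod w \<in> Fil_mod I P (Suc (length w))"
    by (rule subspace_add[OF subspace_Fil_mod])
  then show ?case by (simp add: word_prod_of_def mul_diff_left mul_diff_right)
qed

definition mon_index_mod :: "nat set \<Rightarrow> nat set \<Rightarrow> nat \<Rightarrow> ('v \<times> nat list) set"
  where "mon_index_mod I P n = {b \<in> mon_index I (Suc n). \<not> (length (snd b) = n \<and> set (snd b) \<subseteq> P)}"

text \<open>As in \<open>Fil_eq_span\<close>. Sorting keeps the set of letters, so a word of length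
  \<open>n\<close> that leaves \<open>P\<close> is sorted into one that leaves
  \<open>P\<close>.\<close>

lemma Fil_mod_subset_span:
  assumes I: "I \<subseteq> J"
  shows "Fil_mod I P n \<subseteq> span (monomial ` mon_index_mod I P n)"
proof (rule Fil_mod_minimal)
  fix g w assume w: "g \<in> G" "set w \<subseteq> I" "length w < n \<or> length w = n \<and> \<not> set w \<subseteq> P"
  have "mon_index I n \<subseteq> mon_index_mod I P n" by (auto simp: mon_index_mod_def mon_index_def)
  then have le: "Fil I n \<subseteq> span (monomial ` mon_index_mod I P n)"
    unfolding Fil_eq_span[OF I] by (intro span_mono image_mono)
  show "g \<star> word_prod w \<in> span (monomial ` mon_index_mod I P n)"
  proof (cases "length w < n")
    case True
    then show ?thesis using le w Fil_base by blast
  next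
    case False
    then have n: "length w = n" "\<not> set w \<subseteq> P" using w by auto
    obtain c where c: "word_prod w - c *s word_prod (sort w) \<in> Fil I n" using word_prod_sort[OF I w(2)] n by auto
    have "g \<star> word_prod (sort w) \<in> span (monomial ` mon_index_mod I P n)"
    proof (cases "good I (sort w)")
      case True
      then show ?thesis using w n
        by (intro span_base image_eqI[of _ _ "(g, sort w)"]) (auto simp: mon_index_mod_def mon_index_def monomial_def)
    next
      case False
      then have "word_prod (sort w) \<in> Fil I (length (sort w))" using w by (intro word_prod_bad[OF I]) auto
      then show ?thesis using g_mul_Fil[OF w(1), of _ I I n] le n by auto
    qed
    moreover have "g \<star> (word_prod w - c *s word_prod (sort w)) \<in> span (monomial ` mon_index_mod I P n)"
      using g_mul_Fil[OF w(1) c] le by auto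
    ultimately have "g \<star> (word_prod w - c *s word_prod (sort w)) + c *s (g \<star> word_prod (sort w)) \<in> span (monomial ` mon_index_mod I P n)"
      by (intro span_add span_scale)
    then show ?thesis by (simp add: mul_diff_right mul_scale_right)
  qed
qed simp

lemma Fil_insert_decomp:
  assumes "insert i M \<subseteq> J" "u \<in> Fil (insert i M) 2"
  obtains d u' where "u = (\<Sum>g\<in>G. d g *s (g \<star> x i)) + u'" "u' \<in> Fil M 2"
proof -
  have "Fil (insert i M) 2 \<subseteq> span ((\<lambda>g. g \<star> x i) ` G \<union> Fil M 2)"
    using assms(1) G_subset_Fil[of M]
    by (intro Fil_2_minimal) (auto intro!: span_base gx_in_Fil intro: span_base)
  then obtain a u' where "u = a + u'" "a \<in> span ((\<lambda>g. g \<star> x i) ` G)" "u' \<in> span (Fil M 2)"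
    using assms(2) unfolding span_Un by auto
  moreover have "span (Fil M 2) = Fil M 2" using subspace_Fil by simp
  ultimately show ?thesis using that span_family[OF finite_G] by metis
qed

lemma good_single: "I \<subseteq> J \<Longrightarrow> i \<in> I \<Longrightarrow> good I [i]"
  using N_ge_2[of i] by (auto simp: good_def)

end

section \<open>Pivots of a right coideal subalgebra\<close>

locale coideal_subalgebra_setting = coideal_setting +
  fixes I :: "nat set" and A :: "'b set"
  assumes minimal: "minimal_gens I" and e_nonzero: "e \<noteq> 0"
    and subspace_A: "subspace A" and e_in_A: "e \<in> A"
    and mul_in_A: "\<And>a b. a \<in> A \<Longrightarrow> b \<in> A \<Longrightarrow> a \<star> b \<in> A"
    and D_in_A: "\<And>f a. linear_functional scale f \<Longrightarrow> a \<in> A \<Longrightarrow> D f a \<in> A"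
begin

lemma I_subset: "I \<subseteq> J"
  using minimal by (simp add: minimal_gens_def)

lemma finite_I: "finite I"
  using I_subset finite_J finite_subset by blast

lemma dual_functional:
  assumes "(h, s) \<in> mon_index I n"
  obtains f where "linear_functional scale f" "\<And>b. b \<in> mon_index I n \<Longrightarrow>
      f (monomial b) = (if b = (h, s) then 1 else 0)"
  using indep_family_dual[OF finite_idx[OF finite_I] monomials_independent[OF e_nonzero minimal] assms]
  by auto

text \<open>No antipode acts on \<open>A\<close>. Instead, right multiplication by \<open>g\<close>
  is injective on the finite set \<open>G \<inter> A\<close>, hence onto, and \<open>e\<close> is
  hit.\<close>

lemma inverse_in_A:
  assumes "g \<in> G" "g \<in> A"
  obtains h where "h \<in> G" "h \<in> A" "h \<star> g = e"
proof -
  have inj: "inj_on (\<lambda>h. h \<star> g) (G \<inter> A)"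
    using assms G_right_cancel by (auto simp: inj_on_def)
  have "(\<lambda>h. h \<star> g) ` (G \<inter> A) \<subseteq> G \<inter> A" using assms mul_in_G mul_in_A by auto
  then have "(\<lambda>h. h \<star> g) ` (G \<inter> A) = G \<inter> A"
    using inj finite_G by (intro endo_inj_surj) auto
  then obtain h where "h \<in> G \<inter> A" "h \<star> g = e" using e_in_G e_in_A by (metis IntI imageE)
  then show ?thesis using that by auto
qed

text \<open>\<open>D f\<close> with \<open>f\<close> dual to the leading monomial returns a nonzero
  multiple of its group part. This makes multiplication and, by \<open>inverse_in_A\<close>,
  division by \<open>g\<close> available inside \<open>A\<close>.\<close>

lemma leading_group_element_in_A:
  assumes a: "a \<in> A" "a = (\<Sum>b\<in>mon_index I n. c b *s monomial b)"
    and gw: "(g, w) \<in> mon_index I n" "n = Suc (length w)" "c (g, w) \<noteq> 0"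
  shows "g \<in> A"
proof -
  obtain f where f: "linear_functional scale f" "\<And>b. b \<in> mon_index I n \<Longrightarrow>
      f (monomial b) = (if b = (g, w) then 1 else 0)"
    using dual_functional[OF gw(1)] by metis
  have "D f a = c (g, w) *s g" by (rule D_dual_low[OF I_subset f gw(2,1) a(2)])
  then have "c (g, w) *s g \<in> A" using D_in_A[OF f(1) a(1)] by simp
  then have "inverse (c (g, w)) *s (c (g, w) *s g) \<in> A" by (rule subspace_scale[OF subspace_A])
  then show ?thesis using gw(3) by simp
qed

text \<open>A reduced row echelon form in degree one: \<open>x p\<close> has coefficient 1 in
  \<open>v p\<close> and is its only term with a letter from \<open>P\<close>.\<close>

definition pivots :: "nat set \<Rightarrow> (nat \<Rightarrow> 'b) \<Rightarrow> bool"
  where "pivots P v \<longleftrightarrow> P \<subseteq> I \<and> (\<forall>p\<in>P. v p \<in> A \<and>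
      v p - x p \<in> Fil (I - P) 2)"

lemma maximal_pivots:
  obtains P v where "pivots P v" "\<And>P' v'. pivots P' v' \<Longrightarrow> \<not> P \<subset> P'"
proof -
  let ?Y = "{P. \<exists>v. pivots P v}"
  have "?Y \<subseteq> Pow I" by (auto simp: pivots_def)
  then have "finite ?Y" using finite_I by (meson finite_Pow_iff finite_subset)
  moreover have "{} \<in> ?Y" by (simp add: pivots_def)
  ultimately obtain P where P: "P \<in> ?Y" "\<forall>P'\<in>?Y. P \<le> P' \<longrightarrow> P = P'"
    using finite_has_maximal[of ?Y] by (metis empty_iff)
  then obtain v where "pivots P v" by blast
  moreover have "\<not> P \<subset> P'" if "pivots P' v'" for P' v' using that P(2) by auto
  ultimately show ?thesis by (rule that)
qed

text \<open>One elimination step. The multiples of \<open>g \<star> x i\<close> in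
  \<open>v p\<close> are cancelled by multiples of \<open>g \<star> y\<close>. These lie in
  \<open>A\<close>, because a nonzero coefficient makes \<open>g\<close> the group part of a leading
  monomial of \<open>v p\<close>.\<close>

lemma pivots_extend:
  assumes P: "pivots P v" and i: "i \<in> I" "i \<notin> P" and y: "y \<in> A" "y - x i \<in> Fil (I - insert i P) 2"
  shows "\<exists>v'. pivots (insert i P) v'"
proof -
  let ?M = "I - insert i P"
  have M: "insert i ?M \<subseteq> J" "insert i ?M = I - P" "?M \<subseteq> J" using i I_subset by auto
  have "\<exists>z. z \<in> A \<and> z - x p \<in> Fil ?M 2" if p: "p \<in> P" for p
  proof -
    have vp: "v p \<in> A" "v p - x p \<in> Fil (I - P) 2" "p \<in> I" "p \<noteq> i"
      using P p i by (auto simp: pivots_def)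
    obtain d u where d: "v p - x p = (\<Sum>g\<in>G. d g *s (g \<star> x i)) + u" "u \<in> Fil ?M 2"
      using Fil_insert_decomp[OF M(1)] vp(2) M(2) by metis
    have gA: "d g = 0 \<or> g \<in> A" if g: "g \<in> G" for g
    proof -
      have gi: "(g, [i]) \<in> mon_index I 2" using g good_single[OF I_subset i(1)] by (simp add: mon_index_def)
      obtain f where f: "linear_functional scale f" "\<And>b. b \<in> mon_index I 2 \<Longrightarrow>
          f (monomial b) = (if b = (g, [i]) then 1 else 0)"
        using dual_functional[OF gi] by metis
      have vF: "v p \<in> Fil I 2"
        using Fil_add[OF _ x_in_Fil[OF vp(3) I_subset], of "v p - x p"]
          Fil_subset_mono[of "I - P" I 2] vp(2) by auto
      then obtain c where c: "v p = (\<Sum>b\<in>mon_index I 2. c b *s monomial b)"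
        unfolding Fil_eq_span[OF I_subset] using span_family[OF finite_idx[OF finite_I]] by auto
      have "f (v p) = (\<Sum>b\<in>mon_index I 2. if b = (g, [i]) then c b else 0)"
        unfolding c linear_functional_sum[OF f(1)] by (intro sum.cong) (auto simp: linear_functional_scale[OF f(1)] f(2))
      \<comment> \<open>\<open>f\<close> reads the coefficient of \<open>(g, [i])\<close> in
        \<open>v p\<close> in two ways: as \<open>c (g, [i])\<close> here, and as \<open>d g\<close>
        from the decomposition of \<open>v p - x p\<close> below.\<close>
      then have fc: "f (v p) = c (g, [i])" using gi finite_idx[OF finite_I] by simp
      have fx: "f (h \<star> x j) = (if h = g \<and> j = i then 1 else 0)" if "h \<in> G" "j \<in> I" for h j
        using f(2)[of "(h, [j])"] that good_single[OF I_subset] x_mul_e[of j] I_subset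
        by (auto simp: monomial_def mon_index_def)
      have fu: "f u = 0"
      proof (rule linear_functional_span_zero[OF f(1)])
        show "u \<in> span (monomial ` mon_index ?M 2)" using d(2) Fil_eq_span[OF M(3)] by simp
        fix b assume "b \<in> monomial ` mon_index ?M 2"
        then obtain h w where b: "b = monomial (h, w)" "(h, w) \<in> mon_index ?M 2" by auto
        then have "(h, w) \<in> mon_index I 2" "w \<noteq> [i]" by (auto simp: mon_index_def good_def)
        then show "f b = 0" using f(2)[of "(h, w)"] b by auto
      qed
      have "f (x p) = 0"
        using fx[OF e_in_G vp(3)] vp(3,4) I_subset e_mul_x[of p] by (simp add: subset_iff)
      moreover have "f (\<Sum>g\<in>G. d g *s (g \<star> x i)) = (\<Sum>h\<in>G. if h = g then d h else 0)"
        unfolding linear_functional_sum[OF f(1)] by (intro sum.cong) (auto simp: linear_functional_scale[OF f(1)] fx i)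
      moreover have "v p = x p + ((\<Sum>g\<in>G. d g *s (g \<star> x i)) + u)"
        using d(1) by (simp add: algebra_simps)
      ultimately have "f (v p) = d g"
        using fu g finite_G by (simp add: linear_functional_add[OF f(1)])
      then show ?thesis
        using leading_group_element_in_A[OF vp(1) c gi] fc by auto
    qed
    let ?z = "v p - (\<Sum>g\<in>G. d g *s (g \<star> y))"
    have "?z \<in> A"
    proof (intro subspace_diff[OF subspace_A vp(1)] subspace_sum[OF subspace_A])
      fix g assume "g \<in> G"
      then show "d g *s (g \<star> y) \<in> A"
        using gA[of g] y(1) by (auto simp: subspace_0[OF subspace_A] intro: subspace_scale[OF subspace_A] mul_in_A)
    qed
    moreover have "?z - x p = u - (\<Sum>g\<in>G. d g *s (g \<star> (y - x i)))"
      using d(1) by (simp add: mul_diff_right scale_right_diff_distrib sum_subtractf algebra_simps)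
    moreover have "\<dots> \<in> Fil ?M 2"
      by (intro Fil_diff d(2) subspace_sum[OF subspace_Fil] Fil_scale g_mul_Fil y(2))
    ultimately show ?thesis by metis
  qed
  then obtain v' where v': "\<And>p. p \<in> P \<Longrightarrow> v' p \<in> A \<and> v' p - x p \<in> Fil ?M 2" by metis
  have "pivots (insert i P) (v'(i := y))"
    using v' i y P by (auto simp: pivots_def)
  then show ?thesis by blast
qed

text \<open>Induction on the number of letters of \<open>w\<close> outside \<open>P\<close>. If the
  coefficient at \<open>w\<close> survives, take a letter \<open>i\<close> of \<open>w\<close>
  outside \<open>P\<close> and the operator dual to \<open>w\<close> without \<open>i\<close>. In
  the result a letter \<open>j\<close> in \<open>P\<close> would come from
  \<open>insort j s\<close>, which has fewer letters outside \<open>P\<close>, so its coefficient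
  vanishes. Division by \<open>g\<close> and \<open>d i\<close> then yields an element of
  \<open>A\<close> with pivot \<open>x i\<close>, against the maximality of
  \<open>P\<close>.\<close>

lemma leading_coefficients_vanish:
  assumes P: "pivots P v" "\<And>P' v'. pivots P' v' \<Longrightarrow> \<not> P \<subset> P'"
    and n: "n \<ge> 1"
    and a: "a \<in> A" "a = (\<Sum>b\<in>mon_index I (Suc n). c b *s monomial b)"
    and c: "\<And>g w. (g, w) \<in> mon_index I (Suc n) \<Longrightarrow> length w = n \<Longrightarrow>
        set w \<subseteq> P \<Longrightarrow> c (g, w) = 0"
    and gw: "(g, w) \<in> mon_index I (Suc n)" "length w = n"
  shows "c (g, w) = 0"
  using gw
proof (induction "length (filter (\<lambda>i. i \<notin> P) w)" arbitrary: g w)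
  case 0
  then have "set w \<subseteq> P" by (auto simp: filter_empty_conv)
  then show ?case using c 0 by auto
next
  case (Suc m)
  show ?case
  proof (rule ccontr)
    assume c0: "c (g, w) \<noteq> 0"
    have "filter (\<lambda>i. i \<notin> P) w \<noteq> []" using Suc.hyps(2) by auto
    then obtain i where i: "i \<in> set w" "i \<notin> P" by (auto simp: filter_empty_conv)
    have w: "g \<in> G" "good I w" "sorted w" "set w \<subseteq> I" using Suc.prems by (auto simp: mon_index_def good_def)
    have iI: "i \<in> I" "i \<in> J" using i w I_subset by auto
    define s h where "s = remove1 i w" and "h = g \<star> gl i"
    have ins: "insort i s = w" unfolding s_def using i w by (simp add: insort_remove1)
    have hs: "(h, s) \<in> mon_index I n"
      using w i Suc.prems n gl_in_G[OF iI(2)]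
      by (auto simp: mon_index_def h_def s_def length_remove1 mul_in_G good_remove1)
    have ns: "n = Suc (length s)" using i Suc.prems n by (simp add: s_def length_remove1)
    have m: "length (filter (\<lambda>i. i \<notin> P) s) = m"
      using Suc.hyps(2) i by (simp add: s_def filter_remove1 length_remove1)
    obtain f where f: "linear_functional scale f" "\<And>b. b \<in> mon_index I n \<Longrightarrow>
        f (monomial b) = (if b = (h, s) then 1 else 0)"
      using dual_functional[OF hs] by metis
    obtain k where k: "\<And>i. i \<in> I \<Longrightarrow> k i \<in> G \<and> k i \<star> gl i = h"
      using left_quotients[OF _ I_subset, of h] hs by (auto simp: mon_index_def)
    have ki: "k i = g" using k[OF iI(1)] w(1) iI h_def G_right_cancel gl_in_G by metis
    define I' where "I' = {j\<in>I. good I (insort j s)}"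
    define d where "d j = c (k j, insort j s) * beta (insort j s) j" for j
    have "D f a - (\<Sum>j\<in>I'. d j *s (k j \<star> x j)) \<in> span G"
      unfolding I'_def d_def by (rule D_dual_top[OF I_subset f ns hs k a(2)])
    then have 1: "D f a - (\<Sum>j\<in>I'. d j *s (k j \<star> x j)) \<in> Fil (I - insert i P) 2"
      using G_subset_Fil by blast
    have iI': "i \<in> I'" using iI ins w by (simp add: I'_def)
    have finI': "finite I'" using finite_I by (simp add: I'_def)
    have d0: "d j = 0" if j: "j \<in> I'" "j \<in> P" for j
    proof -
      have "length (filter (\<lambda>i. i \<notin> P) (insort j s)) = m"
        using m j(2) by (induction s arbitrary: m) auto
      moreover have "(k j, insort j s) \<in> mon_index I (Suc n)" "length (insort j s) = n"
        using j k ns by (auto simp: I'_def mon_index_def)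
      ultimately have "c (k j, insort j s) = 0" using Suc.hyps(1) by blast
      then show ?thesis by (simp add: d_def)
    qed
    \<comment> \<open>Letters other than \<open>i\<close> that lie outside \<open>P\<close> do no
      harm: they belong to \<open>I - insert i P\<close>.\<close>
    have 2: "(\<Sum>j\<in>I' - {i}. d j *s (k j \<star> x j)) \<in> Fil (I - insert i P) 2"
    proof (rule subspace_sum[OF subspace_Fil])
      fix j assume j: "j \<in> I' - {i}"
      then have "d j *s (k j \<star> x j) = 0 \<or> j \<in> I - insert i P" using d0 by (auto simp: I'_def)
      moreover have "k j \<in> G" using j k by (simp add: I'_def)
      ultimately show "d j *s (k j \<star> x j) \<in> Fil (I - insert i P) 2"
        using gx_in_Fil[of "k j" j "I - insert i P"] I_subset
        by (auto simp: subspace_0[OF subspace_Fil] intro: Fil_scale)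
    qed
    have eq: "(D f a - (\<Sum>j\<in>I'. d j *s (k j \<star> x j))) + (\<Sum>j\<in>I' - {i}. d j *s (k j \<star> x j))
        = D f a - d i *s (g \<star> x i)"
      by (simp add: sum.remove[OF finI' iI'] ki)
    have 3: "D f a - d i *s (g \<star> x i) \<in> Fil (I - insert i P) 2"
      using Fil_add[OF 1 2] unfolding eq .
    have di: "d i \<noteq> 0"
      using c0 beta_nonzero[OF I_subset w(2) i(1)] by (simp add: d_def ki ins)
    \<comment> \<open>The coefficient at \<open>(g, w)\<close>, assumed nonzero, puts
      \<open>g\<close> into \<open>A\<close>, so that division by \<open>g\<close> stays in
      \<open>A\<close>.\<close>
    have "g \<in> A"
      by (rule leading_group_element_in_A[OF a Suc.prems(1) _ c0]) (simp add: Suc.prems(2))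
    then obtain g' where g': "g' \<in> G" "g' \<in> A" "g' \<star> g = e" using inverse_in_A w(1) by blast
    define y where "y = inverse (d i) *s (g' \<star> D f a)"
    have "y \<in> A"
      unfolding y_def by (intro subspace_scale[OF subspace_A] mul_in_A g' D_in_A f a)
    moreover have "y - x i \<in> Fil (I - insert i P) 2"
    proof -
      have "inverse (d i) *s (g' \<star> (D f a - d i *s (g \<star> x i))) = y - x i"
        using di g' e_mul_x[OF iI(2)]
        by (simp add: y_def mul_diff_right scale_right_diff_distrib mul_scale_right mul_assoc[symmetric])
      then show ?thesis using Fil_scale[OF g_mul_Fil[OF g'(1) 3], of "inverse (d i)"] by simp
    qed
    ultimately obtain v' where "pivots (insert i P) v'" using pivots_extend P(1) iI(1) i(2) by blast
    then show False using P(2)[of "insert i P" v'] i(2) by auto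
  qed
qed

text \<open>\<open>S\<close> is an arbitrary subalgebra that contains the part of \<open>A\<close>
  of degree at most one; that \<open>A\<close> lies in every such \<open>S\<close> expresses
  generation. The induction on the degree removes the leading terms of \<open>a\<close> by an
  element of \<open>A \<inter> S\<close>.\<close>

theorem subset_of_degree_one_closed:
  assumes S: "subspace S" "e \<in> S" "\<And>a b. a \<in> S \<Longrightarrow> b \<in> S \<Longrightarrow>
      a \<star> b \<in> S"
    and deg1: "A \<inter> Fil I 2 \<subseteq> S" and AC: "A \<subseteq> C"
  shows "A \<subseteq> S"
proof -
  obtain P v where P: "pivots P v" "\<And>P' v'. pivots P' v' \<Longrightarrow> \<not> P \<subset> P'"
    using maximal_pivots by blast
  have vA: "v p \<in> A" "v p - x p \<in> Fil (I - P) 2" "p \<in> I" if "p \<in> P" for p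
    using P(1) that by (auto simp: pivots_def)
  have PI: "P \<subseteq> I" using P(1) by (simp add: pivots_def)
  have vS: "v p \<in> S" if p: "p \<in> P" for p
  proof -
    have "(v p - x p) + x p \<in> Fil I 2"
      using vA[OF p] Fil_subset_mono[of "I - P" I 2] x_in_Fil[OF _ I_subset]
      by (intro Fil_add) auto
    then show ?thesis using vA[OF p] deg1 by auto
  qed
  have word_prod_of: "word_prod_of v w \<in> A \<inter> S" if "set w \<subseteq> P" for w
    using that by (induction w) (auto simp: word_prod_of_def e_in_A S vA vS mul_in_A)
  have GS: "g \<in> A \<Longrightarrow> g \<in> G \<Longrightarrow> g \<in> S" for g
    using deg1 G_subset_Fil[of I] span_base[of g G] by blast
  have "A \<inter> Fil I n \<subseteq> S" for n
  proof (induction n)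
    case 0
    show ?case using subspace_0[OF S(1)] by auto
  next
    case (Suc n)
    show ?case
    proof (cases "n = 0")
      case True
      then show ?thesis using deg1 Fil_mono[of 1 2 I] by auto
    next
      case n: False
      show ?thesis
      proof
        fix a assume a: "a \<in> A \<inter> Fil I (Suc n)"
        have fin: "finite (mon_index I (Suc n))" by (rule finite_idx[OF finite_I])
        obtain c where c: "a = (\<Sum>b\<in>mon_index I (Suc n). c b *s monomial b)"
          using a span_family[OF fin, of a monomial] unfolding Fil_eq_span[OF I_subset] by blast
        define Y where "Y = {b \<in> mon_index I (Suc n). length (snd b) = n \<and> set (snd b) \<subseteq> P}"
        have Y: "Y \<subseteq> mon_index I (Suc n)" "mon_index I (Suc n) - Y = mon_index_mod I P n"
          by (auto simp: Y_def mon_index_mod_def)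
        \<comment> \<open>Each leading monomial of \<open>a\<close> over \<open>P\<close> is
          imitated by the same group element times a word in the \<open>v p\<close>.\<close>
        define u where "u = (\<Sum>b\<in>Y. c b *s (fst b \<star> word_prod_of v (snd b)))"
        have "c b *s (fst b \<star> word_prod_of v (snd b)) \<in> A \<inter> S" if b: "b \<in> Y" for b
        \<comment> \<open>Only a nonzero coefficient guarantees that the group part of
          \<open>b\<close> lies in \<open>A\<close>.\<close>
        proof (cases "c b = 0")
          case True
          then show ?thesis by (simp add: subspace_0[OF subspace_A] subspace_0[OF S(1)])
        next
          case False
          have b': "(fst b, snd b) \<in> mon_index I (Suc n)" "Suc n = Suc (length (snd b))"
            "c (fst b, snd b) \<noteq> 0" "fst b \<in> G" "set (snd b) \<subseteq> P"
            using b False by (auto simp: Y_def mon_index_def)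
          have gA: "fst b \<in> A"
            by (rule leading_group_element_in_A[OF _ c b'(1-3)]) (use a in blast)
          have "fst b \<star> word_prod_of v (snd b) \<in> A" "fst b \<star> word_prod_of v (snd b) \<in> S"
            using gA GS[OF gA b'(4)] word_prod_of[OF b'(5)] mul_in_A S(3) by blast+
          then show ?thesis
            using subspace_scale[OF subspace_A] subspace_scale[OF S(1)] by blast
        qed
        then have u: "u \<in> A" "u \<in> S" unfolding u_def
          by (intro subspace_sum subspace_A S(1); blast)+
        have "a - u = (\<Sum>b\<in>mon_index_mod I P n. c b *s monomial b)
            - (\<Sum>b\<in>Y. c b *s (fst b \<star> (word_prod_of v (snd b) - word_prod (snd b))))"
          unfolding c u_def sum.subset_diff[OF Y(1) fin] Y(2)
          by (simp add: monomial_def mul_diff_right scale_right_diff_distrib sum_subtractf)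
        also have "\<dots> \<in> span (monomial ` mon_index_mod I P n)"
        proof (intro span_diff span_sum span_scale)
          fix b assume "b \<in> mon_index_mod I P n"
          then show "monomial b \<in> span (monomial ` mon_index_mod I P n)" by (intro span_base) auto
        next
          fix b assume b: "b \<in> Y"
          have "word_prod_of v (snd b) - word_prod (snd b) \<in> Fil_mod I P (length (snd b))"
            using b vA PI by (intro word_prod_of_minus_word_prod[OF I_subset]) (auto simp: Y_def)
          then have "fst b \<star> (word_prod_of v (snd b) - word_prod (snd b)) \<in> Fil_mod I P n"
            using b by (intro g_mul_Fil_mod) (auto simp: Y_def mon_index_def)
          then show "fst b \<star> (word_prod_of v (snd b) - word_prod (snd b)) \<in> span (monomial ` mon_index_mod I P n)"
            using Fil_mod_subset_span[OF I_subset] by blast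
        qed
        finally have "a - u \<in> span (monomial ` mon_index_mod I P n)" .
        moreover have fin': "finite (mon_index_mod I P n)" using fin Y(2) by (metis finite_Diff)
        ultimately obtain c' where c': "a - u = (\<Sum>b\<in>mon_index_mod I P n. c' b *s monomial b)"
          using span_family by metis
        \<comment> \<open>Extended by zero, the coefficients vanish at all words of length
          \<open>n\<close> over \<open>P\<close>, as \<open>leading_coefficients_vanish\<close>
          requires.\<close>
        define c'' where "c'' b = (if b \<in> mon_index_mod I P n then c' b else 0)" for b
        have c'': "a - u = (\<Sum>b\<in>mon_index I (Suc n). c'' b *s monomial b)"
          unfolding c' by (intro sum.mono_neutral_cong_left fin) (auto simp: c''_def mon_index_mod_def)
        have auA: "a - u \<in> A" using a u by (intro subspace_diff[OF subspace_A]) auto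
        have "c'' (g, w) = 0" if gw: "(g, w) \<in> mon_index I (Suc n)" "length w = n" for g w
          by (rule leading_coefficients_vanish[OF P _ auA c'' _ gw])
            (use n in \<open>auto simp: c''_def mon_index_mod_def\<close>)
        then have "(\<Sum>b\<in>mon_index I (Suc n). c'' b *s monomial b) = (\<Sum>b\<in>mon_index I n. c'' b *s monomial b)"
          by (intro sum.mono_neutral_right fin mon_index_mono ballI) (auto simp: mon_index_def less_Suc_eq)
        then have "a - u \<in> Fil I n"
          unfolding c'' Fil_eq_span[OF I_subset] by (auto intro!: span_sum span_scale intro: span_base)
        then have "a - u \<in> S" using auA Suc.IH by blast
        then have "(a - u) + u \<in> S" using u(2) by (rule subspace_add[OF S(1)])
        then show "a \<in> S" by simp
      qed
    qed
  qed
  then show ?thesis using AC C_subset_Fil[OF minimal] by blast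
qed

end

context coideal_setting
begin

theorem coideal_subalgebra_subset:
  assumes A: "subspace A" "e \<in> A" "\<And>a b. a \<in> A \<Longrightarrow> b \<in> A \<Longrightarrow>
      a \<star> b \<in> A"
    "\<And>f a. linear_functional scale f \<Longrightarrow> a \<in> A \<Longrightarrow> D f a \<in> A" "A \<subseteq> C"
    and S: "subspace S" "e \<in> S" "\<And>a b. a \<in> S \<Longrightarrow> b \<in> S \<Longrightarrow> a \<star> b \<in> S"
    and deg1: "A \<inter> span (G \<union> {g \<star> x i | g i. g \<in> G \<and> i \<in> J}) \<subseteq> S"
  shows "A \<subseteq> S"
\<comment> \<open>Nothing in the locale excludes the zero algebra. If \<open>e = 0\<close>, then
  \<open>C\<close> is zero and the claim is trivial; otherwise the group elements are independent
  and the pivot argument applies.\<close>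
proof (cases "e = 0")
  case True
  have "C \<subseteq> {0}"
  proof
    fix a assume "a \<in> C"
    then show "a \<in> {0}"
      by (intro C_induct[of "{0}" a]) (simp_all add: True subspace_def)
  qed
  then show ?thesis using A(5) subspace_0[OF S(1)] by blast
next
  case False
  obtain I where I: "minimal_gens I" using minimal_gens_exists by blast
  have "coideal_subalgebra_setting_axioms scale mul e G J x D I A"
    unfolding coideal_subalgebra_setting_axioms_def using I A(1,2) False
    by (intro conjI allI impI A(3,4)) assumption+
  then interpret coideal_subalgebra_setting scale mul e G J x gl N comm D C I A
    by (rule coideal_subalgebra_setting.intro[OF coideal_setting_axioms])
  have "Fil I 2 \<subseteq> span (G \<union> {g \<star> x i | g i. g \<in> G \<and> i \<in> J})"
  proof (intro Fil_2_minimal I_subset)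
    fix g assume "g \<in> G"
    then show "g \<in> span (G \<union> {g \<star> x i | g i. g \<in> G \<and> i \<in> J})" by (intro span_base UnI1)
  next
    fix g i assume "g \<in> G" "i \<in> I"
    then show "g \<star> x i \<in> span (G \<union> {g \<star> x i | g i. g \<in> G \<and> i \<in> J})"
      using I_subset by (intro span_base UnI2) auto
  qed simp
  then have "A \<inter> Fil I 2 \<subseteq> S" using deg1 by blast
  from subset_of_degree_one_closed[OF S this A(5)] show ?thesis .
qed

end

section \<open>Algebras as records\<close>

definition pm_scale :: "'k::field \<Rightarrow> ('m \<Rightarrow>\<^sub>0 'k) \<Rightarrow> 'm \<Rightarrow>\<^sub>0 'k"
  where "pm_scale c = Poly_Mapping.map (\<lambda>a. c * a)"

lemma lookup_pm_scale [simp]: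
  "Poly_Mapping.lookup (pm_scale c p) m = c * Poly_Mapping.lookup p m"
  by (simp add: pm_scale_def Poly_Mapping.map.rep_eq when_def)

lemma vector_space_pm_scale: "vector_space (pm_scale :: 'k::field \<Rightarrow> ('m \<Rightarrow>\<^sub>0 'k) \<Rightarrow> _)"
  by unfold_locales (auto intro!: poly_mapping_eqI simp: lookup_add algebra_simps)

interpretation pm: vector_space "pm_scale :: 'k::field \<Rightarrow> ('m \<Rightarrow>\<^sub>0 'k) \<Rightarrow> _"
  by (rule vector_space_pm_scale)

lemma pm_scale_single [simp]: "pm_scale c (Poly_Mapping.single m a) = Poly_Mapping.single m (c * a)"
  by (rule poly_mapping_eqI) (simp add: lookup_single when_def)

lemma keys_pm_scale: "Poly_Mapping.keys (pm_scale c p) \<subseteq> Poly_Mapping.keys p"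
  by (auto simp: in_keys_iff)

lemma pm_sum_singles:
  "p = (\<Sum>m\<in>Poly_Mapping.keys p. Poly_Mapping.single m (Poly_Mapping.lookup p m))"
  by (rule poly_mapping_eqI) (auto simp: lookup_sum lookup_single when_def in_keys_iff)

text \<open>The bound \<open>K\<close> on the supports is carried along, because the properties to
  be proved typically hold only for elements of a carrier.\<close>

lemma pm_linear_induct [consumes 1, case_names zero single add scale]:
  assumes "Poly_Mapping.keys p \<subseteq> K"
    and "P 0" "\<And>m. m \<in> K \<Longrightarrow> P (Poly_Mapping.single m 1)"
    and add: "\<And>p q. Poly_Mapping.keys p \<subseteq> K \<Longrightarrow> Poly_Mapping.keys q \<subseteq> K \<Longrightarrow>
        P p \<Longrightarrow> P q \<Longrightarrow> P (p + q)"
    and scale: "\<And>c p. Poly_Mapping.keys p \<subseteq> K \<Longrightarrow> P p \<Longrightarrow> P (pm_scale c p)"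
  shows "P (p :: 'm \<Rightarrow>\<^sub>0 'k::field)"
proof -
  have "Poly_Mapping.keys (\<Sum>m\<in>Y. Poly_Mapping.single m (Poly_Mapping.lookup p m)) \<subseteq> K \<and>
    P (\<Sum>m\<in>Y. Poly_Mapping.single m (Poly_Mapping.lookup p m))" if "finite Y" "Y \<subseteq> K" for Y
    using that
  proof (induction Y rule: finite_induct)
    case empty
    then show ?case using assms(2) by simp
  next
    case (insert m Y)
    let ?s = "Poly_Mapping.single m (Poly_Mapping.lookup p m)"
    have 1: "Poly_Mapping.keys ?s \<subseteq> K" using insert.prems by simp
    have "P (pm_scale (Poly_Mapping.lookup p m) (Poly_Mapping.single m 1))"
      using insert.prems assms(3) by (intro scale) auto
    then have 2: "P ?s" by simp
    show ?case
      using insert 1 2 add keys_add[of ?s "\<Sum>m\<in>Y. Poly_Mapping.single m (Poly_Mapping.lookup p m)"]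
      by (simp add: subset_iff) blast
  qed
  from this[of "Poly_Mapping.keys p"] assms(1) show ?thesis
    by (subst pm_sum_singles) simp
qed

definition pm_ext :: "('k::field \<Rightarrow> 'v::ab_group_add \<Rightarrow> 'v) \<Rightarrow> ('m \<Rightarrow> 'v) \<Rightarrow> ('m \<Rightarrow>\<^sub>0 'k) \<Rightarrow> 'v"
  where "pm_ext s f p = (\<Sum>m\<in>Poly_Mapping.keys p. s (Poly_Mapping.lookup p m) (f m))"

context vector_space
begin

lemma pm_ext_superset:
  assumes "finite Y" "Poly_Mapping.keys p \<subseteq> Y"
  shows "pm_ext scale f p = (\<Sum>m\<in>Y. scale (Poly_Mapping.lookup p m) (f m))"
  unfolding pm_ext_def using assms
  by (intro sum.mono_neutral_left) (auto simp: in_keys_iff)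

lemma pm_ext_single [simp]: "pm_ext scale f (Poly_Mapping.single m a) = scale a (f m)"
  by (subst pm_ext_superset[of "{m}"]) auto

lemma pm_ext_zero [simp]: "pm_ext scale f 0 = 0"
  by (simp add: pm_ext_def)

lemma pm_ext_add: "pm_ext scale f (p + q) = pm_ext scale f p + pm_ext scale f q"
proof -
  let ?Y = "Poly_Mapping.keys p \<union> Poly_Mapping.keys q"
  show ?thesis
    using keys_add[of p q]
    by (simp add: pm_ext_superset[of ?Y] lookup_add scale_left_distrib sum.distrib)
qed

lemma pm_ext_scale: "pm_ext scale f (pm_scale c p) = scale c (pm_ext scale f p)"
  using keys_pm_scale[of c p]
  by (simp add: pm_ext_superset[of "Poly_Mapping.keys p"] scale_sum_right)

lemma pm_ext_diff: "pm_ext scale f (p - q) = pm_ext scale f p - pm_ext scale f q"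
  by (metis pm_ext_add add_diff_cancel diff_add_cancel)

end

section \<open>Algebras over a field on a carrier set\<close>

locale k_algebra = ring R for R :: "('k::field, 'a, 'e) module_scheme" (structure) +
  assumes smult_closed [simp, intro]: "a \<in> carrier R \<Longrightarrow> c \<odot> a \<in> carrier R"
    and smult_l_distr: "a \<in> carrier R \<Longrightarrow> (c + d) \<odot> a = c \<odot> a \<oplus> d \<odot> a"
    and smult_r_distr: "a \<in> carrier R \<Longrightarrow> b \<in> carrier R \<Longrightarrow>
        c \<odot> (a \<oplus> b) = c \<odot> a \<oplus> c \<odot> b"
    and smult_assoc: "a \<in> carrier R \<Longrightarrow> c \<odot> (d \<odot> a) = (c * d) \<odot> a"
    and smult_one [simp]: "a \<in> carrier R \<Longrightarrow> 1 \<odot> a = a"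
    and smult_mult_left: "a \<in> carrier R \<Longrightarrow> b \<in> carrier R \<Longrightarrow>
        (c \<odot> a) \<otimes> b = c \<odot> (a \<otimes> b)"
    and smult_mult_right: "a \<in> carrier R \<Longrightarrow> b \<in> carrier R \<Longrightarrow>
        a \<otimes> (c \<odot> b) = c \<odot> (a \<otimes> b)"
begin

lemma smult_zero_left [simp]: "a \<in> carrier R \<Longrightarrow> 0 \<odot> a = \<zero>"
  using smult_l_distr[of a 0 0] by (simp add: add.l_cancel_one')

lemma smult_zero_right [simp]: "c \<odot> \<zero> = \<zero>"
  using smult_r_distr[of \<zero> \<zero> c] by (simp add: add.l_cancel_one')

lemma smult_minus_one: "a \<in> carrier R \<Longrightarrow> (-1) \<odot> a = \<ominus> a"
  using smult_l_distr[of a "-1" 1] by (metis add.inv_equality add.right_inverse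
      add_uminus_conv_diff diff_self smult_closed smult_one smult_zero_left uminus_add_conv_diff)

lemma smult_r_minus: "a \<in> carrier R \<Longrightarrow> c \<odot> (\<ominus> a) = \<ominus> (c \<odot> a)"
  by (simp add: smult_minus_one[symmetric] smult_assoc)

lemma smult_r_diff: "a \<in> carrier R \<Longrightarrow> b \<in> carrier R \<Longrightarrow>
    c \<odot> (a \<ominus> b) = c \<odot> a \<ominus> c \<odot> b"
  by (simp add: a_minus_def smult_r_distr smult_r_minus)

lemma finsum_smult:
  "h \<in> B \<rightarrow> carrier R \<Longrightarrow> c \<odot> finsum R h B = (\<Oplus>b\<in>B. c \<odot> h b)"
proof (induction B rule: infinite_finite_induct)
  case (insert b B)
  then show ?case by (simp add: smult_r_distr Pi_iff)
qed auto

lemma submodule_iff: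
  "submodule W (KK :: 'k ring) R \<longleftrightarrow> W \<subseteq> carrier R \<and> \<zero> \<in> W \<and>
    (\<forall>a\<in>W. \<forall>b\<in>W. a \<oplus> b \<in> W) \<and> (\<forall>c. \<forall>a\<in>W. c \<odot> a \<in> W)"
proof
  assume "submodule W (KK :: 'k ring) R"
  then interpret submodule W "KK :: 'k ring" R .
  show "W \<subseteq> carrier R \<and> \<zero> \<in> W \<and>
      (\<forall>a\<in>W. \<forall>b\<in>W. a \<oplus> b \<in> W) \<and> (\<forall>c. \<forall>a\<in>W. c \<odot> a \<in> W)"
    using subset m_closed one_closed smult_closed by (auto simp: ring_of_type_algebra_def)
next
  assume *: "W \<subseteq> carrier R \<and> \<zero> \<in> W \<and>
      (\<forall>a\<in>W. \<forall>b\<in>W. a \<oplus> b \<in> W) \<and> (\<forall>c. \<forall>a\<in>W. c \<odot> a \<in> W)"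
  have "subgroup W (add_monoid R)"
  proof (rule add.subgroupI)
    fix a assume "a \<in> W"
    then show "\<ominus> a \<in> W" using * smult_minus_one by (metis subsetD)
  qed (use * in auto)
  then show "submodule W (KK :: 'k ring) R"
    using * by (simp add: submodule_def submodule_axioms_def)
qed

lemma submodule_lin_span:
  assumes "Y \<subseteq> carrier R"
  shows "submodule (lin_span R Y) (KK :: 'k ring) R"
proof -
  have "submodule (carrier R) (KK :: 'k ring) R" by (simp add: submodule_iff)
  then show ?thesis
    unfolding lin_span_def hull_def using assms by (subst submodule_iff) (auto simp: submodule_iff)
qed

lemma lin_span_minimal:
  "submodule W (KK :: 'k ring) R \<Longrightarrow> Y \<subseteq> W \<Longrightarrow> lin_span R Y \<subseteq> W"
  unfolding lin_span_def by (rule hull_minimal)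

lemma lin_span_base: "a \<in> Y \<Longrightarrow> a \<in> lin_span R Y"
  unfolding lin_span_def by (rule hull_inc)

lemma is_subalgebra_iff:
  "is_subalgebra B R \<longleftrightarrow> B \<subseteq> carrier R \<and> \<one> \<in> B \<and>
      (\<forall>a\<in>B. \<forall>b\<in>B. a \<oplus> b \<in> B) \<and>
    (\<forall>c. \<forall>a\<in>B. c \<odot> a \<in> B) \<and> (\<forall>a\<in>B. \<forall>b\<in>B. a \<otimes> b \<in> B)"
proof
  assume "is_subalgebra B R"
  then show "B \<subseteq> carrier R \<and> \<one> \<in> B \<and>
      (\<forall>a\<in>B. \<forall>b\<in>B. a \<oplus> b \<in> B) \<and>
    (\<forall>c. \<forall>a\<in>B. c \<odot> a \<in> B) \<and> (\<forall>a\<in>B. \<forall>b\<in>B. a \<otimes> b \<in> B)"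
    unfolding is_subalgebra_def submodule_iff
    using subringE(1,3,6)[of B R] by (intro conjI ballI) simp_all
next
  assume *: "B \<subseteq> carrier R \<and> \<one> \<in> B \<and>
      (\<forall>a\<in>B. \<forall>b\<in>B. a \<oplus> b \<in> B) \<and>
    (\<forall>c. \<forall>a\<in>B. c \<odot> a \<in> B) \<and> (\<forall>a\<in>B. \<forall>b\<in>B. a \<otimes> b \<in> B)"
  have neg: "\<ominus> a \<in> B" if "a \<in> B" for a
  proof -
    have "a \<in> carrier R" "(-1) \<odot> a \<in> B" using * that by auto
    then show ?thesis by (simp add: smult_minus_one)
  qed
  \<comment> \<open>Zero is not listed in the criterion; it is a scalar multiple of the
    unit.\<close>
  have "0 \<odot> \<one> \<in> B" using * by blast
  then have z: "\<zero> \<in> B" by simp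
  have "subring B R"
    by (rule subringI) (use * neg in simp_all)
  then show "is_subalgebra B R"
    using * z by (simp add: is_subalgebra_def submodule_iff)
qed

definition lin_ext :: "('m \<Rightarrow> 'a) \<Rightarrow> ('m \<Rightarrow>\<^sub>0 'k) \<Rightarrow> 'a"
  where "lin_ext h p = (\<Oplus>m\<in>Poly_Mapping.keys p. Poly_Mapping.lookup p m \<odot> h m)"

lemma lin_ext_superset:
  assumes "finite Y" "Poly_Mapping.keys p \<subseteq> Y" "h \<in> Y \<rightarrow> carrier R"
  shows "lin_ext h p = (\<Oplus>m\<in>Y. Poly_Mapping.lookup p m \<odot> h m)"
  unfolding lin_ext_def using assms
  by (intro add.finprod_mono_neutral_cong_left) (auto simp: in_keys_iff Pi_iff)

lemma lin_ext_closed: "h \<in> Poly_Mapping.keys p \<rightarrow> carrier R \<Longrightarrow> lin_ext h p \<in> carrier R"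
  unfolding lin_ext_def by (rule finsum_closed) auto

lemma lin_ext_zero [simp]: "lin_ext h 0 = \<zero>"
  by (simp add: lin_ext_def)

lemma lin_ext_single [simp]: "h m \<in> carrier R \<Longrightarrow> lin_ext h (Poly_Mapping.single m a) = a \<odot> h m"
  by (subst lin_ext_superset[of "{m}"]) auto

lemma lin_ext_add:
  assumes "h \<in> Poly_Mapping.keys p \<rightarrow> carrier R" "h \<in> Poly_Mapping.keys q \<rightarrow> carrier R"
  shows "lin_ext h (p + q) = lin_ext h p \<oplus> lin_ext h q"
proof -
  let ?Y = "Poly_Mapping.keys p \<union> Poly_Mapping.keys q"
  have h: "h \<in> ?Y \<rightarrow> carrier R" using assms by auto
  have "lin_ext h (p + q) = (\<Oplus>m\<in>?Y. Poly_Mapping.lookup (p + q) m \<odot> h m)"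
    using keys_add[of p q] h by (intro lin_ext_superset) auto
  also have "\<dots> = (\<Oplus>m\<in>?Y. Poly_Mapping.lookup p m \<odot> h m \<oplus> Poly_Mapping.lookup q m \<odot> h m)"
    using h by (intro finsum_cong') (auto simp: lookup_add smult_l_distr Pi_iff)
  also have "\<dots> = (\<Oplus>m\<in>?Y. Poly_Mapping.lookup p m \<odot> h m) \<oplus> (\<Oplus>m\<in>?Y. Poly_Mapping.lookup q m \<odot> h m)"
    using h by (intro finsum_addf) (auto simp: Pi_iff)
  finally show ?thesis using h by (simp add: lin_ext_superset[of ?Y])
qed

lemma lin_ext_scale:
  assumes "h \<in> Poly_Mapping.keys p \<rightarrow> carrier R"
  shows "lin_ext h (pm_scale c p) = c \<odot> lin_ext h p"
proof -
  have "lin_ext h (pm_scale c p) = (\<Oplus>m\<in>Poly_Mapping.keys p. c \<odot> (Poly_Mapping.lookup p m \<odot> h m))"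
    using assms keys_pm_scale[of c p]
    by (subst lin_ext_superset[of "Poly_Mapping.keys p"]) (auto intro!: finsum_cong' simp: smult_assoc Pi_iff)
  also have "\<dots> = c \<odot> lin_ext h p"
    unfolding lin_ext_def using assms by (intro finsum_smult[symmetric]) (auto simp: Pi_iff)
  finally show ?thesis .
qed

end

text \<open>A basis of \<open>W\<close> is extended to the whole space; its members go to 0 and the
  new basis vectors are fixed. The values of \<open>\<pi>\<close> are representatives modulo
  \<open>W\<close> that depend linearly on the class.\<close>

lemma (in vector_space) projection_along:
  assumes "subspace W"
  obtains \<pi> where "\<And>a b. \<pi> (a + b) = \<pi> a + \<pi> b" "\<And>c a. \<pi> (c *s a) = c *s \<pi> a"
    "\<And>a. a \<in> W \<Longrightarrow> \<pi> a = 0" "\<And>a. a - \<pi> a \<in> W"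
proof -
  interpret P: vector_space_pair scale scale by unfold_locales
  obtain B where B: "B \<subseteq> W" "independent B" "W \<subseteq> span B"
    using maximal_independent_subset by metis
  obtain B' where B': "B \<subseteq> B'" "independent B'" "UNIV \<subseteq> span B'"
    using maximal_independent_subset_extend[of B UNIV] B by auto
  obtain \<pi> where \<pi>: "Vector_Spaces.linear scale scale \<pi>" "\<forall>b\<in>B'. \<pi> b = (if b \<in> B then 0 else b)"
    using P.linear_independent_extend[OF B'(2), of "\<lambda>b. if b \<in> B then 0 else b"] by blast
  have add: "\<pi> (a + b) = \<pi> a + \<pi> b" and sc: "\<pi> (c *s a) = c *s \<pi> a" for a b c
    using \<pi>(1) by (auto simp: Vector_Spaces.linear_iff)
  have z: "\<pi> 0 = 0" using sc[of 0 0] by simp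
  have "\<pi> a = 0" if "a \<in> span B" for a
    using that by (induction rule: span_induct_alt) (use z add sc \<pi>(2) B'(1) in auto)
  moreover have "a - \<pi> a \<in> W" if "a \<in> span B'" for a
    using that
  proof (induction rule: span_induct_alt)
    case base
    then show ?case using z subspace_0[OF assms] by simp
  next
    case (step c b a)
    have "b - \<pi> b \<in> W" using \<pi>(2) step(1) B(1) subspace_0[OF assms] by auto
    then have "c *s (b - \<pi> b) + (a - \<pi> a) \<in> W"
      using step assms by (intro subspace_add subspace_scale)
    then show ?case by (simp add: add sc scale_right_diff_distrib algebra_simps)
  qed
  ultimately show ?thesis using that add sc B(3) B'(3) by blast
qed

text \<open>Linear algebra needs a type, whereas \<open>R\<close> lives on a carrier set.
  \<open>\<sigma>\<close> evaluates formal combinations of elements of \<open>R\<close>;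
  \<open>\<tau>\<close> selects a formal combination with a given value, and does so linearly thanks
  to a projection along the kernel of \<open>\<sigma>\<close>.\<close>

lemma (in k_algebra) linear_section:
  obtains \<sigma> :: "('a \<Rightarrow>\<^sub>0 'k) \<Rightarrow> 'a" and \<tau> :: "'a \<Rightarrow> ('a \<Rightarrow>\<^sub>0 'k)"
  where "\<And>p. \<sigma> p \<in> carrier R" "\<And>p q. \<sigma> (p + q) = \<sigma> p \<oplus> \<sigma> q" "\<And>c p. \<sigma> (pm_scale c p) = c \<odot> \<sigma> p"
    "\<And>a. a \<in> carrier R \<Longrightarrow> \<sigma> (\<tau> a) = a"
    "\<And>a b. a \<in> carrier R \<Longrightarrow> b \<in> carrier R \<Longrightarrow>
        \<tau> (a \<oplus> b) = \<tau> a + \<tau> b"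
    "\<And>c a. a \<in> carrier R \<Longrightarrow> \<tau> (c \<odot> a) = pm_scale c (\<tau> a)"
proof -
  \<comment> \<open>The value zero outside the carrier makes \<open>\<sigma>\<close> total with
    values in the carrier.\<close>
  define h where "h a = (if a \<in> carrier R then a else \<zero>)" for a
  have h: "h a \<in> carrier R" for a by (simp add: h_def)
  define \<sigma> where "\<sigma> = lin_ext h"
  have \<sigma>c: "\<sigma> p \<in> carrier R" and \<sigma>a: "\<sigma> (p + q) = \<sigma> p \<oplus> \<sigma> q" and \<sigma>s: "\<sigma> (pm_scale c p) = c \<odot> \<sigma> p" for p q c
    by (auto simp: \<sigma>_def lin_ext_closed lin_ext_add lin_ext_scale h)
  have \<sigma>1: "\<sigma> (Poly_Mapping.single a 1) = a" if "a \<in> carrier R" for a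
    using that h[of a] by (simp add: \<sigma>_def h_def)
  have "pm.subspace {p. \<sigma> p = \<zero>}"
    by (auto simp: pm.subspace_def \<sigma>a \<sigma>s) (simp add: \<sigma>_def)
  then obtain \<pi> where \<pi>: "\<And>a b. \<pi> (a + b) = \<pi> a + \<pi> b" "\<And>c a. \<pi> (pm_scale c a) = pm_scale c (\<pi> a)"
    "\<And>a. a \<in> {p. \<sigma> p = \<zero>} \<Longrightarrow>
        \<pi> a = 0" "\<And>a. a - \<pi> a \<in> {p. \<sigma> p = \<zero>}"
    by (rule pm.projection_along) blast
  have \<sigma>d: "\<sigma> (p - q) = \<sigma> p \<ominus> \<sigma> q" for p q
  proof -
    have "\<sigma> p = \<sigma> (p - q) \<oplus> \<sigma> q" using \<sigma>a[of "p - q" q] by simp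
    then show ?thesis using \<sigma>c by (simp add: a_minus_def a_assoc r_neg)
  qed
  have \<pi>d: "\<pi> p = \<pi> q" if "\<sigma> p = \<sigma> q" for p q
  proof -
    have "\<pi> (p - q) = 0" using that \<sigma>c by (intro \<pi>(3)) (simp add: \<sigma>d r_neg a_minus_def)
    then show ?thesis using \<pi>(1)[of "p - q" q] by simp
  qed
  \<comment> \<open>\<open>Poly_Mapping.single a 1\<close> is not additive in \<open>a\<close>, but
    the defect lies in the kernel of \<open>\<sigma>\<close>, where \<open>\<pi>\<close>
    vanishes.\<close>
  define \<tau> where "\<tau> a = \<pi> (Poly_Mapping.single a 1)" for a
  show ?thesis
  proof (rule that[of \<sigma> \<tau>])
    show "\<sigma> (\<tau> a) = a" if "a \<in> carrier R" for a
      using \<pi>(4)[of "Poly_Mapping.single a 1"] \<sigma>1[OF that] \<sigma>c that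
      by (simp add: \<tau>_def \<sigma>d)
    show "\<tau> (a \<oplus> b) = \<tau> a + \<tau> b" if "a \<in> carrier R" "b \<in> carrier R" for a b
      unfolding \<tau>_def \<pi>(1)[symmetric] using that by (intro \<pi>d) (simp add: \<sigma>a \<sigma>1)
    show "\<tau> (c \<odot> a) = pm_scale c (\<tau> a)" if "a \<in> carrier R" for a c
      unfolding \<tau>_def \<pi>(2)[symmetric] using that \<sigma>1 \<sigma>s[of c "Poly_Mapping.single a 1"]
      by (intro \<pi>d) (simp add: \<sigma>a)
  qed (use \<sigma>c \<sigma>a \<sigma>s in auto)
qed

text \<open>The convolution product of \<open>monoid_algebra\<close> as a nested linear extension,
  so that bilinearity comes from \<open>pm_ext\<close>.\<close>

definition pm_mult :: "('m \<Rightarrow> 'm \<Rightarrow> 'm) \<Rightarrow> ('m \<Rightarrow>\<^sub>0 'k::field) \<Rightarrow> ('m \<Rightarrow>\<^sub>0 'k) \<Rightarrow> 'm \<Rightarrow>\<^sub>0 'k"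
  where "pm_mult m p q = pm_ext pm_scale (\<lambda>s. pm_ext pm_scale (\<lambda>t. Poly_Mapping.single (m s t) 1) q) p"

lemma monoid_algebra_simps [simp]:
  "carrier (monoid_algebra G) = {p :: 'm \<Rightarrow>\<^sub>0 'k::field. Poly_Mapping.keys p \<subseteq> carrier G}"
  "one (monoid_algebra G :: ('k, 'm \<Rightarrow>\<^sub>0 'k) module) = Poly_Mapping.single (one G) 1"
  "zero (monoid_algebra G :: ('k, 'm \<Rightarrow>\<^sub>0 'k) module) = 0"
  "add (monoid_algebra G :: ('k, 'm \<Rightarrow>\<^sub>0 'k) module) = (+)"
  "module.smult (monoid_algebra G :: ('k, 'm \<Rightarrow>\<^sub>0 'k) module) = pm_scale"
  by (simp_all add: monoid_algebra_def pm_scale_def fun_eq_iff)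

lemma monoid_algebra_mult [simp]:
  "monoid.mult (monoid_algebra G :: ('k::field, 'm \<Rightarrow>\<^sub>0 'k) module) = pm_mult (monoid.mult G)"
  by (auto simp: monoid_algebra_def pm_mult_def pm_ext_def fun_eq_iff pm.scale_sum_right)

lemma pm_mult_single [simp]:
  "pm_mult m (Poly_Mapping.single s a) (Poly_Mapping.single t b) = Poly_Mapping.single (m s t) (a * b)"
  by (simp add: pm_mult_def)

lemma pm_mult_add_left: "pm_mult m (p + p') q = pm_mult m p q + pm_mult m p' q"
  by (simp add: pm_mult_def pm.pm_ext_add)

lemma pm_mult_scale_left: "pm_mult m (pm_scale c p) q = pm_scale c (pm_mult m p q)"
  by (simp add: pm_mult_def pm.pm_ext_scale)

lemma pm_mult_zero_left [simp]: "pm_mult m 0 q = 0"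
  by (simp add: pm_mult_def)

lemma pm_mult_add_right: "pm_mult m p (q + q') = pm_mult m p q + pm_mult m p q'"
  unfolding pm_mult_def
  by (simp add: pm.pm_ext_add pm_ext_def[of pm_scale _ p] pm.scale_right_distrib sum.distrib)

lemma pm_mult_scale_right: "pm_mult m p (pm_scale c q) = pm_scale c (pm_mult m p q)"
  unfolding pm_mult_def
  by (simp add: pm.pm_ext_scale pm_ext_def[of pm_scale _ p] pm.scale_sum_right mult.commute)

lemma pm_mult_zero_right [simp]: "pm_mult m p 0 = 0"
  by (simp add: pm_mult_def pm_ext_def[of pm_scale _ p])

lemma pm_mult_diff_left: "pm_mult m (p - p') q = pm_mult m p q - pm_mult m p' q"
  by (metis pm_mult_add_left add_diff_cancel diff_add_cancel)

lemma pm_mult_diff_right: "pm_mult m p (q - q') = pm_mult m p q - pm_mult m p q'"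
  by (metis pm_mult_add_right add_diff_cancel diff_add_cancel)

lemma pm_mult_closed:
  assumes "Poly_Mapping.keys p \<subseteq> K" "Poly_Mapping.keys q \<subseteq> K" "\<And>s t. s \<in> K \<Longrightarrow>
      t \<in> K \<Longrightarrow> m s t \<in> K"
  shows "Poly_Mapping.keys (pm_mult m p q) \<subseteq> K"
  using assms(1)
proof (induction rule: pm_linear_induct)
  case (single s)
  show ?case using assms(2)
  proof (induction rule: pm_linear_induct)
    case (add p q)
    then show ?case
      unfolding pm_mult_add_right by (intro order_trans[OF keys_add] Un_least)
  next
    case (scale c p)
    then show ?case unfolding pm_mult_scale_right by (intro order_trans[OF keys_pm_scale])
  qed (use single assms in auto)
next
  case (add p q)
  then show ?case unfolding pm_mult_add_left by (intro order_trans[OF keys_add] Un_least)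
next
  case (scale c p)
  then show ?case unfolding pm_mult_scale_left by (intro order_trans[OF keys_pm_scale])
qed simp

lemma pm_mult_assoc:
  assumes "Poly_Mapping.keys p \<subseteq> K" "Poly_Mapping.keys q \<subseteq> K" "Poly_Mapping.keys r \<subseteq> K"
    "\<And>s t u. s \<in> K \<Longrightarrow> t \<in> K \<Longrightarrow> u \<in> K \<Longrightarrow>
        m (m s t) u = m s (m t u)"
  shows "pm_mult m (pm_mult m p q) r = pm_mult m p (pm_mult m q r)"
  using assms(1)
proof (induction rule: pm_linear_induct)
  case (single s)
  show ?case using assms(2)
  proof (induction rule: pm_linear_induct)
    case (single t)
    note st = \<open>s \<in> K\<close> \<open>t \<in> K\<close>
    show ?case using assms(3)
      by (induction rule: pm_linear_induct)
        (simp_all add: st assms(4) pm_mult_add_right pm_mult_scale_right)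
  qed (auto simp: pm_mult_add_left pm_mult_add_right pm_mult_scale_left pm_mult_scale_right)
qed (auto simp: pm_mult_add_left pm_mult_scale_left)

lemma k_algebra_monoid_algebra:
  assumes "monoid G"
  shows "k_algebra (monoid_algebra G :: ('k::field, 'm \<Rightarrow>\<^sub>0 'k) module)"
proof -
  interpret G: monoid G by fact
  let ?R = "monoid_algebra G :: ('k, 'm \<Rightarrow>\<^sub>0 'k) module"
  have one_l: "pm_mult (monoid.mult G) (Poly_Mapping.single (one G) 1) p = p"
    and one_r: "pm_mult (monoid.mult G) p (Poly_Mapping.single (one G) 1) = p"
    if "Poly_Mapping.keys p \<subseteq> carrier G" for p :: "'m \<Rightarrow>\<^sub>0 'k"
    using that
    by (induction rule: pm_linear_induct;
        simp add: pm_mult_add_left pm_mult_add_right pm_mult_scale_left pm_mult_scale_right)+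
  have "ring ?R"
  proof (rule ringI)
    show "abelian_group ?R"
    proof (rule abelian_groupI)
      fix p assume "p \<in> carrier ?R"
      then show "\<exists>q\<in>carrier ?R. q \<oplus>\<^bsub>?R\<^esub> p = \<zero>\<^bsub>?R\<^esub>"
        using keys_pm_scale[of "-1" p]
        by (intro bexI[of _ "pm_scale (-1) p"]) (auto intro!: poly_mapping_eqI simp: lookup_add)
    next
      fix p q assume "p \<in> carrier ?R" "q \<in> carrier ?R"
      then show "p \<oplus>\<^bsub>?R\<^esub> q \<in> carrier ?R"
        using order_trans[OF keys_add, of p q "carrier G"] by simp
    qed (simp_all add: add_ac)
    show "monoid ?R"
    proof (rule monoidI)
      fix p q r assume "p \<in> carrier ?R" "q \<in> carrier ?R" "r \<in> carrier ?R"
      then show "p \<otimes>\<^bsub>?R\<^esub> q \<otimes>\<^bsub>?R\<^esub> r = p \<otimes>\<^bsub>?R\<^esub> (q \<otimes>\<^bsub>?R\<^esub> r)"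
        using pm_mult_assoc[of p "carrier G" q r "monoid.mult G"] G.m_assoc by simp
    next
      fix p q assume "p \<in> carrier ?R" "q \<in> carrier ?R"
      then show "p \<otimes>\<^bsub>?R\<^esub> q \<in> carrier ?R"
        using pm_mult_closed[of p "carrier G" q "monoid.mult G"] by simp
    qed (simp_all add: one_l one_r)
  qed (auto simp: pm_mult_add_left pm_mult_add_right)
  then show ?thesis
    unfolding k_algebra_def k_algebra_axioms_def
    by (simp add: pm.scale_left_distrib pm.scale_right_distrib pm_mult_scale_left
        pm_mult_scale_right order_trans[OF keys_pm_scale])
qed

text \<open>For \<open>R Quot I\<close> and \<open>quot_algebra R I\<close>, which are records of
  different types with the same ring operations.\<close>

lemma ring_cong_fields:
  assumes "ring R" "carrier S = carrier R" "monoid.mult S = monoid.mult R" "one S = one R"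
    "zero S = zero R" "add S = add R"
  shows "ring S"
proof -
  interpret ring R by fact
  show ?thesis
  proof (rule ringI)
    show "abelian_group S"
      by (rule abelian_groupI) (auto simp: assms(2-) a_ac intro: add.l_inv_ex)
    show "monoid S"
      by (rule monoidI) (auto simp: assms(2-) m_assoc)
  qed (auto simp: assms(2-) l_distr r_distr)
qed

section \<open>Quotient algebras\<close>

locale k_algebra_ideal = k_algebra R + ideal I R for I :: "'a set" and R :: "('k::field, 'a, 'e) module_scheme" (structure)
begin

abbreviation "Q \<equiv> quot_algebra R I"

lemma quot_carrier: "carrier Q = (\<lambda>a. I +> a) ` carrier R"
  by (auto simp: quot_algebra_def FactRing_def A_RCOSETS_def')

lemma coset_closed [simp, intro]: "a \<in> carrier R \<Longrightarrow> I +> a \<in> carrier Q"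
  by (auto simp: quot_carrier)

lemma coset_cases:
  assumes "C \<in> carrier Q"
  obtains a where "a \<in> carrier R" "C = I +> a"
  using assms by (auto simp: quot_carrier)

lemma coset_mult: "a \<in> carrier R \<Longrightarrow> b \<in> carrier R \<Longrightarrow>
    (I +> a) \<otimes>\<^bsub>Q\<^esub> (I +> b) = I +> (a \<otimes> b)"
  using ring_hom_mult[OF rcos_ring_hom] by (simp add: quot_algebra_def)

lemma coset_add: "a \<in> carrier R \<Longrightarrow> b \<in> carrier R \<Longrightarrow>
    (I +> a) \<oplus>\<^bsub>Q\<^esub> (I +> b) = I +> (a \<oplus> b)"
  using ring_hom_add[OF rcos_ring_hom] by (simp add: quot_algebra_def)

lemma coset_one: "one Q = I +> \<one>"
  using ring_hom_one[OF rcos_ring_hom] by (simp add: quot_algebra_def)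

lemma coset_eq_iff: "a \<in> carrier R \<Longrightarrow> b \<in> carrier R \<Longrightarrow>
    I +> a = I +> b \<longleftrightarrow> a \<ominus> b \<in> I"
  using quotient_eq_iff_same_a_r_cos[OF is_ideal] by blast

text \<open>A ring ideal is a subspace, since
  \<open>c \<odot> a = (c \<odot> \<one>) \<otimes> a\<close>.\<close>

lemma smult_in_I: "a \<in> I \<Longrightarrow> c \<odot> a \<in> I"
  using I_l_closed[of a "c \<odot> \<one>"] Icarr[of a] by (simp add: smult_mult_left)

text \<open>The union in \<open>quot_algebra\<close> runs over all representatives of the coset;
  they differ by elements of the ideal, which scalars preserve, so all of them give the same
  coset.\<close>

lemma coset_smult:
  assumes "a \<in> carrier R"
  shows "c \<odot>\<^bsub>Q\<^esub> (I +> a) = I +> (c \<odot> a)"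
proof -
  have "I +> (c \<odot> b) = I +> (c \<odot> a)" if b: "b \<in> I +> a" for b
  proof -
    obtain i where i: "i \<in> I" "b = i \<oplus> a" using b by (auto simp: a_r_coset_def')
    have ic: "i \<in> carrier R" using i Icarr by blast
    have "c \<odot> b \<ominus> c \<odot> a = c \<odot> i"
      using i(2) ic assms by (simp add: smult_r_distr a_minus_def a_assoc r_neg)
    then show ?thesis using assms i ic smult_in_I by (simp add: coset_eq_iff)
  qed
  moreover have "a \<in> I +> a" using assms a_rcos_self by blast
  ultimately have "(\<Union>b\<in>I +> a. I +> (c \<odot> b)) = I +> (c \<odot> a)" by blast
  then show ?thesis by (simp add: quot_algebra_def)
qed

lemma k_algebra_quot: "k_algebra Q"
proof -
  have "ring Q"
    by (rule ring_cong_fields[OF quotient_is_ring]) (simp_all add: quot_algebra_def)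
  then show ?thesis
    unfolding k_algebra_def k_algebra_axioms_def
    by (auto elim!: coset_cases simp: coset_smult coset_add coset_mult smult_l_distr smult_r_distr
        smult_assoc smult_mult_left smult_mult_right)
qed

lemma coset_zero_iff: "a \<in> carrier R \<Longrightarrow> I +> a = zero Q \<longleftrightarrow> a \<in> I"
proof -
  assume a: "a \<in> carrier R"
  have "zero Q = I" by (simp add: quot_algebra_def FactRing_def)
  also have "I = I +> \<zero>" using a_rcos_zero[OF is_ideal] by (simp add: a_coset_join2 is_additive_subgroup)
  finally show ?thesis using a by (simp add: coset_eq_iff a_minus_def)
qed

end

section \<open>Tensor products\<close>

locale tensor = M: k_algebra M + N: k_algebra N
  for M :: "('k::field, 'a, 'e) module_scheme" and N :: "('k, 'b, 'f) module_scheme"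
begin

abbreviation "pre \<equiv> pre_tensor M N"
abbreviation "T \<equiv> tensor_algebra M N"
abbreviation "pt \<equiv> pure_tensor M N"
abbreviation sg :: "'a \<Rightarrow> 'b \<Rightarrow> ('a \<times> 'b \<Rightarrow>\<^sub>0 'k)" where "sg a b \<equiv> Poly_Mapping.single (a, b) 1"

lemma k_algebra_pre: "k_algebra pre"
  unfolding pre_tensor_def
  by (intro k_algebra_monoid_algebra DirProd_monoid M.monoid_axioms N.monoid_axioms)

lemma pre_simps [simp]:
  "carrier pre = {p. Poly_Mapping.keys p \<subseteq> carrier M \<times> carrier N}"
  "one pre = sg \<one>\<^bsub>M\<^esub> \<one>\<^bsub>N\<^esub>" "zero pre = 0" "add pre = (+)" "module.smult pre = pm_scale"
  by (simp_all add: pre_tensor_def)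

lemma pre_mult: "monoid.mult pre (Poly_Mapping.single (a, b) r) (Poly_Mapping.single (c, d) s) =
    Poly_Mapping.single (a \<otimes>\<^bsub>M\<^esub> c, b \<otimes>\<^bsub>N\<^esub> d) (r * s)"
  by (simp add: pre_tensor_def DirProd_def)

lemma pre_mult_left:
  "monoid.mult pre (p + q) r = monoid.mult pre p r + monoid.mult pre q r"
  "monoid.mult pre (p - q) r = monoid.mult pre p r - monoid.mult pre q r"
  "monoid.mult pre (pm_scale c p) r = pm_scale c (monoid.mult pre p r)"
  "monoid.mult pre 0 r = 0"
  by (simp_all add: pre_tensor_def pm_mult_add_left pm_mult_diff_left pm_mult_scale_left)

lemma pre_mult_right:
  "monoid.mult pre r (p + q) = monoid.mult pre r p + monoid.mult pre r q"
  "monoid.mult pre r (p - q) = monoid.mult pre r p - monoid.mult pre r q"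
  "monoid.mult pre r (pm_scale c p) = pm_scale c (monoid.mult pre r p)"
  "monoid.mult pre r 0 = 0"
  by (simp_all add: pre_tensor_def pm_mult_add_right pm_mult_diff_right pm_mult_scale_right)

lemma bilin_rels_cases:
  assumes "r \<in> bilin_rels M N"
  obtains (add_left) a a' b where "r = sg (a \<oplus>\<^bsub>M\<^esub> a') b - sg a b - sg a' b"
      "a \<in> carrier M" "a' \<in> carrier M" "b \<in> carrier N"
    | (add_right) a b b' where "r = sg a (b \<oplus>\<^bsub>N\<^esub> b') - sg a b - sg a b'"
      "a \<in> carrier M" "b \<in> carrier N" "b' \<in> carrier N"
    | (smult_left) c a b where "r = sg (c \<odot>\<^bsub>M\<^esub> a) b - Poly_Mapping.single (a, b) c"
      "a \<in> carrier M" "b \<in> carrier N"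
    | (smult_right) c a b where "r = sg a (c \<odot>\<^bsub>N\<^esub> b) - Poly_Mapping.single (a, b) c"
      "a \<in> carrier M" "b \<in> carrier N"
  using assms unfolding bilin_rels_def Let_def by blast

lemma bilin_rels_intros:
  "a \<in> carrier M \<Longrightarrow> a' \<in> carrier M \<Longrightarrow> b \<in> carrier N \<Longrightarrow>
    sg (a \<oplus>\<^bsub>M\<^esub> a') b - sg a b - sg a' b \<in> bilin_rels M N"
  "a \<in> carrier M \<Longrightarrow> b \<in> carrier N \<Longrightarrow> b' \<in> carrier N \<Longrightarrow>
    sg a (b \<oplus>\<^bsub>N\<^esub> b') - sg a b - sg a b' \<in> bilin_rels M N"
  "a \<in> carrier M \<Longrightarrow> b \<in> carrier N \<Longrightarrow>
      sg (c \<odot>\<^bsub>M\<^esub> a) b - Poly_Mapping.single (a, b) c \<in> bilin_rels M N"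
  "a \<in> carrier M \<Longrightarrow> b \<in> carrier N \<Longrightarrow>
      sg a (c \<odot>\<^bsub>N\<^esub> b) - Poly_Mapping.single (a, b) c \<in> bilin_rels M N"
  unfolding bilin_rels_def Let_def by blast+

lemma pre_diff_closed: "p \<in> carrier pre \<Longrightarrow> q \<in> carrier pre \<Longrightarrow> p - q \<in> carrier pre"
proof -
  assume pq: "p \<in> carrier pre" "q \<in> carrier pre"
  have "Poly_Mapping.keys (p - q) \<subseteq> Poly_Mapping.keys p \<union> Poly_Mapping.keys q"
    by (auto simp: in_keys_iff lookup_minus)
  then show ?thesis using pq by auto
qed

lemma pre_add_closed: "p \<in> carrier pre \<Longrightarrow> q \<in> carrier pre \<Longrightarrow> p + q \<in> carrier pre"
  using order_trans[OF keys_add, of p q "carrier M \<times> carrier N"] by simp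

lemma bilin_rels_subset: "bilin_rels M N \<subseteq> carrier pre"
proof
  fix r assume "r \<in> bilin_rels M N"
  then show "r \<in> carrier pre"
    by (cases rule: bilin_rels_cases) (auto simp del: pre_simps intro!: pre_diff_closed, auto)
qed

lemma bilin_ideal_sub: "submodule (bilin_ideal M N) (KK :: 'k ring) pre"
  unfolding bilin_ideal_def by (rule k_algebra.submodule_lin_span[OF k_algebra_pre bilin_rels_subset])

lemma bilin_ideal_closed:
  "bilin_ideal M N \<subseteq> carrier pre" "0 \<in> bilin_ideal M N"
  "a \<in> bilin_ideal M N \<Longrightarrow> b \<in> bilin_ideal M N \<Longrightarrow> a + b \<in> bilin_ideal M N"
  "a \<in> bilin_ideal M N \<Longrightarrow> pm_scale c a \<in> bilin_ideal M N"
  using bilin_ideal_sub unfolding k_algebra.submodule_iff[OF k_algebra_pre] by auto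

lemma bilin_ideal_base: "r \<in> bilin_rels M N \<Longrightarrow> r \<in> bilin_ideal M N"
  unfolding bilin_ideal_def by (rule k_algebra.lin_span_base[OF k_algebra_pre])

lemma bilin_ideal_minimal:
  assumes "\<And>r. r \<in> bilin_rels M N \<Longrightarrow> P r" "P 0"
    "\<And>a b. a \<in> carrier pre \<Longrightarrow> b \<in> carrier pre \<Longrightarrow> P a \<Longrightarrow> P b \<Longrightarrow>
        P (a + b)"
    "\<And>c a. a \<in> carrier pre \<Longrightarrow> P a \<Longrightarrow> P (pm_scale c a)" "p \<in> bilin_ideal M N"
  shows "P p"
proof -
  interpret P: k_algebra pre by (rule k_algebra_pre)
  have "submodule {p \<in> carrier pre. P p} (KK :: 'k ring) pre"
    unfolding P.submodule_iff using assms(2-4) P.a_closed P.smult_closed P.zero_closed by auto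
  then have "bilin_ideal M N \<subseteq> {p \<in> carrier pre. P p}"
    unfolding bilin_ideal_def using assms(1) bilin_rels_subset by (intro P.lin_span_minimal) auto
  then show ?thesis using assms(5) by auto
qed

text \<open>A bilinearity relation multiplied by a single basis element, on either side, is again a
  relation. By linearity the span of the relations, which is all that \<open>bilin_ideal\<close> is
  by definition, absorbs products.\<close>

lemma bilin_ideal_mult:
  assumes t: "t \<in> carrier pre" and p: "p \<in> bilin_ideal M N"
  shows "monoid.mult pre t p \<in> bilin_ideal M N \<and> monoid.mult pre p t \<in> bilin_ideal M N"
proof -
  have "Poly_Mapping.keys t \<subseteq> carrier M \<times> carrier N" using t by simp
  then show ?thesis
  proof (induction rule: pm_linear_induct)
    case (single m)
    obtain a b where m: "m = (a, b)" "a \<in> carrier M" "b \<in> carrier N" using single by auto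
    show ?case
    proof (rule bilin_ideal_minimal[OF _ _ _ _ p])
      fix r assume "r \<in> bilin_rels M N"
      then have "monoid.mult pre (sg a b) r \<in> bilin_rels M N \<and> monoid.mult pre r (sg a b) \<in> bilin_rels M N"
        by (cases rule: bilin_rels_cases)
          (simp_all add: pre_mult_left pre_mult_right pre_mult M.r_distr M.l_distr N.r_distr N.l_distr
            M.smult_mult_left M.smult_mult_right N.smult_mult_left N.smult_mult_right
            bilin_rels_intros m)
      then show "monoid.mult pre (Poly_Mapping.single m 1) r \<in> bilin_ideal M N \<and>
          monoid.mult pre r (Poly_Mapping.single m 1) \<in> bilin_ideal M N"
        using m bilin_ideal_base by simp
    qed (simp_all add: pre_mult_left pre_mult_right bilin_ideal_closed)
  qed (simp_all add: pre_mult_left pre_mult_right bilin_ideal_closed)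
qed

sublocale B: k_algebra_ideal "bilin_ideal M N" pre
proof -
  interpret P: k_algebra pre by (rule k_algebra_pre)
  have "subgroup (bilin_ideal M N) (add_monoid pre)"
    using bilin_ideal_sub by (simp add: submodule_def)
  then have "ideal (bilin_ideal M N) pre"
    using bilin_ideal_mult by (intro idealI P.ring_axioms) auto
  then show "k_algebra_ideal (bilin_ideal M N) pre"
    by (simp add: k_algebra_ideal_def k_algebra_pre)
qed

lemma T_eq: "T = quot_algebra pre (bilin_ideal M N)"
  by (simp add: tensor_algebra_def)

lemma k_algebra_T: "k_algebra T"
  unfolding T_eq by (rule B.k_algebra_quot)

lemma pt_eq: "pt a b = bilin_ideal M N +>\<^bsub>pre\<^esub> sg a b"
  by (simp add: pure_tensor_def)

lemma sg_closed: "a \<in> carrier M \<Longrightarrow> b \<in> carrier N \<Longrightarrow>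
    Poly_Mapping.single (a, b) c \<in> carrier pre"
  by simp

lemma pt_closed [simp, intro]: "a \<in> carrier M \<Longrightarrow> b \<in> carrier N \<Longrightarrow>
    pt a b \<in> carrier T"
  unfolding pt_eq T_eq by (intro B.coset_closed sg_closed)

lemma pt_mult:
  "a \<in> carrier M \<Longrightarrow> b \<in> carrier N \<Longrightarrow> c \<in> carrier M \<Longrightarrow>
      d \<in> carrier N \<Longrightarrow>
    pt a b \<otimes>\<^bsub>T\<^esub> pt c d = pt (a \<otimes>\<^bsub>M\<^esub> c) (b \<otimes>\<^bsub>N\<^esub> d)"
  unfolding pt_eq T_eq by (simp add: B.coset_mult pre_mult)

lemma T_one: "one T = pt \<one>\<^bsub>M\<^esub> \<one>\<^bsub>N\<^esub>"
  unfolding pt_eq T_eq by (simp add: B.coset_one)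

lemma pre_minus: "a \<in> carrier pre \<Longrightarrow> b \<in> carrier pre \<Longrightarrow>
    a \<ominus>\<^bsub>pre\<^esub> b = a - b"
proof -
  assume ab: "a \<in> carrier pre" "b \<in> carrier pre"
  have "\<ominus>\<^bsub>pre\<^esub> b = pm_scale (-1) b" using B.smult_minus_one[OF ab(2)] by simp
  also have "\<dots> = - b" by (rule poly_mapping_eqI) simp
  finally show ?thesis by (simp add: a_minus_def)
qed

lemma coset_eqI:
  "p \<in> carrier pre \<Longrightarrow> q \<in> carrier pre \<Longrightarrow> p - q \<in> bilin_ideal M N \<Longrightarrow>
    bilin_ideal M N +>\<^bsub>pre\<^esub> p = bilin_ideal M N +>\<^bsub>pre\<^esub> q"
  by (subst B.coset_eq_iff) (simp_all only: pre_minus)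

lemma pt_add_left:
  assumes "a \<in> carrier M" "a' \<in> carrier M" "b \<in> carrier N"
  shows "pt (a \<oplus>\<^bsub>M\<^esub> a') b = pt a b \<oplus>\<^bsub>T\<^esub> pt a' b"
proof -
  have "pt a b \<oplus>\<^bsub>T\<^esub> pt a' b = bilin_ideal M N +>\<^bsub>pre\<^esub> (sg a b + sg a' b)"
    unfolding pt_eq T_eq using assms by (simp add: B.coset_add)
  moreover have "sg (a \<oplus>\<^bsub>M\<^esub> a') b - (sg a b + sg a' b) \<in> bilin_ideal M N"
    using bilin_ideal_base[OF bilin_rels_intros(1)[OF assms]] by (simp add: algebra_simps)
  moreover have "sg a b + sg a' b \<in> carrier pre"
    using assms by (intro pre_add_closed sg_closed)
  ultimately show ?thesis
    unfolding pt_eq using assms by (simp only: coset_eqI sg_closed M.a_closed)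
qed

lemma pt_add_right:
  assumes "a \<in> carrier M" "b \<in> carrier N" "b' \<in> carrier N"
  shows "pt a (b \<oplus>\<^bsub>N\<^esub> b') = pt a b \<oplus>\<^bsub>T\<^esub> pt a b'"
proof -
  have "pt a b \<oplus>\<^bsub>T\<^esub> pt a b' = bilin_ideal M N +>\<^bsub>pre\<^esub> (sg a b + sg a b')"
    unfolding pt_eq T_eq using assms by (simp add: B.coset_add)
  moreover have "sg a (b \<oplus>\<^bsub>N\<^esub> b') - (sg a b + sg a b') \<in> bilin_ideal M N"
    using bilin_ideal_base[OF bilin_rels_intros(2)[OF assms]] by (simp add: algebra_simps)
  moreover have "sg a b + sg a b' \<in> carrier pre"
    using assms by (intro pre_add_closed sg_closed)
  ultimately show ?thesis
    unfolding pt_eq using assms by (simp only: coset_eqI sg_closed N.a_closed)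
qed

lemma pt_smult_left:
  assumes "a \<in> carrier M" "b \<in> carrier N"
  shows "pt (c \<odot>\<^bsub>M\<^esub> a) b = c \<odot>\<^bsub>T\<^esub> pt a b"
proof -
  have "c \<odot>\<^bsub>T\<^esub> pt a b = bilin_ideal M N +>\<^bsub>pre\<^esub> Poly_Mapping.single (a, b) c"
    unfolding pt_eq T_eq using assms by (simp add: B.coset_smult)
  then show ?thesis
    unfolding pt_eq using assms bilin_ideal_base[OF bilin_rels_intros(3)[OF assms, of c]]
    by (simp only: coset_eqI sg_closed M.smult_closed)
qed

lemma pt_smult_right:
  assumes "a \<in> carrier M" "b \<in> carrier N"
  shows "pt a (c \<odot>\<^bsub>N\<^esub> b) = c \<odot>\<^bsub>T\<^esub> pt a b"
proof -
  have "c \<odot>\<^bsub>T\<^esub> pt a b = bilin_ideal M N +>\<^bsub>pre\<^esub> Poly_Mapping.single (a, b) c"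
    unfolding pt_eq T_eq using assms by (simp add: B.coset_smult)
  then show ?thesis
    unfolding pt_eq using assms bilin_ideal_base[OF bilin_rels_intros(4)[OF assms, of c]]
    by (simp only: coset_eqI sg_closed N.smult_closed)
qed

text \<open>The linear map on the tensor product induced by \<open>\<beta>\<close>, computed on a
  chosen representative. For bilinear \<open>\<beta>\<close> the choice is immaterial by
  \<open>tensor_lift_coset\<close>.\<close>

definition tensor_lift :: "('k \<Rightarrow> 'v::ab_group_add \<Rightarrow> 'v) \<Rightarrow> ('a \<Rightarrow> 'b \<Rightarrow> 'v) \<Rightarrow> ('a \<times> 'b \<Rightarrow>\<^sub>0 'k) set \<Rightarrow> 'v"
  where "tensor_lift s \<beta> t = pm_ext s (\<lambda>(a, b). \<beta> a b) (SOME p. p \<in> carrier pre \<and>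
      t = bilin_ideal M N +>\<^bsub>pre\<^esub> p)"

definition bilinear_on :: "('k \<Rightarrow> 'v::ab_group_add \<Rightarrow> 'v) \<Rightarrow> ('a \<Rightarrow> 'b \<Rightarrow> 'v) \<Rightarrow> bool"
  where "bilinear_on s \<beta> \<longleftrightarrow>
    (\<forall>a\<in>carrier M. \<forall>a'\<in>carrier M. \<forall>b\<in>carrier N. \<beta> (a \<oplus>\<^bsub>M\<^esub> a') b = \<beta> a b + \<beta> a' b) \<and>
    (\<forall>a\<in>carrier M. \<forall>b\<in>carrier N. \<forall>b'\<in>carrier N. \<beta> a (b \<oplus>\<^bsub>N\<^esub> b') = \<beta> a b + \<beta> a b') \<and>
    (\<forall>c. \<forall>a\<in>carrier M. \<forall>b\<in>carrier N. \<beta> (c \<odot>\<^bsub>M\<^esub> a) b = s c (\<beta> a b)) \<and>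
    (\<forall>c. \<forall>a\<in>carrier M. \<forall>b\<in>carrier N. \<beta> a (c \<odot>\<^bsub>N\<^esub> b) = s c (\<beta> a b))"

context
  fixes s :: "'k \<Rightarrow> 'v::ab_group_add \<Rightarrow> 'v"
  assumes vs: "vector_space s"
begin

interpretation vector_space s by (rule vs)

text \<open>The linear extension of a bilinear \<open>\<beta>\<close> kills the relations and hence
  their span, on which two representatives differ.\<close>

lemma tensor_lift_coset:
  assumes \<beta>: "bilinear_on s \<beta>" and p: "p \<in> carrier pre"
  shows "tensor_lift s \<beta> (bilin_ideal M N +>\<^bsub>pre\<^esub> p) = pm_ext s (\<lambda>(a, b). \<beta> a b) p"
proof -
  let ?e = "pm_ext s (\<lambda>(a, b). \<beta> a b)"
  define q where "q = (SOME q. q \<in> carrier pre \<and>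
      bilin_ideal M N +>\<^bsub>pre\<^esub> p = bilin_ideal M N +>\<^bsub>pre\<^esub> q)"
  have q: "q \<in> carrier pre \<and> bilin_ideal M N +>\<^bsub>pre\<^esub> p = bilin_ideal M N +>\<^bsub>pre\<^esub> q"
    unfolding q_def by (rule someI[of _ p]) (use p in blast)
  have "?e r = 0" if "r \<in> bilin_ideal M N" for r
  proof (rule bilin_ideal_minimal[OF _ _ _ _ that])
    fix r assume "r \<in> bilin_rels M N"
    then show "?e r = 0"
      using \<beta> by (cases rule: bilin_rels_cases) (simp_all add: pm_ext_diff bilinear_on_def)
  qed (simp_all add: pm_ext_add pm_ext_scale)
  moreover have "p - q \<in> bilin_ideal M N"
    using q p by (metis B.coset_eq_iff pre_minus)
  ultimately have "?e (p - q) = 0" by blast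
  then have "?e q = ?e p" by (simp add: pm_ext_diff)
  then show ?thesis unfolding tensor_lift_def q_def .
qed

lemma tensor_lift_pt:
  assumes "bilinear_on s \<beta>" "a \<in> carrier M" "b \<in> carrier N"
  shows "tensor_lift s \<beta> (pt a b) = \<beta> a b"
  unfolding pt_eq using assms by (subst tensor_lift_coset) simp_all

lemma T_cases:
  assumes "t \<in> carrier T"
  obtains p where "p \<in> carrier pre" "t = bilin_ideal M N +>\<^bsub>pre\<^esub> p"
  using assms unfolding T_eq by (rule B.coset_cases)

lemma tensor_lift_add:
  assumes "bilinear_on s \<beta>" "t \<in> carrier T" "u \<in> carrier T"
  shows "tensor_lift s \<beta> (t \<oplus>\<^bsub>T\<^esub> u) = tensor_lift s \<beta> t + tensor_lift s \<beta> u"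
proof -
  obtain p q where pq: "p \<in> carrier pre" "t = bilin_ideal M N +>\<^bsub>pre\<^esub> p"
    "q \<in> carrier pre" "u = bilin_ideal M N +>\<^bsub>pre\<^esub> q"
    using assms T_cases by metis
  have "t \<oplus>\<^bsub>T\<^esub> u = bilin_ideal M N +>\<^bsub>pre\<^esub> (p + q)"
    using pq unfolding T_eq by (simp add: B.coset_add)
  moreover have "p + q \<in> carrier pre" using pq(1,3) by (rule pre_add_closed)
  ultimately show ?thesis using pq assms by (simp only: tensor_lift_coset pm_ext_add)
qed

lemma tensor_lift_smult:
  assumes "bilinear_on s \<beta>" "t \<in> carrier T"
  shows "tensor_lift s \<beta> (c \<odot>\<^bsub>T\<^esub> t) = s c (tensor_lift s \<beta> t)"
proof -
  obtain p where p: "p \<in> carrier pre" "t = bilin_ideal M N +>\<^bsub>pre\<^esub> p"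
    using assms T_cases by metis
  have "c \<odot>\<^bsub>T\<^esub> t = bilin_ideal M N +>\<^bsub>pre\<^esub> pm_scale c p"
    using p unfolding T_eq by (simp add: B.coset_smult)
  moreover have "pm_scale c p \<in> carrier pre" using B.smult_closed[OF p(1), of c] by simp
  ultimately show ?thesis using p assms by (simp only: tensor_lift_coset pm_ext_scale)
qed

lemma T_linear_induct:
  assumes "t \<in> carrier T"
    and "P \<zero>\<^bsub>T\<^esub>" "\<And>a b. a \<in> carrier M \<Longrightarrow> b \<in> carrier N \<Longrightarrow>
        P (pt a b)"
    and "\<And>t u. t \<in> carrier T \<Longrightarrow> u \<in> carrier T \<Longrightarrow> P t \<Longrightarrow> P u \<Longrightarrow>
        P (t \<oplus>\<^bsub>T\<^esub> u)"
    and "\<And>c t. t \<in> carrier T \<Longrightarrow> P t \<Longrightarrow> P (c \<odot>\<^bsub>T\<^esub> t)"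
  shows "P t"
proof -
  let ?c = "\<lambda>p. bilin_ideal M N +>\<^bsub>pre\<^esub> p"
  obtain p where p: "p \<in> carrier pre" "t = ?c p"
    using assms T_cases by metis
  have "Poly_Mapping.keys p \<subseteq> carrier M \<times> carrier N" using p by simp
  then have "P (?c p)"
  proof (induction rule: pm_linear_induct)
    case zero
    have "?c 0 = \<zero>\<^bsub>T\<^esub>" unfolding T_eq by (subst B.coset_zero_iff) (auto simp: bilin_ideal_closed)
    then show ?case using assms(2) by simp
  next
    case (single m)
    then show ?case using assms(3) by (cases m) (auto simp: pt_eq)
  next
    case (add p q)
    have "?c (p + q) = ?c p \<oplus>\<^bsub>T\<^esub> ?c q" using add unfolding T_eq by (simp add: B.coset_add)
    then show ?case using add assms(4) by (simp add: T_eq B.coset_closed)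
  next
    case (scale c p)
    have "?c (pm_scale c p) = c \<odot>\<^bsub>T\<^esub> ?c p" using scale unfolding T_eq by (simp add: B.coset_smult)
    then show ?case using scale assms(5) by (simp add: T_eq B.coset_closed)
  qed
  then show ?thesis using p by simp
qed

lemma tensor_lift_zero: "bilinear_on s \<beta> \<Longrightarrow> tensor_lift s \<beta> \<zero>\<^bsub>T\<^esub> = 0"
proof -
  interpret T: k_algebra T by (rule k_algebra_T)
  assume "bilinear_on s \<beta>"
  then show ?thesis using tensor_lift_smult[of \<beta> "\<zero>\<^bsub>T\<^esub>" 0] by simp
qed

lemma bilinear_on_mult:
  assumes "bilinear_on s \<beta>" "a \<in> carrier M" "b \<in> carrier N"
  shows "bilinear_on s (\<lambda>c d. \<beta> (a \<otimes>\<^bsub>M\<^esub> c) (b \<otimes>\<^bsub>N\<^esub> d))"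
  using assms unfolding bilinear_on_def
  by (simp add: M.r_distr N.r_distr M.smult_mult_right N.smult_mult_right)

lemma tensor_lift_pt_mult:
  assumes \<beta>: "bilinear_on s \<beta>" and ab: "a \<in> carrier M" "b \<in> carrier N" and t: "t \<in> carrier T"
  shows "tensor_lift s \<beta> (pt a b \<otimes>\<^bsub>T\<^esub> t) = tensor_lift s (\<lambda>c d. \<beta> (a \<otimes>\<^bsub>M\<^esub> c) (b \<otimes>\<^bsub>N\<^esub> d)) t"
proof -
  interpret T: k_algebra T by (rule k_algebra_T)
  note [simp] = bilinear_on_mult[OF \<beta> ab] \<beta> ab pt_closed[OF ab]
  show ?thesis
    using t
    by (rule T_linear_induct)
      (simp_all add: tensor_lift_zero pt_mult tensor_lift_pt T.r_distr tensor_lift_add T.smult_mult_right tensor_lift_smult)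
qed

lemma tensor_lift_linear:
  assumes \<beta>: "bilinear_on s \<beta>" and t: "t \<in> carrier T"
    and L: "\<And>u v. L (u + v) = L u + L v" "\<And>c v. L (s c v) = s c (L v)"
  shows "tensor_lift s (\<lambda>a b. L (\<beta> a b)) t = L (tensor_lift s \<beta> t)"
proof -
  have L0: "L 0 = 0" using L(2)[of 0 0] by simp
  have \<beta>': "bilinear_on s (\<lambda>a b. L (\<beta> a b))" using \<beta> L by (simp add: bilinear_on_def)
  show ?thesis
    using t by (rule T_linear_induct) (simp_all add: \<beta> \<beta>' tensor_lift_zero L0 tensor_lift_pt tensor_lift_add tensor_lift_smult L)
qed

end

end

section \<open>The q-binomial theorem\<close>

text \<open>Gaussian binomials by Pascal's rule. A quotient of q-factorials would divide by zero at
  a root of unity, the case needed here.\<close>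

fun qbinom :: "'k::field \<Rightarrow> nat \<Rightarrow> nat \<Rightarrow> 'k"
  where "qbinom q n 0 = 1"
  | "qbinom q 0 (Suc k) = 0"
  | "qbinom q (Suc n) (Suc k) = qbinom q n k + q ^ Suc k * qbinom q n (Suc k)"

definition qint :: "'k::field \<Rightarrow> nat \<Rightarrow> 'k"
  where "qint q n = (\<Sum>a<n. q ^ a)"

lemma qint_Suc: "qint q (Suc n) = 1 + q * qint q n"
  unfolding qint_def by (subst sum.lessThan_Suc_shift) (simp add: sum_distrib_left)

text \<open>The absorption identity replaces the quotient formula and does not divide. When
  \<open>qint q (Suc n)\<close> is 0, it forces the inner coefficients to vanish.\<close>

lemma qbinom_absorb: "qint q (Suc k) * qbinom q (Suc n) (Suc k) = qint q (Suc n) * qbinom q n k"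
proof (induction n arbitrary: k)
  case 0
  show ?case by (cases k) (simp_all add: qint_def)
next
  case (Suc n)
  show ?case
  proof (cases k)
    case 0
    have "qint q 1 * qbinom q (Suc n) 1 = qint q (Suc n)" using Suc.IH[of 0] by simp
    then show ?thesis by (simp add: 0 qint_Suc[of q "Suc n"] qint_def[of q "Suc 0"])
  next
    case (Suc j)
    have "qint q (Suc k) * qbinom q (Suc (Suc n)) (Suc k) =
      qint q (Suc k) * qbinom q (Suc n) k + q ^ Suc k * (qint q (Suc k) * qbinom q (Suc n) (Suc k))"
      by (simp add: algebra_simps)
    also have "\<dots> = qbinom q (Suc n) k + q * (qint q k * qbinom q (Suc n) k)
        + q ^ Suc k * (qint q (Suc n) * qbinom q n k)"
      by (simp only: Suc.IH) (simp only: qint_Suc[of q k] algebra_simps mult_1_left)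
    also have "qint q k * qbinom q (Suc n) k = qint q (Suc n) * qbinom q n j"
      using Suc.IH[of j] Suc by simp
    also have "qbinom q (Suc n) k + q * (qint q (Suc n) * qbinom q n j)
        + q ^ Suc k * (qint q (Suc n) * qbinom q n k) =
        qbinom q (Suc n) k + q * qint q (Suc n) * (qbinom q n j + q ^ k * qbinom q n k)"
      by (simp add: algebra_simps)
    also have "qbinom q n j + q ^ k * qbinom q n k = qbinom q (Suc n) k" by (simp add: Suc)
    finally show ?thesis by (simp only: qint_Suc[of q "Suc n"] algebra_simps mult_1_left)
  qed
qed

lemma qbinom_eq_0: "n < k \<Longrightarrow> qbinom q n k = 0"
  by (induction q n k rule: qbinom.induct) auto

lemma qbinom_self: "qbinom q n n = 1"
  by (induction n) (auto simp: qbinom_eq_0)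

context k_algebra
begin

lemma pow_q_commute:
  assumes "a \<in> carrier R" "b \<in> carrier R" "b \<otimes> a = q \<odot> (a \<otimes> b)"
  shows "b \<otimes> a [^] (k::nat) = q ^ k \<odot> (a [^] k \<otimes> b)"
proof (induction k)
  case (Suc k)
  have "b \<otimes> a [^] Suc k = (b \<otimes> a [^] k) \<otimes> a" using assms by (simp add: m_assoc)
  also have "\<dots> = q ^ k \<odot> (a [^] k \<otimes> (b \<otimes> a))"
    using assms by (simp add: Suc smult_mult_left m_assoc)
  also have "\<dots> = q ^ Suc k \<odot> (a [^] Suc k \<otimes> b)"
    using assms by (simp add: smult_mult_right smult_assoc m_assoc mult.commute)
  finally show ?case .
qed (use assms in simp)

lemma q_binomial_theorem:
  assumes a: "a \<in> carrier R" and b: "b \<in> carrier R" and ba: "b \<otimes> a = q \<odot> (a \<otimes> b)"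
  shows "(a \<oplus> b) [^] n = (\<Oplus>k\<in>{..n}. qbinom q n k \<odot> (a [^] k \<otimes> b [^] (n - k)))"
proof (induction n)
  case 0
  show ?case using a b by simp
next
  case (Suc n)
  define m where "m k = a [^] k \<otimes> b [^] (Suc n - k)" for k
  have m: "m k \<in> carrier R" for k using a b by (simp add: m_def)
  have a_m: "a \<otimes> (a [^] k \<otimes> b [^] (n - k)) = m (Suc k)" for k
    using a b by (simp add: m_def m_assoc[symmetric] nat_pow_Suc2[symmetric])
  have b_m: "b \<otimes> (a [^] k \<otimes> b [^] (n - k)) = q ^ k \<odot> m k" if "k \<le> n" for k
  proof -
    have "b \<otimes> (a [^] k \<otimes> b [^] (n - k)) = (b \<otimes> a [^] k) \<otimes> b [^] (n - k)"
      using a b by (simp add: m_assoc)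
    also have "\<dots> = q ^ k \<odot> (a [^] k \<otimes> (b \<otimes> b [^] (n - k)))"
      using a b by (simp add: pow_q_commute[OF a b ba] smult_mult_left m_assoc)
    also have "b \<otimes> b [^] (n - k) = b [^] (Suc n - k)"
      using b that by (simp add: nat_pow_Suc2[symmetric] Suc_diff_le)
    finally show ?thesis by (simp add: m_def)
  qed
  let ?c = "qbinom q n"
  have "(a \<oplus> b) [^] Suc n = (a \<oplus> b) \<otimes> (\<Oplus>k\<in>{..n}. ?c k \<odot> (a [^] k \<otimes> b [^] (n - k)))"
    using a b Suc by (simp only: nat_pow_Suc2 a_closed)
  also have "\<dots> = (\<Oplus>k\<in>{..n}. (a \<oplus> b) \<otimes> (?c k \<odot> (a [^] k \<otimes> b [^] (n - k))))"
    using a b by (intro finsum_rdistr) auto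
  also have "\<dots> = (\<Oplus>k\<in>{..n}. ?c k \<odot> m (Suc k) \<oplus> (q ^ k * ?c k) \<odot> m k)"
    using a b m by (intro finsum_cong')
      (auto simp: l_distr smult_mult_right a_m b_m smult_r_distr smult_assoc mult.commute)
  also have "\<dots> = (\<Oplus>k\<in>{..n}. ?c k \<odot> m (Suc k)) \<oplus> (\<Oplus>k\<in>{..n}. (q ^ k * ?c k) \<odot> m k)"
    using m by (intro finsum_addf) auto
  \<comment> \<open>The added term at \<open>Suc n\<close> is zero, since
    \<open>qbinom q n (Suc n) = 0\<close>. Splitting off \<open>k = 0\<close> then aligns both sums
    on \<open>m (Suc k)\<close> for Pascal's rule.\<close>
  also have "(\<Oplus>k\<in>{..n}. (q ^ k * ?c k) \<odot> m k) = (\<Oplus>k\<in>{..Suc n}. (q ^ k * ?c k) \<odot> m k)"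
    using m by (subst finsum_Suc) (auto simp: qbinom_eq_0)
  also have "\<dots> = (\<Oplus>k\<in>{..n}. (q ^ Suc k * ?c (Suc k)) \<odot> m (Suc k)) \<oplus> m 0"
    using m by (subst finsum_Suc2) auto
  also have "(\<Oplus>k\<in>{..n}. ?c k \<odot> m (Suc k)) \<oplus>
      ((\<Oplus>k\<in>{..n}. (q ^ Suc k * ?c (Suc k)) \<odot> m (Suc k)) \<oplus> m 0) =
      ((\<Oplus>k\<in>{..n}. ?c k \<odot> m (Suc k)) \<oplus>
      (\<Oplus>k\<in>{..n}. (q ^ Suc k * ?c (Suc k)) \<odot> m (Suc k))) \<oplus> m 0"
    using m by (intro a_assoc[symmetric] finsum_closed) auto
  also have "(\<Oplus>k\<in>{..n}. ?c k \<odot> m (Suc k)) \<oplus>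
      (\<Oplus>k\<in>{..n}. (q ^ Suc k * ?c (Suc k)) \<odot> m (Suc k)) =
      (\<Oplus>k\<in>{..n}. ?c k \<odot> m (Suc k) \<oplus> (q ^ Suc k * ?c (Suc k)) \<odot> m (Suc k))"
    using m by (intro finsum_addf[symmetric]) auto
  also have "\<dots> = (\<Oplus>k\<in>{..n}. qbinom q (Suc n) (Suc k) \<odot> m (Suc k))"
    using m by (intro finsum_cong') (auto simp: smult_l_distr)
  also have "\<dots> \<oplus> m 0 = (\<Oplus>k\<in>{..Suc n}. qbinom q (Suc n) k \<odot> m k)"
    using m by (subst finsum_Suc2) auto
  finally show ?case by (simp add: m_def)
qed

text \<open>For \<open>0 < k < n\<close> absorption gives \<open>qint q k * qbinom q n k = 0\<close>
  with \<open>qint q k\<close> nonzero, so only the two outer terms of the q-binomial theorem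
  remain.\<close>

lemma q_freshman:
  assumes a: "a \<in> carrier R" and b: "b \<in> carrier R" and ba: "b \<otimes> a = q \<odot> (a \<otimes> b)"
    and n: "0 < n" and q: "qint q n = 0" "\<And>k. 0 < k \<Longrightarrow> k < n \<Longrightarrow> qint q k \<noteq> 0"
  shows "(a \<oplus> b) [^] n = a [^] n \<oplus> b [^] n"
proof -
  have z: "qbinom q n k = 0" if "0 < k" "k < n" for k
  proof -
    have "qint q k * qbinom q n k = qint q n * qbinom q (n - 1) (k - 1)"
      using qbinom_absorb[of q "k - 1" "n - 1"] that by (simp del: qbinom.simps)
    then show ?thesis using q(1) q(2)[OF that] by simp
  qed
  have "(\<Oplus>k\<in>{..n}. qbinom q n k \<odot> (a [^] k \<otimes> b [^] (n - k))) =
    (\<Oplus>k\<in>{0, n}. qbinom q n k \<odot> (a [^] k \<otimes> b [^] (n - k)))"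
  proof (rule add.finprod_mono_neutral_cong_right)
    fix k assume "k \<in> {..n} - {0, n}"
    then have "qbinom q n k = 0" by (intro z) auto
    then show "qbinom q n k \<odot> (a [^] k \<otimes> b [^] (n - k)) = \<zero>" using a b by simp
  qed (use a b in auto)
  also have "\<dots> = b [^] n \<oplus> a [^] n"
    using a b n by (subst finsum_insert) (auto simp: qbinom_self)
  finally show ?thesis using a b by (simp add: q_binomial_theorem[OF a b ba] a_comm)
qed

end

section \<open>Homomorphisms from free algebras\<close>

lemma monoid_free_monoid: "monoid (free_monoid S)"
  by (rule monoidI) (auto simp: free_monoid_def)

lemma free_monoid_simps [simp]:
  "carrier (free_monoid S) = lists S" "monoid.mult (free_monoid S) = (@)" "one (free_monoid S) = []"
  by (simp_all add: free_monoid_def)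

lemma k_algebra_free_algebra: "k_algebra (free_algebra S)"
  unfolding free_algebra_def by (rule k_algebra_monoid_algebra[OF monoid_free_monoid])

lemma free_algebra_simps [simp]:
  "carrier (free_algebra S :: ('k::field, 'x list \<Rightarrow>\<^sub>0 'k) module) = {p. Poly_Mapping.keys p \<subseteq> lists S}"
  "one (free_algebra S :: ('k, 'x list \<Rightarrow>\<^sub>0 'k) module) = Poly_Mapping.single [] 1"
  "zero (free_algebra S :: ('k, 'x list \<Rightarrow>\<^sub>0 'k) module) = 0"
  "add (free_algebra S :: ('k, 'x list \<Rightarrow>\<^sub>0 'k) module) = (+)"
  "module.smult (free_algebra S :: ('k, 'x list \<Rightarrow>\<^sub>0 'k) module) = pm_scale"
  "monoid.mult (free_algebra S :: ('k, 'x list \<Rightarrow>\<^sub>0 'k) module) = pm_mult (@)"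
  by (simp_all add: free_algebra_def)

lemma free_gen_closed: "l \<in> S \<Longrightarrow> free_gen l \<in> carrier (free_algebra S)"
  by (simp add: free_gen_def)

locale free_lift_setting = k_algebra T for T :: "('k::field, 'b, 'e) module_scheme" (structure) +
  fixes S :: "'x set" and f :: "'x \<Rightarrow> 'b"
  assumes f_closed: "\<And>l. l \<in> S \<Longrightarrow> f l \<in> carrier T"
begin

abbreviation F :: "('k, 'x list \<Rightarrow>\<^sub>0 'k) module" where "F \<equiv> free_algebra S"

definition wval :: "'x list \<Rightarrow> 'b"
  where "wval w = foldr (\<lambda>x r. f x \<otimes> r) w \<one>"

lemma wval_closed: "w \<in> lists S \<Longrightarrow> wval w \<in> carrier T"
  by (induction w) (auto simp: wval_def f_closed)

lemma wval_append: "w \<in> lists S \<Longrightarrow> v \<in> lists S \<Longrightarrow>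
    wval (w @ v) = wval w \<otimes> wval v"
proof (induction w)
  case (Cons l w)
  then show ?case using wval_closed[of w] wval_closed[of v] by (auto simp: wval_def f_closed m_assoc)
qed (auto simp: wval_def wval_closed[unfolded wval_def])

lemma free_lift_eq: "free_lift T f p = lin_ext wval p"
  by (simp add: free_lift_def lin_ext_def wval_def)

lemma wval_Pi:
  assumes "p \<in> carrier F"
  shows "wval \<in> Poly_Mapping.keys p \<rightarrow> carrier T"
proof (rule Pi_I, rule wval_closed)
  fix w assume "w \<in> Poly_Mapping.keys p"
  then show "w \<in> lists S"
    using assms unfolding free_algebra_simps mem_Collect_eq by (rule subsetD[rotated])
qed

lemma free_lift_closed [simp]: "p \<in> carrier F \<Longrightarrow> free_lift T f p \<in> carrier T"
  unfolding free_lift_eq by (intro lin_ext_closed wval_Pi)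

lemma free_lift_add:
  "p \<in> carrier F \<Longrightarrow> q \<in> carrier F \<Longrightarrow>
      free_lift T f (p + q) = free_lift T f p \<oplus> free_lift T f q"
  unfolding free_lift_eq by (intro lin_ext_add wval_Pi)

lemma free_lift_scale: "p \<in> carrier F \<Longrightarrow> free_lift T f (pm_scale c p) = c \<odot> free_lift T f p"
  unfolding free_lift_eq by (intro lin_ext_scale wval_Pi)

lemma free_lift_single: "w \<in> lists S \<Longrightarrow> free_lift T f (Poly_Mapping.single w c) = c \<odot> wval w"
  unfolding free_lift_eq by (intro lin_ext_single wval_closed)

lemma free_lift_gen: "l \<in> S \<Longrightarrow> free_lift T f (free_gen l) = f l"
  by (simp add: free_gen_def free_lift_single wval_def f_closed)

text \<open>Both sides are bilinear, so words suffice, and on words concatenation becomes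
  multiplication.\<close>

lemma free_lift_mult:
  assumes p: "p \<in> carrier F" and q: "q \<in> carrier F"
  shows "free_lift T f (p \<otimes>\<^bsub>F\<^esub> q) = free_lift T f p \<otimes> free_lift T f q"
proof -
  interpret F: k_algebra F by (rule k_algebra_free_algebra)
  have K: "Poly_Mapping.keys p \<subseteq> lists S" "Poly_Mapping.keys q \<subseteq> lists S" using p q by auto
  have cl: "Poly_Mapping.keys (pm_mult (@) p q) \<subseteq> lists S"
    if "Poly_Mapping.keys p \<subseteq> lists S" "Poly_Mapping.keys q \<subseteq> lists S"
        for p q :: "'x list \<Rightarrow>\<^sub>0 'k"
    using F.m_closed[of p q] that by simp
  show ?thesis
    using K(1)
  proof (induction rule: pm_linear_induct)
    case zero
    then show ?case using q free_lift_closed[OF q] by (simp add: free_lift_eq)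
  next
    case (single w)
    show ?case using K(2)
    proof (induction rule: pm_linear_induct)
      case zero
      then show ?case using single by (simp add: free_lift_eq wval_closed)
    next
      case (single v)
      then show ?case using \<open>w \<in> lists S\<close> by (simp add: free_lift_single wval_append wval_closed)
    next
      case (add p q)
      then show ?case using single cl
        by (simp add: pm_mult_add_right free_lift_add r_distr)
    next
      case (scale c p)
      then show ?case using single cl
        by (simp add: pm_mult_scale_right free_lift_scale smult_mult_right)
    qed
  next
    case (add p p')
    then show ?case using q cl by (simp add: pm_mult_add_left free_lift_add l_distr)
  next
    case (scale c p)
    then show ?case using q cl by (simp add: pm_mult_scale_left free_lift_scale smult_mult_left)
  qed
qed

lemma free_lift_one: "free_lift T f \<one>\<^bsub>F\<^esub> = \<one>"
  by (simp add: free_lift_single wval_def)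

lemma free_lift_hom: "free_lift T f \<in> ring_hom F T"
  by (rule ring_hom_memI)
    (simp_all only: free_lift_closed free_lift_mult free_lift_one, simp add: free_lift_add)

end

section \<open>The Hopf algebra of a datum\<close>

locale hopf_datum =
  fixes D :: "('g, 'k::field) datum"
  assumes datum: "is_datum D"
begin

abbreviation "S \<equiv> Inl ` carrier (grp D) \<union> Inr ` {1..theta D} :: ('g + nat) set"
abbreviation "F \<equiv> FF D"
abbreviation "U \<equiv> UU D"
abbreviation "gr \<equiv> U_grp D"
abbreviation "x \<equiv> U_x D"
abbreviation "g \<equiv> gel D"
abbreviation "\<chi> \<equiv> chi D"
abbreviation "J \<equiv> {1..theta D}"
abbreviation proj where "proj p \<equiv> U_ideal D +>\<^bsub>F\<^esub> p"
abbreviation fg :: "'g + nat \<Rightarrow> ('g + nat) list \<Rightarrow>\<^sub>0 'k" where "fg \<equiv> free_gen"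

sublocale G: comm_group "grp D"
  using datum by (simp add: is_datum_def)

lemma finite_G: "finite (carrier (grp D))"
  using datum by (simp add: is_datum_def)

lemma g_closed [simp]: "i \<in> J \<Longrightarrow> g i \<in> carrier (grp D)"
  using datum by (simp add: is_datum_def)

lemma chi_hom: "i \<in> J \<Longrightarrow> \<chi> i \<in> hom (grp D) (mult_of (KK :: 'k ring))"
  using datum by (simp add: is_datum_def)

lemma chi_nonzero: "i \<in> J \<Longrightarrow> h \<in> carrier (grp D) \<Longrightarrow> \<chi> i h \<noteq> 0"
  using hom_in_carrier[OF chi_hom] by (fastforce simp: ring_of_type_algebra_def)

lemma chi_gi: "i \<in> J \<Longrightarrow> \<chi> i (g i) \<noteq> 1"
  using datum by (simp add: is_datum_def)

lemma chi_swap: "i \<in> J \<Longrightarrow> j \<in> J \<Longrightarrow> i \<noteq> j \<Longrightarrow>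
    \<chi> i (g j) * \<chi> j (g i) = 1"
  using datum by (simp add: is_datum_def)

sublocale F: k_algebra F
  unfolding FF_def by (rule k_algebra_free_algebra)

lemma fg_closed [simp]:
  "h \<in> carrier (grp D) \<Longrightarrow> fg (Inl h) \<in> carrier F" "i \<in> J \<Longrightarrow>
      fg (Inr i) \<in> carrier F"
  unfolding FF_def by (rule free_gen_closed; simp)+

lemma U_rels_subset: "U_rels D \<subseteq> carrier F"
  unfolding U_rels_def Let_def by (auto intro!: F.minus_closed simp del: One_nat_def)

lemma ideal_U: "ideal (U_ideal D) F"
  unfolding U_ideal_def by (rule F.genideal_ideal[OF U_rels_subset])

sublocale I: k_algebra_ideal "U_ideal D" F
  by (simp add: k_algebra_ideal_def F.k_algebra_axioms ideal_U)

lemma U_eq: "U = quot_algebra F (U_ideal D)"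
  by (simp add: UU_def)

sublocale U: k_algebra U
  unfolding U_eq by (rule I.k_algebra_quot)

lemma proj_simps:
  "p \<in> carrier F \<Longrightarrow> proj p \<in> carrier U"
  "p \<in> carrier F \<Longrightarrow> q \<in> carrier F \<Longrightarrow>
      proj (p \<otimes>\<^bsub>F\<^esub> q) = proj p \<otimes>\<^bsub>U\<^esub> proj q"
  "p \<in> carrier F \<Longrightarrow> q \<in> carrier F \<Longrightarrow>
      proj (p \<oplus>\<^bsub>F\<^esub> q) = proj p \<oplus>\<^bsub>U\<^esub> proj q"
  "p \<in> carrier F \<Longrightarrow> proj (c \<odot>\<^bsub>F\<^esub> p) = c \<odot>\<^bsub>U\<^esub> proj p"
  "proj \<one>\<^bsub>F\<^esub> = \<one>\<^bsub>U\<^esub>"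
  unfolding U_eq by (simp_all add: I.coset_mult I.coset_add I.coset_smult I.coset_one I.coset_closed)

lemma proj_minus: "p \<in> carrier F \<Longrightarrow> q \<in> carrier F \<Longrightarrow>
    proj (p \<ominus>\<^bsub>F\<^esub> q) = proj p \<ominus>\<^bsub>U\<^esub> proj q"
  by (simp add: a_minus_def proj_simps F.smult_minus_one[symmetric] U.smult_minus_one[symmetric])

lemma proj_pow: "p \<in> carrier F \<Longrightarrow> proj (p [^]\<^bsub>F\<^esub> (n::nat)) = proj p [^]\<^bsub>U\<^esub> n"
  by (induction n) (simp_all add: proj_simps)

lemma gr_eq: "gr h = proj (fg (Inl h))" and x_eq: "x i = proj (fg (Inr i))"
  by (simp_all add: U_grp_def U_x_def)

lemma gr_closed [simp]: "h \<in> carrier (grp D) \<Longrightarrow> gr h \<in> carrier U"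
  and x_closed [simp]: "i \<in> J \<Longrightarrow> x i \<in> carrier U"
  by (simp_all add: gr_eq x_eq proj_simps)

lemma rel_eq:
  assumes "p \<ominus>\<^bsub>F\<^esub> q \<in> U_rels D" "p \<in> carrier F" "q \<in> carrier F"
  shows "proj p = proj q"
  using assms I.coset_eq_iff F.genideal_self[OF U_rels_subset] unfolding U_ideal_def by blast

lemma U_rels_intros:
  "h \<in> carrier (grp D) \<Longrightarrow> h' \<in> carrier (grp D) \<Longrightarrow>
    fg (Inl h) \<otimes>\<^bsub>F\<^esub> fg (Inl h') \<ominus>\<^bsub>F\<^esub> fg (Inl (h \<otimes>\<^bsub>grp D\<^esub> h')) \<in> U_rels D"
  "fg (Inl \<one>\<^bsub>grp D\<^esub>) \<ominus>\<^bsub>F\<^esub> \<one>\<^bsub>F\<^esub> \<in> U_rels D"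
  "h \<in> carrier (grp D) \<Longrightarrow> i \<in> J \<Longrightarrow>
    fg (Inl h) \<otimes>\<^bsub>F\<^esub> fg (Inr i) \<ominus>\<^bsub>F\<^esub> \<chi> i h \<odot>\<^bsub>F\<^esub> (fg (Inr i) \<otimes>\<^bsub>F\<^esub> fg (Inl h)) \<in> U_rels D"
  "i \<in> J \<Longrightarrow> j \<in> J \<Longrightarrow> i < j \<Longrightarrow>
    fg (Inr j) \<otimes>\<^bsub>F\<^esub> fg (Inr i) \<ominus>\<^bsub>F\<^esub> (\<chi> i (g j) \<odot>\<^bsub>F\<^esub> (fg (Inr i) \<otimes>\<^bsub>F\<^esub> fg (Inr j)) \<oplus>\<^bsub>F\<^esub>
      lam D i j \<odot>\<^bsub>F\<^esub> (\<one>\<^bsub>F\<^esub> \<ominus>\<^bsub>F\<^esub> fg (Inl (g i \<otimes>\<^bsub>grp D\<^esub> g j)))) \<in> U_rels D"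
  "i \<in> J \<Longrightarrow> fg (Inr i) [^]\<^bsub>F\<^esub> NN D i \<ominus>\<^bsub>F\<^esub>
      mu D i \<odot>\<^bsub>F\<^esub> (\<one>\<^bsub>F\<^esub> \<ominus>\<^bsub>F\<^esub> fg (Inl (g i [^]\<^bsub>grp D\<^esub> NN D i))) \<in> U_rels D"
  unfolding U_rels_def Let_def by blast+

lemma U_rels_cases:
  assumes "r \<in> U_rels D"
  obtains (grp) h h' where "h \<in> carrier (grp D)" "h' \<in> carrier (grp D)"
      "r = fg (Inl h) \<otimes>\<^bsub>F\<^esub> fg (Inl h') \<ominus>\<^bsub>F\<^esub> fg (Inl (h \<otimes>\<^bsub>grp D\<^esub> h'))"
    | (unit) "r = fg (Inl \<one>\<^bsub>grp D\<^esub>) \<ominus>\<^bsub>F\<^esub> \<one>\<^bsub>F\<^esub>"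
    | (act) h i where "h \<in> carrier (grp D)" "i \<in> J"
      "r = fg (Inl h) \<otimes>\<^bsub>F\<^esub> fg (Inr i) \<ominus>\<^bsub>F\<^esub> \<chi> i h \<odot>\<^bsub>F\<^esub> (fg (Inr i) \<otimes>\<^bsub>F\<^esub> fg (Inl h))"
    | (swap) i j where "i \<in> J" "j \<in> J" "i < j"
      "r = fg (Inr j) \<otimes>\<^bsub>F\<^esub> fg (Inr i) \<ominus>\<^bsub>F\<^esub> (\<chi> i (g j) \<odot>\<^bsub>F\<^esub> (fg (Inr i) \<otimes>\<^bsub>F\<^esub> fg (Inr j)) \<oplus>\<^bsub>F\<^esub>
        lam D i j \<odot>\<^bsub>F\<^esub> (\<one>\<^bsub>F\<^esub> \<ominus>\<^bsub>F\<^esub> fg (Inl (g i \<otimes>\<^bsub>grp D\<^esub> g j))))"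
    | (pow) i where "i \<in> J" "r = fg (Inr i) [^]\<^bsub>F\<^esub> NN D i \<ominus>\<^bsub>F\<^esub>
        mu D i \<odot>\<^bsub>F\<^esub> (\<one>\<^bsub>F\<^esub> \<ominus>\<^bsub>F\<^esub> fg (Inl (g i [^]\<^bsub>grp D\<^esub> NN D i)))"
  using assms unfolding U_rels_def Let_def by blast

section \<open>The defining relations in \<open>U\<close>\<close>

lemma gr_mult: "h \<in> carrier (grp D) \<Longrightarrow> h' \<in> carrier (grp D) \<Longrightarrow>
    gr h \<otimes>\<^bsub>U\<^esub> gr h' = gr (h \<otimes>\<^bsub>grp D\<^esub> h')"
  using rel_eq[OF U_rels_intros(1)] by (simp add: gr_eq proj_simps)

lemma gr_one: "gr \<one>\<^bsub>grp D\<^esub> = \<one>\<^bsub>U\<^esub>"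
  using rel_eq[OF U_rels_intros(2)] by (simp add: gr_eq proj_simps)

lemma gr_x: "h \<in> carrier (grp D) \<Longrightarrow> i \<in> J \<Longrightarrow>
    gr h \<otimes>\<^bsub>U\<^esub> x i = \<chi> i h \<odot>\<^bsub>U\<^esub> (x i \<otimes>\<^bsub>U\<^esub> gr h)"
  using rel_eq[OF U_rels_intros(3)] by (simp add: gr_eq x_eq proj_simps)

lemma x_x: "i \<in> J \<Longrightarrow> j \<in> J \<Longrightarrow> i < j \<Longrightarrow>
    x j \<otimes>\<^bsub>U\<^esub> x i = \<chi> i (g j) \<odot>\<^bsub>U\<^esub> (x i \<otimes>\<^bsub>U\<^esub> x j) \<oplus>\<^bsub>U\<^esub>
      lam D i j \<odot>\<^bsub>U\<^esub> (\<one>\<^bsub>U\<^esub> \<ominus>\<^bsub>U\<^esub> gr (g i \<otimes>\<^bsub>grp D\<^esub> g j))"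
  using rel_eq[OF U_rels_intros(4)] by (simp add: gr_eq x_eq proj_simps proj_minus)

lemma x_pow: "i \<in> J \<Longrightarrow>
    x i [^]\<^bsub>U\<^esub> NN D i = mu D i \<odot>\<^bsub>U\<^esub> (\<one>\<^bsub>U\<^esub> \<ominus>\<^bsub>U\<^esub> gr (g i [^]\<^bsub>grp D\<^esub> NN D i))"
  using rel_eq[OF U_rels_intros(5)] by (simp add: gr_eq x_eq proj_simps proj_minus proj_pow)

lemma gr_pow: "h \<in> carrier (grp D) \<Longrightarrow>
    gr h [^]\<^bsub>U\<^esub> (n::nat) = gr (h [^]\<^bsub>grp D\<^esub> n)"
  by (induction n) (simp_all add: gr_one gr_mult)

section \<open>The orders of the character values\<close>

lemma mult_of_KK:
  "carrier (mult_of (KK :: 'k ring)) = - {0}" "monoid.mult (mult_of (KK :: 'k ring)) = (*)"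
  "one (mult_of (KK :: 'k ring)) = 1"
  by (auto simp: ring_of_type_algebra_def)

lemma group_mult_of_KK: "group (mult_of (KK :: 'k ring))"
proof (rule groupI)
  fix c assume "c \<in> carrier (mult_of (KK :: 'k ring))"
  then show "\<exists>d\<in>carrier (mult_of (KK :: 'k ring)). d \<otimes>\<^bsub>mult_of (KK :: 'k ring)\<^esub> c = \<one>\<^bsub>mult_of (KK :: 'k ring)\<^esub>"
    unfolding mult_of_KK by (intro bexI[of _ "inverse c"]) auto
qed (simp_all only: mult_of_KK, auto)

lemma mult_of_KK_pow: "c [^]\<^bsub>mult_of (KK :: 'k ring)\<^esub> (n::nat) = c ^ n"
proof -
  interpret M: group "mult_of (KK :: 'k ring)" by (rule group_mult_of_KK)
  show ?thesis by (induction n) (simp_all only: M.nat_pow_0 M.nat_pow_Suc mult_of_KK power_0 power_Suc2)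
qed

lemma NN_pow: "i \<in> J \<Longrightarrow> \<chi> i (g i) ^ n = 1 \<longleftrightarrow> NN D i dvd n"
proof -
  interpret M: group "mult_of (KK :: 'k ring)" by (rule group_mult_of_KK)
  assume i: "i \<in> J"
  then have "\<chi> i (g i) \<in> carrier (mult_of (KK :: 'k ring))"
    using chi_nonzero[OF i g_closed[OF i]] by (simp only: mult_of_KK) simp
  from M.pow_eq_id[OF this, of n] show ?thesis
    by (simp only: mult_of_KK_pow mult_of_KK(3) NN_def)
qed

lemma chi_pow_order: "i \<in> J \<Longrightarrow> h \<in> carrier (grp D) \<Longrightarrow>
    \<chi> i h ^ Coset.order (grp D) = 1"
proof -
  assume i: "i \<in> J" and h: "h \<in> carrier (grp D)"
  interpret M: group "mult_of (KK :: 'k ring)" by (rule group_mult_of_KK)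
  interpret H: group_hom "grp D" "mult_of (KK :: 'k ring)" "\<chi> i"
    using chi_hom[OF i] by unfold_locales
  have "\<chi> i (h [^]\<^bsub>grp D\<^esub> Coset.order (grp D)) = \<chi> i h [^]\<^bsub>mult_of (KK :: 'k ring)\<^esub> Coset.order (grp D)"
    using h by (rule H.hom_nat_pow)
  then show ?thesis
    using h H.hom_one by (simp only: G.pow_order_eq_1 mult_of_KK_pow mult_of_KK(3))
qed

text \<open>\<open>NN D i\<close> could be 0 only for a value of infinite order, and 1 only for the
  value 1. The first is excluded because it divides the order of the finite group, the second by the
  datum.\<close>

lemma NN_ge_2: "i \<in> J \<Longrightarrow> NN D i \<ge> 2"
proof -
  assume i: "i \<in> J"
  have "Coset.order (grp D) > 0" using finite_G by (simp add: G.order_gt_0_iff_finite)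
  moreover have "NN D i dvd Coset.order (grp D)" using chi_pow_order[OF i g_closed[OF i]] NN_pow[OF i] by blast
  ultimately have "NN D i \<noteq> 0" by (metis dvd_0_left_iff less_irrefl)
  moreover have "NN D i \<noteq> 1" using NN_pow[OF i, of 1] chi_gi[OF i] by auto
  ultimately show ?thesis by linarith
qed

text \<open>From \<open>(q - 1) * qint q n = q ^ n - 1\<close> with \<open>q\<close> different from
  1.\<close>

lemma qint_chi:
  assumes "i \<in> J"
  shows "qint (\<chi> i (g i)) n = 0 \<longleftrightarrow> NN D i dvd n"
proof -
  have "(\<chi> i (g i) - 1) * qint (\<chi> i (g i)) n = \<chi> i (g i) ^ n - 1"
    unfolding qint_def by (metis power_diff_1_eq)
  then show ?thesis using NN_pow[OF assms, of n] chi_gi[OF assms] by auto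
qed

end

text \<open>Used with \<open>w = 1 \<otimes> 1\<close>, \<open>u = 1 \<otimes> k\<close> and
  \<open>v = k \<otimes> k\<close> for a group element \<open>k\<close>: it expresses that
  \<open>1 - k\<close> is skew-primitive.\<close>

lemma (in k_algebra) telescope:
  assumes "u \<in> carrier R" "v \<in> carrier R" "w \<in> carrier R"
  shows "(u \<ominus> v) \<oplus> (w \<ominus> u) = w \<ominus> v"
proof -
  have "(u \<ominus> v) \<oplus> (w \<ominus> u) = (w \<ominus> u) \<oplus> (u \<oplus> \<ominus> v)" using assms
      by (simp add: a_minus_def a_comm)
  also have "\<dots> = w \<oplus> (\<ominus> u \<oplus> (u \<oplus> \<ominus> v))" using assms
      by (simp add: a_minus_def a_assoc)
  also have "\<ominus> u \<oplus> (u \<oplus> \<ominus> v) = \<ominus> v" using assms by (simp add: r_neg1)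
  finally show ?thesis by (simp add: a_minus_def)
qed

lemma (in k_algebra) rearrange_swap:
  assumes "a \<in> carrier R" "b \<in> carrier R" "c \<in> carrier R" "d \<in> carrier R"
    "u \<in> carrier R" "v \<in> carrier R" "w \<in> carrier R"
  shows "(a \<oplus> (u \<ominus> v)) \<oplus> b \<oplus> (c \<oplus> (d \<oplus> (w \<ominus> u))) = (a \<oplus> c \<oplus> (b \<oplus> d)) \<oplus> (w \<ominus> v)"
proof -
  have "(a \<oplus> (u \<ominus> v)) \<oplus> b \<oplus> (c \<oplus> (d \<oplus> (w \<ominus> u))) =
      (a \<oplus> c \<oplus> (b \<oplus> d)) \<oplus> ((u \<ominus> v) \<oplus> (w \<ominus> u))"
    using assms by (simp add: a_ac)
  then show ?thesis using assms by (simp add: telescope)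
qed

context hopf_datum
begin

section \<open>The comultiplication respects the relations\<close>

sublocale X: tensor U U
  by (simp add: tensor_def U.k_algebra_axioms)

sublocale T: k_algebra X.T
  by (rule X.k_algebra_T)

abbreviation "T \<equiv> X.T"
abbreviation "pt \<equiv> X.pt"

definition comult_x :: "nat \<Rightarrow> ((('g + nat) list \<Rightarrow>\<^sub>0 'k) set \<times> (('g + nat) list \<Rightarrow>\<^sub>0 'k) set \<Rightarrow>\<^sub>0 'k) set"
  where "comult_x i = pt (x i) (gr (g i)) \<oplus>\<^bsub>T\<^esub> pt \<one>\<^bsub>U\<^esub> (x i)"

lemma comult_x_closed [simp]: "i \<in> J \<Longrightarrow> comult_x i \<in> carrier T"
  by (simp add: comult_x_def)

sublocale L: free_lift_setting X.T S "comult_gen D"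
proof
  fix l assume "l \<in> S"
  then show "comult_gen D l \<in> carrier X.T"
  proof
    assume "l \<in> Inr ` J"
    then obtain i where "l = Inr i" "i \<in> J" by blast
    then show ?thesis using comult_x_closed by (simp add: comult_x_def)
  qed auto
qed

lemma F_eq: "L.F = F"
  by (simp add: FF_def)

lemma pt_minus_left: "a \<in> carrier U \<Longrightarrow> b \<in> carrier U \<Longrightarrow> c \<in> carrier U \<Longrightarrow>
    pt (a \<ominus>\<^bsub>U\<^esub> b) c = pt a c \<ominus>\<^bsub>T\<^esub> pt b c"
  by (simp add: a_minus_def X.pt_add_left X.pt_smult_left U.smult_minus_one[symmetric]
      T.smult_minus_one[symmetric])

lemma pt_minus_right: "a \<in> carrier U \<Longrightarrow> b \<in> carrier U \<Longrightarrow> c \<in> carrier U \<Longrightarrow>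
    pt c (a \<ominus>\<^bsub>U\<^esub> b) = pt c a \<ominus>\<^bsub>T\<^esub> pt c b"
  by (simp add: a_minus_def X.pt_add_right X.pt_smult_right U.smult_minus_one[symmetric]
      T.smult_minus_one[symmetric])

lemma pt_pow: "a \<in> carrier U \<Longrightarrow> b \<in> carrier U \<Longrightarrow>
    pt a b [^]\<^bsub>T\<^esub> (n::nat) = pt (a [^]\<^bsub>U\<^esub> n) (b [^]\<^bsub>U\<^esub> n)"
  by (induction n) (simp_all add: X.T_one X.pt_mult)

lemma gr_comm: "h \<in> carrier (grp D) \<Longrightarrow> h' \<in> carrier (grp D) \<Longrightarrow>
    gr h \<otimes>\<^bsub>U\<^esub> gr h' = gr h' \<otimes>\<^bsub>U\<^esub> gr h"
  by (simp add: gr_mult G.m_comm)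

lemma comult_x_act:
  assumes "h \<in> carrier (grp D)" "i \<in> J"
  shows "pt (gr h) (gr h) \<otimes>\<^bsub>T\<^esub> comult_x i = \<chi> i h \<odot>\<^bsub>T\<^esub> (comult_x i \<otimes>\<^bsub>T\<^esub> pt (gr h) (gr h))"
  using assms gr_comm[of h "g i"] unfolding comult_x_def
  by (simp add: T.l_distr T.r_distr X.pt_mult gr_x X.pt_smult_left X.pt_smult_right T.smult_r_distr)

text \<open>The mixed terms of the two products match because
  \<open>\<chi> i (g j) * \<chi> j (g i) = 1\<close>. The terms with \<open>lam D i j\<close> add up
  to a multiple of \<open>1 \<otimes> 1 - k \<otimes> k\<close>, since \<open>1 \<otimes> k\<close>
  occurs with both signs.\<close>

lemma comult_x_swap:
  assumes "i \<in> J" "j \<in> J" "i < j"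
  shows "comult_x j \<otimes>\<^bsub>T\<^esub> comult_x i = \<chi> i (g j) \<odot>\<^bsub>T\<^esub> (comult_x i \<otimes>\<^bsub>T\<^esub> comult_x j) \<oplus>\<^bsub>T\<^esub>
      lam D i j \<odot>\<^bsub>T\<^esub> (\<one>\<^bsub>T\<^esub> \<ominus>\<^bsub>T\<^esub> pt (gr (g i \<otimes>\<^bsub>grp D\<^esub> g j)) (gr (g i \<otimes>\<^bsub>grp D\<^esub> g j)))"
proof -
  define k where "k = gr (g i \<otimes>\<^bsub>grp D\<^esub> g j)"
  define c where "c = \<chi> i (g j)"
  define l where "l = lam D i j"
  have k: "gr (g i) \<otimes>\<^bsub>U\<^esub> gr (g j) = k" "gr (g j) \<otimes>\<^bsub>U\<^esub> gr (g i) = k" "k \<in> carrier U"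
    using assms by (simp_all add: k_def gr_mult G.m_comm)
  have ji: "gr (g j) \<otimes>\<^bsub>U\<^esub> x i = c \<odot>\<^bsub>U\<^esub> (x i \<otimes>\<^bsub>U\<^esub> gr (g j))"
    using assms by (simp add: gr_x c_def)
  have ij: "c \<odot>\<^bsub>U\<^esub> (gr (g i) \<otimes>\<^bsub>U\<^esub> x j) = x j \<otimes>\<^bsub>U\<^esub> gr (g i)"
    using assms chi_swap[of i j] by (simp add: gr_x U.smult_assoc c_def)
  have xx: "x j \<otimes>\<^bsub>U\<^esub> x i = c \<odot>\<^bsub>U\<^esub> (x i \<otimes>\<^bsub>U\<^esub> x j) \<oplus>\<^bsub>U\<^esub> (l \<odot>\<^bsub>U\<^esub> \<one>\<^bsub>U\<^esub> \<ominus>\<^bsub>U\<^esub> l \<odot>\<^bsub>U\<^esub> k)"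
    using assms k by (simp add: x_x U.smult_r_diff k_def c_def l_def)
  let ?a = "c \<odot>\<^bsub>T\<^esub> pt (x i \<otimes>\<^bsub>U\<^esub> x j) k"
  let ?b = "c \<odot>\<^bsub>T\<^esub> pt (x j) (x i \<otimes>\<^bsub>U\<^esub> gr (g j))"
  let ?c = "pt (x i) (x j \<otimes>\<^bsub>U\<^esub> gr (g i))"
  let ?d = "c \<odot>\<^bsub>T\<^esub> pt \<one>\<^bsub>U\<^esub> (x i \<otimes>\<^bsub>U\<^esub> x j)"
  let ?u = "l \<odot>\<^bsub>T\<^esub> pt \<one>\<^bsub>U\<^esub> k"
  let ?v = "l \<odot>\<^bsub>T\<^esub> pt k k"
  let ?w = "l \<odot>\<^bsub>T\<^esub> pt \<one>\<^bsub>U\<^esub> \<one>\<^bsub>U\<^esub>"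
  have gx: "gr (g i) \<in> carrier U" "gr (g j) \<in> carrier U" "x i \<in> carrier U" "x j \<in> carrier U"
    using assms by simp_all
  have "comult_x j \<otimes>\<^bsub>T\<^esub> comult_x i = pt (x j \<otimes>\<^bsub>U\<^esub> x i) k \<oplus>\<^bsub>T\<^esub> pt (x j) (gr (g j) \<otimes>\<^bsub>U\<^esub> x i) \<oplus>\<^bsub>T\<^esub>
      (pt (x i) (x j \<otimes>\<^bsub>U\<^esub> gr (g i)) \<oplus>\<^bsub>T\<^esub> pt \<one>\<^bsub>U\<^esub> (x j \<otimes>\<^bsub>U\<^esub> x i))"
    unfolding comult_x_def using gx k by (simp add: T.l_distr T.r_distr X.pt_mult T.a_ac)
  also have "pt (x j \<otimes>\<^bsub>U\<^esub> x i) k = ?a \<oplus>\<^bsub>T\<^esub> (?u \<ominus>\<^bsub>T\<^esub> ?v)"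
    unfolding xx using gx k by (simp add: X.pt_add_left X.pt_smult_left pt_minus_left)
  also have "pt (x j) (gr (g j) \<otimes>\<^bsub>U\<^esub> x i) = ?b"
    using gx by (simp add: ji X.pt_smult_right)
  also have "pt \<one>\<^bsub>U\<^esub> (x j \<otimes>\<^bsub>U\<^esub> x i) = ?d \<oplus>\<^bsub>T\<^esub> (?w \<ominus>\<^bsub>T\<^esub> ?u)"
    unfolding xx using gx k by (simp add: X.pt_add_right X.pt_smult_right pt_minus_right)
  also have "?a \<oplus>\<^bsub>T\<^esub> (?u \<ominus>\<^bsub>T\<^esub> ?v) \<oplus>\<^bsub>T\<^esub> ?b \<oplus>\<^bsub>T\<^esub> (?c \<oplus>\<^bsub>T\<^esub> (?d \<oplus>\<^bsub>T\<^esub> (?w \<ominus>\<^bsub>T\<^esub> ?u))) =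
      ?a \<oplus>\<^bsub>T\<^esub> ?c \<oplus>\<^bsub>T\<^esub> (?b \<oplus>\<^bsub>T\<^esub> ?d) \<oplus>\<^bsub>T\<^esub> (?w \<ominus>\<^bsub>T\<^esub> ?v)"
    using gx k by (intro T.rearrange_swap) auto
  also have "?a \<oplus>\<^bsub>T\<^esub> ?c \<oplus>\<^bsub>T\<^esub> (?b \<oplus>\<^bsub>T\<^esub> ?d) = c \<odot>\<^bsub>T\<^esub> (comult_x i \<otimes>\<^bsub>T\<^esub> comult_x j)"
  proof -
    have "?c = c \<odot>\<^bsub>T\<^esub> pt (x i) (gr (g i) \<otimes>\<^bsub>U\<^esub> x j)"
      using gx by (simp add: ij[symmetric] X.pt_smult_right)
    then show ?thesis unfolding comult_x_def using gx k
      by (simp add: T.l_distr T.r_distr X.pt_mult T.smult_r_distr T.a_ac)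
  qed
  also have "?w \<ominus>\<^bsub>T\<^esub> ?v = l \<odot>\<^bsub>T\<^esub> (\<one>\<^bsub>T\<^esub> \<ominus>\<^bsub>T\<^esub> pt k k)"
    using k by (simp add: X.T_one T.smult_r_diff)
  finally show ?thesis by (simp add: k_def c_def l_def)
qed

text \<open>The summands \<open>b = x_i \<otimes> g_i\<close> and \<open>a = 1 \<otimes> x_i\<close>
  satisfy \<open>b a = q a b\<close> with \<open>q = \<chi> i (g i)\<close> of order
  \<open>NN D i\<close>. By \<open>q_freshman\<close> only the two pure powers remain, and they
  combine because \<open>1 - k\<close>, with \<open>k\<close> the power of \<open>g_i\<close>, is
  skew-primitive.\<close>

lemma comult_x_pow:
  assumes i: "i \<in> J"
  shows "comult_x i [^]\<^bsub>T\<^esub> NN D i = mu D i \<odot>\<^bsub>T\<^esub>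
    (\<one>\<^bsub>T\<^esub> \<ominus>\<^bsub>T\<^esub> pt (gr (g i [^]\<^bsub>grp D\<^esub> NN D i)) (gr (g i [^]\<^bsub>grp D\<^esub> NN D i)))"
proof -
  define n where "n = NN D i"
  define k where "k = gr (g i [^]\<^bsub>grp D\<^esub> n)"
  define m where "m = mu D i"
  let ?b = "pt (x i) (gr (g i))" and ?a = "pt \<one>\<^bsub>U\<^esub> (x i)"
  have k: "k \<in> carrier U" using i by (simp add: k_def)
  have ba: "?b \<otimes>\<^bsub>T\<^esub> ?a = \<chi> i (g i) \<odot>\<^bsub>T\<^esub> (?a \<otimes>\<^bsub>T\<^esub> ?b)"
    using i by (simp add: X.pt_mult gr_x X.pt_smult_right)
  have n2: "n \<ge> 2" using NN_ge_2[OF i] by (simp add: n_def)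
  have "comult_x i [^]\<^bsub>T\<^esub> n = (?a \<oplus>\<^bsub>T\<^esub> ?b) [^]\<^bsub>T\<^esub> n"
    using i by (simp add: comult_x_def T.a_comm)
  also have "\<dots> = ?a [^]\<^bsub>T\<^esub> n \<oplus>\<^bsub>T\<^esub> ?b [^]\<^bsub>T\<^esub> n"
  proof (rule T.q_freshman[OF _ _ ba])
    show "qint (\<chi> i (g i)) n = 0" using qint_chi[OF i] by (simp add: n_def)
    show "qint (\<chi> i (g i)) k \<noteq> 0" if "0 < k" "k < n" for k
      using qint_chi[OF i, of k] that nat_dvd_not_less[of k n] by (simp add: n_def)
  qed (use i n2 in auto)
  also have "?a [^]\<^bsub>T\<^esub> n = pt \<one>\<^bsub>U\<^esub> (m \<odot>\<^bsub>U\<^esub> (\<one>\<^bsub>U\<^esub> \<ominus>\<^bsub>U\<^esub> k))"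
    using i x_pow[OF i] by (simp add: pt_pow n_def k_def m_def)
  also have "\<dots> = m \<odot>\<^bsub>T\<^esub> (pt \<one>\<^bsub>U\<^esub> \<one>\<^bsub>U\<^esub> \<ominus>\<^bsub>T\<^esub> pt \<one>\<^bsub>U\<^esub> k)"
    using k by (simp add: X.pt_smult_right pt_minus_right)
  also have "?b [^]\<^bsub>T\<^esub> n = pt (m \<odot>\<^bsub>U\<^esub> (\<one>\<^bsub>U\<^esub> \<ominus>\<^bsub>U\<^esub> k)) k"
    using i x_pow[OF i] by (simp add: pt_pow n_def k_def m_def gr_pow)
  also have "\<dots> = m \<odot>\<^bsub>T\<^esub> (pt \<one>\<^bsub>U\<^esub> k \<ominus>\<^bsub>T\<^esub> pt k k)"
    using k by (simp add: X.pt_smult_left pt_minus_left)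
  also have "m \<odot>\<^bsub>T\<^esub> (pt \<one>\<^bsub>U\<^esub> \<one>\<^bsub>U\<^esub> \<ominus>\<^bsub>T\<^esub> pt \<one>\<^bsub>U\<^esub> k) \<oplus>\<^bsub>T\<^esub> m \<odot>\<^bsub>T\<^esub> (pt \<one>\<^bsub>U\<^esub> k \<ominus>\<^bsub>T\<^esub> pt k k)
      = m \<odot>\<^bsub>T\<^esub> ((pt \<one>\<^bsub>U\<^esub> k \<ominus>\<^bsub>T\<^esub> pt k k) \<oplus>\<^bsub>T\<^esub> (pt \<one>\<^bsub>U\<^esub> \<one>\<^bsub>U\<^esub> \<ominus>\<^bsub>T\<^esub> pt \<one>\<^bsub>U\<^esub> k))"
    using k by (subst T.a_comm) (simp_all add: T.smult_r_distr)
  also have "(pt \<one>\<^bsub>U\<^esub> k \<ominus>\<^bsub>T\<^esub> pt k k) \<oplus>\<^bsub>T\<^esub> (pt \<one>\<^bsub>U\<^esub> \<one>\<^bsub>U\<^esub> \<ominus>\<^bsub>T\<^esub> pt \<one>\<^bsub>U\<^esub> k) = \<one>\<^bsub>T\<^esub> \<ominus>\<^bsub>T\<^esub> pt k k"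
    using k by (subst T.telescope) (auto simp: X.T_one)
  finally show ?thesis by (simp add: n_def k_def m_def)
qed

lemma F_add: "add F = (+)" and F_smult: "module.smult F = pm_scale"
  by (simp_all add: FF_def)

abbreviation "\<Delta>' \<equiv> free_lift T (comult_gen D)"

lemma hom_simps:
  "p \<in> carrier F \<Longrightarrow> \<Delta>' p \<in> carrier T"
  "p \<in> carrier F \<Longrightarrow> q \<in> carrier F \<Longrightarrow>
      \<Delta>' (p \<otimes>\<^bsub>F\<^esub> q) = \<Delta>' p \<otimes>\<^bsub>T\<^esub> \<Delta>' q"
  "p \<in> carrier F \<Longrightarrow> q \<in> carrier F \<Longrightarrow>
      \<Delta>' (p \<oplus>\<^bsub>F\<^esub> q) = \<Delta>' p \<oplus>\<^bsub>T\<^esub> \<Delta>' q"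
  "p \<in> carrier F \<Longrightarrow> \<Delta>' (c \<odot>\<^bsub>F\<^esub> p) = c \<odot>\<^bsub>T\<^esub> \<Delta>' p"
  "\<Delta>' \<one>\<^bsub>F\<^esub> = \<one>\<^bsub>T\<^esub>"
  using L.free_lift_closed[unfolded F_eq, of p] L.free_lift_mult[unfolded F_eq, of p q]
    L.free_lift_add[unfolded F_eq, of p q] L.free_lift_scale[unfolded F_eq, of p c]
    L.free_lift_one[unfolded F_eq]
  by (simp_all only: F_add F_smult)

lemma hom_minus: "p \<in> carrier F \<Longrightarrow> q \<in> carrier F \<Longrightarrow>
    \<Delta>' (p \<ominus>\<^bsub>F\<^esub> q) = \<Delta>' p \<ominus>\<^bsub>T\<^esub> \<Delta>' q"
  by (simp add: a_minus_def hom_simps F.smult_minus_one[symmetric] T.smult_minus_one[symmetric])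

lemma hom_pow: "p \<in> carrier F \<Longrightarrow>
    \<Delta>' (p [^]\<^bsub>F\<^esub> (n::nat)) = \<Delta>' p [^]\<^bsub>T\<^esub> n"
  by (induction n) (simp_all add: hom_simps)

lemma hom_gen:
  "h \<in> carrier (grp D) \<Longrightarrow> \<Delta>' (fg (Inl h)) = pt (gr h) (gr h)"
  "i \<in> J \<Longrightarrow> \<Delta>' (fg (Inr i)) = comult_x i"
  using L.free_lift_gen[of "Inl h"] L.free_lift_gen[of "Inr i"] by (simp_all add: comult_x_def)

lemma hom_rel:
  assumes "r \<in> U_rels D"
  shows "\<Delta>' r = \<zero>\<^bsub>T\<^esub>"
  using assms
proof (cases rule: U_rels_cases)
  case (grp h h')
  then show ?thesis by (simp add: hom_minus hom_simps hom_gen X.pt_mult gr_mult)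
next
  case unit
  then show ?thesis by (simp add: hom_minus hom_simps hom_gen gr_one X.T_one)
next
  case (act h i)
  then show ?thesis by (simp add: hom_minus hom_simps hom_gen comult_x_act)
next
  case (swap i j)
  then show ?thesis using comult_x_swap[OF swap(1-3)] by (simp add: hom_minus hom_simps hom_gen)
next
  case (pow i)
  then show ?thesis using comult_x_pow[OF pow(1)] by (simp add: hom_minus hom_simps hom_gen hom_pow)
qed

text \<open>The kernel of the homomorphism is an ideal that contains the relations.\<close>

lemma hom_ideal:
  assumes "p \<in> U_ideal D"
  shows "\<Delta>' p = \<zero>\<^bsub>T\<^esub>"
proof -
  have hom: "ring_hom_ring F T \<Delta>'"
    by (rule ring_hom_ringI2[OF F.ring_axioms T.ring_axioms L.free_lift_hom[unfolded F_eq]])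
  have ker: "r \<in> a_kernel F T \<Delta>' \<longleftrightarrow> r \<in> carrier F \<and>
      \<Delta>' r = \<zero>\<^bsub>T\<^esub>" for r
    unfolding a_kernel_def' by blast
  have "U_rels D \<subseteq> a_kernel F T \<Delta>'"
  proof
    fix r assume "r \<in> U_rels D"
    then show "r \<in> a_kernel F T \<Delta>'" using ker hom_rel U_rels_subset by blast
  qed
  then have "U_ideal D \<subseteq> a_kernel F T \<Delta>'"
    unfolding U_ideal_def by (rule F.genideal_minimal[OF ring_hom_ring.kernel_is_ideal[OF hom]])
  then show ?thesis using assms ker by blast
qed

text \<open>As the ideal goes to zero, the image of a coset under \<open>\<Delta>'\<close> is a
  singleton; this is what the \<open>the_elem\<close> in \<open>comult\<close> relies on.\<close>

lemma comult_proj: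
  assumes p: "p \<in> carrier F"
  shows "comult D (proj p) = \<Delta>' p"
proof -
  have "\<Delta>' q = \<Delta>' p" if q: "q \<in> proj p" for q
  proof -
    obtain j where "j \<in> U_ideal D" "q = j \<oplus>\<^bsub>F\<^esub> p" using q by (auto simp: a_r_coset_def')
    then show ?thesis using p I.Icarr by (simp add: hom_simps hom_ideal)
  qed
  moreover have "p \<in> proj p" using p I.a_rcos_self by blast
  ultimately have "\<Delta>' ` proj p = {\<Delta>' p}" by blast
  then show ?thesis by (simp add: comult_def)
qed

lemma U_cases:
  assumes "a \<in> carrier U"
  obtains p where "p \<in> carrier F" "a = proj p"
  using assms unfolding U_eq by (rule I.coset_cases)

lemma comult_simps:
  "a \<in> carrier U \<Longrightarrow> comult D a \<in> carrier T"
  "a \<in> carrier U \<Longrightarrow> b \<in> carrier U \<Longrightarrow>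
      comult D (a \<otimes>\<^bsub>U\<^esub> b) = comult D a \<otimes>\<^bsub>T\<^esub> comult D b"
  "a \<in> carrier U \<Longrightarrow> b \<in> carrier U \<Longrightarrow>
      comult D (a \<oplus>\<^bsub>U\<^esub> b) = comult D a \<oplus>\<^bsub>T\<^esub> comult D b"
  "a \<in> carrier U \<Longrightarrow> comult D (c \<odot>\<^bsub>U\<^esub> a) = c \<odot>\<^bsub>T\<^esub> comult D a"
  "comult D \<one>\<^bsub>U\<^esub> = pt \<one>\<^bsub>U\<^esub> \<one>\<^bsub>U\<^esub>"
  "h \<in> carrier (grp D) \<Longrightarrow> comult D (gr h) = pt (gr h) (gr h)"
  "i \<in> J \<Longrightarrow> comult D (x i) = comult_x i"
proof -
  assume a: "a \<in> carrier U"
  then obtain p where p: "p \<in> carrier F" "a = proj p" by (rule U_cases)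
  then show "comult D a \<in> carrier T" by (simp only: comult_proj hom_simps)
  show "comult D (c \<odot>\<^bsub>U\<^esub> a) = c \<odot>\<^bsub>T\<^esub> comult D a"
    using p F.smult_closed[OF p(1), of c] by (simp only: proj_simps(4)[symmetric] comult_proj hom_simps)
  assume "b \<in> carrier U"
  then obtain q where q: "q \<in> carrier F" "b = proj q" by (rule U_cases)
  show "comult D (a \<otimes>\<^bsub>U\<^esub> b) = comult D a \<otimes>\<^bsub>T\<^esub> comult D b"
    using p q F.m_closed[OF p(1) q(1)] by (simp only: proj_simps(2)[symmetric] comult_proj hom_simps)
  show "comult D (a \<oplus>\<^bsub>U\<^esub> b) = comult D a \<oplus>\<^bsub>T\<^esub> comult D b"
    using p q F.a_closed[OF p(1) q(1)] by (simp only: proj_simps(3)[symmetric] comult_proj hom_simps)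
next
  show "comult D \<one>\<^bsub>U\<^esub> = pt \<one>\<^bsub>U\<^esub> \<one>\<^bsub>U\<^esub>"
    by (simp only: proj_simps(5)[symmetric] comult_proj[OF F.one_closed] hom_simps(5))
      (simp only: X.T_one proj_simps(5))
  show "h \<in> carrier (grp D) \<Longrightarrow> comult D (gr h) = pt (gr h) (gr h)"
    by (subst gr_eq) (simp only: comult_proj fg_closed hom_gen)
  show "i \<in> J \<Longrightarrow> comult D (x i) = comult_x i"
    by (subst x_eq) (simp only: comult_proj fg_closed hom_gen)
qed

end

lemma (in tensor) tensor_lift_cong:
  assumes "vector_space s" "bilinear_on s \<beta>" "bilinear_on s \<beta>'" "t \<in> carrier T"
    and "\<And>a b. a \<in> carrier M \<Longrightarrow> b \<in> carrier N \<Longrightarrow> \<beta> a b = \<beta>' a b"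
  shows "tensor_lift s \<beta> t = tensor_lift s \<beta>' t"
  using assms(4)
  by (rule T_linear_induct[OF assms(1)])
    (simp_all add: tensor_lift_zero tensor_lift_pt tensor_lift_add tensor_lift_smult assms)

lemma (in tensor) bilinear_on_linear:
  assumes "bilinear_on s \<beta>" "\<And>u v. L (u + v) = L u + L v" "\<And>c v. L (s c v) = s c (L v)"
  shows "bilinear_on s (\<lambda>a b. L (\<beta> a b))"
  using assms by (simp add: bilinear_on_def)

context hopf_datum
begin

text \<open>The algebra \<open>U\<close>, whose elements are cosets, is transported along a linear section \<open>\<tau>\<close> into the
  type of formal linear combinations, where the type-based linear algebra is available.\<close>

context
  fixes \<sigma> :: "((('g + nat) list \<Rightarrow>\<^sub>0 'k) set \<Rightarrow>\<^sub>0 'k) \<Rightarrow> (('g + nat) list \<Rightarrow>\<^sub>0 'k) set"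
    and \<tau> :: "(('g + nat) list \<Rightarrow>\<^sub>0 'k) set \<Rightarrow> ((('g + nat) list \<Rightarrow>\<^sub>0 'k) set \<Rightarrow>\<^sub>0 'k)"
  assumes \<sigma>_closed [simp]: "\<And>p. \<sigma> p \<in> carrier U"
    and \<sigma>_add: "\<And>p q. \<sigma> (p + q) = \<sigma> p \<oplus>\<^bsub>U\<^esub> \<sigma> q"
    and \<sigma>_scale: "\<And>c p. \<sigma> (pm_scale c p) = c \<odot>\<^bsub>U\<^esub> \<sigma> p"
    and \<sigma>_\<tau> [simp]: "\<And>a. a \<in> carrier U \<Longrightarrow> \<sigma> (\<tau> a) = a"
    and \<tau>_add: "\<And>a b. a \<in> carrier U \<Longrightarrow> b \<in> carrier U \<Longrightarrow>
        \<tau> (a \<oplus>\<^bsub>U\<^esub> b) = \<tau> a + \<tau> b"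
    and \<tau>_scale: "\<And>c a. a \<in> carrier U \<Longrightarrow>
        \<tau> (c \<odot>\<^bsub>U\<^esub> a) = pm_scale c (\<tau> a)"
begin

definition "star v w = \<tau> (\<sigma> v \<otimes>\<^bsub>U\<^esub> \<sigma> w)"

text \<open>The operator \<open>(id \<otimes> f) \<Delta>\<close>, carried over by
  \<open>\<sigma>\<close> and \<open>\<tau>\<close>.\<close>

definition "slice f v = X.tensor_lift pm_scale (\<lambda>a b. pm_scale (f (\<tau> b)) (\<tau> a)) (comult D (\<sigma> v))"

lemma star_\<tau>: "a \<in> carrier U \<Longrightarrow> b \<in> carrier U \<Longrightarrow>
    star (\<tau> a) (\<tau> b) = \<tau> (a \<otimes>\<^bsub>U\<^esub> b)"
  by (simp add: star_def)

lemma \<tau>_minus: "a \<in> carrier U \<Longrightarrow> b \<in> carrier U \<Longrightarrow>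
    \<tau> (a \<ominus>\<^bsub>U\<^esub> b) = \<tau> a - \<tau> b"
  by (simp add: a_minus_def U.smult_minus_one[symmetric] \<tau>_add \<tau>_scale pm.scale_minus_left)

lemma star_simps:
  "star (u + v) w = star u w + star v w" "star u (v + w) = star u v + star u w"
  "star (pm_scale c u) v = pm_scale c (star u v)" "star u (pm_scale c v) = pm_scale c (star u v)"
  "star (star u v) w = star u (star v w)"
  by (simp_all add: star_def \<sigma>_add \<sigma>_scale \<tau>_add \<tau>_scale U.l_distr U.r_distr U.smult_mult_left
      U.smult_mult_right U.m_assoc)

lemma bilinear_slice:
  assumes "linear_functional pm_scale f"
  shows "X.bilinear_on pm_scale (\<lambda>a b. pm_scale (f (\<tau> b)) (\<tau> a))"
  using assms unfolding X.bilinear_on_def linear_functional_def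
  by (simp add: \<tau>_add \<tau>_scale pm.scale_right_distrib pm.scale_left_distrib mult.commute)

lemma linear_functional_star: "linear_functional pm_scale f \<Longrightarrow>
    linear_functional pm_scale (\<lambda>v. f (star u v))"
  by (simp add: linear_functional_def star_simps)

lemma slice_add: "linear_functional pm_scale f \<Longrightarrow> slice f (v + w) = slice f v + slice f w"
  by (simp add: slice_def \<sigma>_add comult_simps X.tensor_lift_add[OF vector_space_pm_scale] bilinear_slice)

lemma slice_scale: "linear_functional pm_scale f \<Longrightarrow> slice f (pm_scale c v) = pm_scale c (slice f v)"
  by (simp add: slice_def \<sigma>_scale comult_simps X.tensor_lift_smult[OF vector_space_pm_scale] bilinear_slice)

lemma slice_one: "linear_functional pm_scale f \<Longrightarrow>
    slice f (\<tau> \<one>\<^bsub>U\<^esub>) = pm_scale (f (\<tau> \<one>\<^bsub>U\<^esub>)) (\<tau> \<one>\<^bsub>U\<^esub>)"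
  by (simp add: slice_def comult_simps X.tensor_lift_pt[OF vector_space_pm_scale] bilinear_slice)

text \<open>The rule that \<open>id \<otimes> f\<close> applied to \<open>(a \<otimes> b) t\<close>
  is \<open>a\<close> times \<open>id \<otimes> f(b _)\<close> applied to \<open>t\<close>. With the
  coproducts of the generators it yields the recursion rules \<open>D_g\<close> and
  \<open>D_x\<close>.\<close>

lemma tensor_lift_slice_mult:
  assumes f: "linear_functional pm_scale f" and ab: "a \<in> carrier U" "b \<in> carrier U" and v: "t \<in> carrier T"
  shows "X.tensor_lift pm_scale (\<lambda>a b. pm_scale (f (\<tau> b)) (\<tau> a)) (pt a b \<otimes>\<^bsub>T\<^esub> t) =
    star (\<tau> a) (X.tensor_lift pm_scale (\<lambda>c d. pm_scale (f (star (\<tau> b) (\<tau> d))) (\<tau> c)) t)"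
proof -
  note vs = vector_space_pm_scale
  let ?\<beta> = "\<lambda>a b. pm_scale (f (\<tau> b)) (\<tau> a)"
  let ?\<gamma> = "\<lambda>c d. pm_scale (f (star (\<tau> b) (\<tau> d))) (\<tau> c)"
  have \<gamma>: "X.bilinear_on pm_scale ?\<gamma>"
    using bilinear_slice[OF linear_functional_star[OF f]] .
  have \<gamma>': "X.bilinear_on pm_scale (\<lambda>c d. star (\<tau> a) (?\<gamma> c d))"
    by (rule X.bilinear_on_linear[where L = "star (\<tau> a)", OF \<gamma> star_simps(2,4)])
  have "X.tensor_lift pm_scale ?\<beta> (pt a b \<otimes>\<^bsub>T\<^esub> t) =
      X.tensor_lift pm_scale (\<lambda>c d. ?\<beta> (a \<otimes>\<^bsub>U\<^esub> c) (b \<otimes>\<^bsub>U\<^esub> d)) t"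
    by (rule X.tensor_lift_pt_mult[OF vs bilinear_slice[OF f] ab v])
  also have "\<dots> = X.tensor_lift pm_scale (\<lambda>c d. star (\<tau> a) (?\<gamma> c d)) t"
    using ab
    by (intro X.tensor_lift_cong[OF vs X.bilinear_on_mult[OF vs bilinear_slice[OF f] ab] \<gamma>' v])
      (simp add: star_simps star_\<tau>)
  also have "\<dots> = star (\<tau> a) (X.tensor_lift pm_scale ?\<gamma> t)"
    by (rule X.tensor_lift_linear[where L = "star (\<tau> a)", OF vs \<gamma> v star_simps(2,4)])
  finally show ?thesis .
qed

lemma \<sigma>_star: "a \<in> carrier U \<Longrightarrow>
    \<sigma> (star (\<tau> a) v) = a \<otimes>\<^bsub>U\<^esub> \<sigma> v"
  by (simp add: star_def)

lemma slice_grp: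
  assumes "linear_functional pm_scale f" "h \<in> carrier (grp D)"
  shows "slice f (star (\<tau> (gr h)) v) = star (\<tau> (gr h)) (slice (\<lambda>w. f (star (\<tau> (gr h)) w)) v)"
proof -
  have t: "comult D (\<sigma> v) \<in> carrier T" by (rule comult_simps(1)[OF \<sigma>_closed])
  have c: "gr h \<in> carrier U" using assms by simp
  have "comult D (\<sigma> (star (\<tau> (gr h)) v)) = pt (gr h) (gr h) \<otimes>\<^bsub>T\<^esub> comult D (\<sigma> v)"
    using assms(2) c by (simp only: \<sigma>_star comult_simps(2,6) \<sigma>_closed)
  then show ?thesis
    unfolding slice_def using tensor_lift_slice_mult[OF assms(1) c c t] by (simp only:)
qed

lemma slice_x:
  assumes "linear_functional pm_scale f" "i \<in> J"
  shows "slice f (star (\<tau> (x i)) v) = star (\<tau> (x i)) (slice (\<lambda>w. f (star (\<tau> (gr (g i))) w)) v) +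
    slice (\<lambda>w. f (star (\<tau> (x i)) w)) v"
proof -
  have t: "comult D (\<sigma> v) \<in> carrier T" by (rule comult_simps(1)[OF \<sigma>_closed])
  have c: "gr (g i) \<in> carrier U" "x i \<in> carrier U" using assms by simp_all
  let ?L = "X.tensor_lift pm_scale (\<lambda>a b. pm_scale (f (\<tau> b)) (\<tau> a))"
  have "comult D (\<sigma> (star (\<tau> (x i)) v)) = comult_x i \<otimes>\<^bsub>T\<^esub> comult D (\<sigma> v)"
    using assms(2) c by (simp only: \<sigma>_star comult_simps(2,7) \<sigma>_closed)
  also have "\<dots> = pt (x i) (gr (g i)) \<otimes>\<^bsub>T\<^esub> comult D (\<sigma> v) \<oplus>\<^bsub>T\<^esub> pt \<one>\<^bsub>U\<^esub> (x i) \<otimes>\<^bsub>T\<^esub> comult D (\<sigma> v)"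
    unfolding comult_x_def by (intro T.l_distr X.pt_closed U.one_closed c t)
  finally have "slice f (star (\<tau> (x i)) v) = ?L (pt (x i) (gr (g i)) \<otimes>\<^bsub>T\<^esub> comult D (\<sigma> v)) +
      ?L (pt \<one>\<^bsub>U\<^esub> (x i) \<otimes>\<^bsub>T\<^esub> comult D (\<sigma> v))"
    using c t unfolding slice_def
    by (simp only: X.tensor_lift_add[OF vector_space_pm_scale bilinear_slice[OF assms(1)]]
        T.m_closed X.pt_closed U.one_closed)
  also have "?L (pt \<one>\<^bsub>U\<^esub> (x i) \<otimes>\<^bsub>T\<^esub> comult D (\<sigma> v)) =
      star (\<tau> \<one>\<^bsub>U\<^esub>) (slice (\<lambda>w. f (star (\<tau> (x i)) w)) v)"
    unfolding slice_def by (rule tensor_lift_slice_mult[OF assms(1) U.one_closed c(2) t])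
  also have "\<dots> = slice (\<lambda>w. f (star (\<tau> (x i)) w)) v"
  proof -
    let ?\<beta> = "\<lambda>a b. pm_scale (f (star (\<tau> (x i)) (\<tau> b))) (\<tau> a)"
    have \<beta>: "X.bilinear_on pm_scale ?\<beta>" by (rule bilinear_slice[OF linear_functional_star[OF assms(1)]])
    have \<beta>': "X.bilinear_on pm_scale (\<lambda>a b. star (\<tau> \<one>\<^bsub>U\<^esub>) (?\<beta> a b))"
      by (rule X.bilinear_on_linear[where L = "star (\<tau> \<one>\<^bsub>U\<^esub>)", OF \<beta> star_simps(2,4)])
    have "star (\<tau> \<one>\<^bsub>U\<^esub>) (X.tensor_lift pm_scale ?\<beta> (comult D (\<sigma> v))) =
        X.tensor_lift pm_scale (\<lambda>a b. star (\<tau> \<one>\<^bsub>U\<^esub>) (?\<beta> a b)) (comult D (\<sigma> v))"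
      by (rule X.tensor_lift_linear[where L = "star (\<tau> \<one>\<^bsub>U\<^esub>)", symmetric,
            OF vector_space_pm_scale \<beta> t star_simps(2,4)])
    also have "\<dots> = X.tensor_lift pm_scale ?\<beta> (comult D (\<sigma> v))"
      by (rule X.tensor_lift_cong[OF vector_space_pm_scale \<beta>' \<beta> t]) (simp add: star_simps star_\<tau>)
    finally show ?thesis unfolding slice_def .
  qed
  also have "?L (pt (x i) (gr (g i)) \<otimes>\<^bsub>T\<^esub> comult D (\<sigma> v)) =
      star (\<tau> (x i)) (slice (\<lambda>w. f (star (\<tau> (gr (g i))) w)) v)"
    unfolding slice_def by (rule tensor_lift_slice_mult[OF assms(1) c(2,1) t])
  finally show ?thesis .
qed

section \<open>Verification of the abstract setting for \<open>U\<close>\<close>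

lemma x_gr: "h \<in> carrier (grp D) \<Longrightarrow> i \<in> J \<Longrightarrow>
    x i \<otimes>\<^bsub>U\<^esub> gr h = inverse (\<chi> i h) \<odot>\<^bsub>U\<^esub> (gr h \<otimes>\<^bsub>U\<^esub> x i)"
  using chi_nonzero[of i h] by (simp add: gr_x U.smult_assoc)

abbreviation "GG \<equiv> (\<lambda>h. \<tau> (gr h)) ` carrier (grp D)"

lemma star_x_swap:
  assumes "i \<in> J" "j \<in> J" "i < j"
  shows "star (\<tau> (x j)) (\<tau> (x i)) - pm_scale (\<chi> i (g j)) (star (\<tau> (x i)) (\<tau> (x j))) \<in> pm.span GG"
proof -
  have k: "gr (g i \<otimes>\<^bsub>grp D\<^esub> g j) \<in> carrier U" using assms by simp
  have "star (\<tau> (x j)) (\<tau> (x i)) - pm_scale (\<chi> i (g j)) (star (\<tau> (x i)) (\<tau> (x j))) =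
      pm_scale (lam D i j) (\<tau> \<one>\<^bsub>U\<^esub> - \<tau> (gr (g i \<otimes>\<^bsub>grp D\<^esub> g j)))"
    using assms k by (simp add: star_\<tau> x_x \<tau>_add \<tau>_scale \<tau>_minus)
  moreover have "\<tau> \<one>\<^bsub>U\<^esub> \<in> GG"
      by (rule image_eqI[of _ _ "\<one>\<^bsub>grp D\<^esub>"]) (simp_all add: gr_one)
  moreover have "\<tau> (gr (g i \<otimes>\<^bsub>grp D\<^esub> g j)) \<in> GG" using assms by (intro imageI) simp
  ultimately show ?thesis by (simp add: pm.span_scale pm.span_diff pm.span_base)
qed

lemma star_x_pow:
  assumes "i \<in> J"
  shows "((\<lambda>v. star (\<tau> (x i)) v) ^^ n) (\<tau> \<one>\<^bsub>U\<^esub>) = \<tau> (x i [^]\<^bsub>U\<^esub> n)"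
proof (induction n)
  case (Suc n)
  have "star (\<tau> (x i)) (\<tau> (x i [^]\<^bsub>U\<^esub> n)) = \<tau> (x i [^]\<^bsub>U\<^esub> Suc n)"
    using assms by (simp only: star_\<tau> x_closed U.nat_pow_closed U.nat_pow_Suc2)
  then show ?case by (simp only: funpow.simps comp_apply Suc)
qed simp

text \<open>\<open>U\<close> is spanned by words in the generators, and a word arises from the unit
  by left multiplications.\<close>

lemma U_induct:
  assumes W: "pm.subspace W" and e: "\<tau> \<one>\<^bsub>U\<^esub> \<in> W"
    and gr: "\<And>h v. h \<in> carrier (grp D) \<Longrightarrow> v \<in> W \<Longrightarrow> star (\<tau> (gr h)) v \<in> W"
    and x: "\<And>i v. i \<in> J \<Longrightarrow> v \<in> W \<Longrightarrow> star (\<tau> (x i)) v \<in> W"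
    and a: "a \<in> carrier U"
  shows "\<tau> a \<in> W"
proof -
  obtain p where p: "p \<in> carrier F" "a = proj p" using a by (rule U_cases)
  have sg: "Poly_Mapping.single w 1 \<in> carrier F" if "w \<in> lists S" for w
    using that by (simp add: FF_def)
  have word: "\<tau> (proj (Poly_Mapping.single w 1)) \<in> W" if "w \<in> lists S" for w
    using that
  proof (induction w)
    case Nil
    have "\<one>\<^bsub>F\<^esub> = Poly_Mapping.single [] 1" by (simp add: FF_def)
    then show ?case using e proj_simps(5) by simp
  next
    case (Cons l w)
    have w: "w \<in> lists S" and l: "l \<in> S" using Cons.hyps by auto
    have fl: "fg l \<in> carrier F" using l by auto
    have "Poly_Mapping.single (l # w) 1 = fg l \<otimes>\<^bsub>F\<^esub> Poly_Mapping.single w 1"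
      by (simp add: FF_def free_gen_def)
    then have "\<tau> (proj (Poly_Mapping.single (l # w) 1)) =
        star (\<tau> (proj (fg l))) (\<tau> (proj (Poly_Mapping.single w 1)))"
      using fl sg[OF w] by (simp only: proj_simps(1,2) star_\<tau>)
    moreover have "star (\<tau> (proj (fg l))) (\<tau> (proj (Poly_Mapping.single w 1))) \<in> W"
      using l gr[OF _ Cons.IH] x[OF _ Cons.IH] by (auto simp: gr_eq x_eq)
    ultimately show ?case by (simp only:)
  qed
  have FK: "q \<in> carrier F \<longleftrightarrow> Poly_Mapping.keys q \<subseteq> lists S" for q by (simp add: FF_def)
  have "Poly_Mapping.keys p \<subseteq> lists S" using p(1) FK by blast
  then have "\<tau> (proj p) \<in> W"
  proof (induction rule: pm_linear_induct)
    case zero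
    have "proj (0 \<odot>\<^bsub>F\<^esub> \<one>\<^bsub>F\<^esub>) = 0 \<odot>\<^bsub>U\<^esub> \<one>\<^bsub>U\<^esub>" by (simp only: proj_simps F.one_closed)
    moreover have "0 \<odot>\<^bsub>F\<^esub> \<one>\<^bsub>F\<^esub> = 0" by (simp add: FF_def)
    moreover have "\<tau> (0 \<odot>\<^bsub>U\<^esub> \<one>\<^bsub>U\<^esub>) = 0"
        using \<tau>_scale[OF U.one_closed, of 0] by simp
    ultimately show ?case using pm.subspace_0[OF W] by simp
  next
    case (single w)
    then show ?case by (rule word)
  next
    case (add p q)
    have "proj (p + q) = proj p \<oplus>\<^bsub>U\<^esub> proj q"
      using proj_simps(3)[of p q] add(1,2) unfolding FK F_add by blast
    then show ?case
      using add pm.subspace_add[OF W] proj_simps(1) \<tau>_add unfolding FK[symmetric] by metis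
  next
    case (scale c p)
    have "proj (pm_scale c p) = c \<odot>\<^bsub>U\<^esub> proj p"
      using proj_simps(4)[of p c] scale(1) unfolding FK F_smult by blast
    then show ?case
      using scale pm.subspace_scale[OF W] proj_simps(1) \<tau>_scale unfolding FK[symmetric] by metis
  qed
  then show ?thesis using p by simp
qed


text \<open>A vanishing geometric sum of \<open>m\<close> terms would make the \<open>m\<close>-th
  power of \<open>inverse q\<close> equal to 1, hence also that of \<open>q\<close>, whose order is
  \<open>NN D i\<close>.\<close>

lemma inverse_chi_sum:
  assumes "i \<in> J" "0 < m" "m < NN D i"
  shows "(\<Sum>a<m. inverse (\<chi> i (g i)) ^ a) \<noteq> 0"
proof
  let ?q = "\<chi> i (g i)"
  assume "(\<Sum>a<m. inverse ?q ^ a) = 0"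
  then have "inverse ?q ^ m = 1"
    using power_diff_1_eq[of "inverse ?q" m] by simp
  then have "?q ^ m = 1" by (simp add: power_inverse)
  then have "NN D i dvd m" using NN_pow[OF assms(1)] by blast
  then show False using assms(2,3) nat_dvd_not_less by blast
qed

text \<open>The scalar \<open>comm j i\<close> becomes the inverse of \<open>\<chi> j (g i)\<close>,
  since by \<open>x_gr\<close> this is the cost of moving \<open>x j\<close> to the right of a group
  element. So the q-integers of the abstract part are taken at the inverse of
  \<open>\<chi> i (g i)\<close>.\<close>

lemma coideal_setting_U:
  "coideal_setting pm_scale star (\<tau> \<one>\<^bsub>U\<^esub>) GG J (\<lambda>i. \<tau> (x i)) (\<lambda>i. \<tau> (gr (g i))) (NN D)
    (\<lambda>j i. inverse (\<chi> j (g i))) slice (\<tau> ` carrier U)"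
proof (intro coideal_setting.intro[OF vector_space_pm_scale] coideal_setting_axioms.intro)
  show "finite GG" using finite_G by simp
  show e: "\<tau> \<one>\<^bsub>U\<^esub> \<in> GG"
      by (rule image_eqI[of _ _ "\<one>\<^bsub>grp D\<^esub>"]) (simp_all add: gr_one)
  show "star u v \<in> GG" if "u \<in> GG" "v \<in> GG" for u v
    using that by (auto simp: star_\<tau> gr_mult)
  show "\<exists>v\<in>GG. star v u = \<tau> \<one>\<^bsub>U\<^esub> \<and>
      star u v = \<tau> \<one>\<^bsub>U\<^esub>" if u: "u \<in> GG" for u
  proof -
    obtain h where h: "h \<in> carrier (grp D)" "u = \<tau> (gr h)" using u by blast
    have "star (\<tau> (gr (inv\<^bsub>grp D\<^esub> h))) u = \<tau> \<one>\<^bsub>U\<^esub> \<and>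
        star u (\<tau> (gr (inv\<^bsub>grp D\<^esub> h))) = \<tau> \<one>\<^bsub>U\<^esub>"
      using h by (simp add: star_\<tau> gr_mult gr_one)
    moreover have "\<tau> (gr (inv\<^bsub>grp D\<^esub> h)) \<in> GG" using h by (intro imageI) simp
    ultimately show ?thesis by (rule bexI)
  qed
  show "\<exists>c. star (\<tau> (x i)) u = pm_scale c (star u (\<tau> (x i)))" if i: "i \<in> J" and u: "u \<in> GG" for i u
  proof -
    obtain h where h: "h \<in> carrier (grp D)" "u = \<tau> (gr h)" using u by blast
    show ?thesis
      using h x_gr[OF h(1) i] x_closed[OF i] gr_closed[OF h(1)]
      by (intro exI[of _ "inverse (\<chi> i h)"]) (simp only: star_\<tau> \<tau>_scale U.m_closed)
  qed
  show "star (\<tau> (x j)) (\<tau> (gr (g i))) = pm_scale (inverse (\<chi> j (g i))) (star (\<tau> (gr (g i))) (\<tau> (x j)))"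
    if "i \<in> J" "j \<in> J" for i j
    using x_gr[OF g_closed[OF that(1)] that(2)] x_closed[OF that(2)] gr_closed[OF g_closed[OF that(1)]]
    by (simp only: star_\<tau> \<tau>_scale U.m_closed)
  show "inverse (\<chi> j (g i)) \<noteq> 0" if "i \<in> J" "j \<in> J" for i j
    using chi_nonzero[OF that(2) g_closed[OF that(1)]] by simp
  show "(\<Sum>a<m. inverse (\<chi> i (g i)) ^ a) \<noteq> 0" if "i \<in> J" "0 < m" "m < NN D i" for i m
    using inverse_chi_sum that by blast
  show "\<exists>c. star (\<tau> (x j)) (\<tau> (x i)) - pm_scale c (star (\<tau> (x i)) (\<tau> (x j))) \<in> pm.span GG"
    if ij: "i \<in> J" "j \<in> J" "i \<noteq> j" for i j
  proof (cases "i < j")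
    case True
    then show ?thesis using star_x_swap ij by blast
  next
    case False
    \<comment> \<open>The relation is given for one order of the indices only; the other order is
      obtained by solving it.\<close>
    let ?c = "\<chi> j (g i)" and ?ij = "star (\<tau> (x i)) (\<tau> (x j))" and ?ji = "star (\<tau> (x j)) (\<tau> (x i))"
    have c: "?c \<noteq> 0" using chi_nonzero[OF ij(2) g_closed[OF ij(1)]] .
    have "?ij - pm_scale ?c ?ji \<in> pm.span GG" using star_x_swap[of j i] False ij by simp
    then have "pm_scale (- inverse ?c) (?ij - pm_scale ?c ?ji) \<in> pm.span GG" by (rule pm.span_scale)
    also have "pm_scale (- inverse ?c) (?ij - pm_scale ?c ?ji) = ?ji - pm_scale (inverse ?c) ?ij"
      using c by (simp add: pm.scale_right_diff_distrib)
    finally show ?thesis by blast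
  qed
  show "((\<lambda>a. star (\<tau> (x i)) a) ^^ NN D i) (\<tau> \<one>\<^bsub>U\<^esub>) \<in> pm.span GG"
      if i: "i \<in> J" for i
  proof -
    have k: "gr (g i [^]\<^bsub>grp D\<^esub> NN D i) \<in> carrier U" using i by simp
    have "((\<lambda>a. star (\<tau> (x i)) a) ^^ NN D i) (\<tau> \<one>\<^bsub>U\<^esub>) =
        pm_scale (mu D i) (\<tau> \<one>\<^bsub>U\<^esub> - \<tau> (gr (g i [^]\<^bsub>grp D\<^esub> NN D i)))"
      using k by (simp only: star_x_pow[OF i] x_pow[OF i] \<tau>_scale \<tau>_minus U.minus_closed U.one_closed)
    moreover have "\<tau> (gr (g i [^]\<^bsub>grp D\<^esub> NN D i)) \<in> GG" using i by (intro imageI) simp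
    ultimately show ?thesis using e by (simp add: pm.span_scale pm.span_diff pm.span_base)
  qed
  show "slice f (v + w) = slice f v + slice f w" if "linear_functional pm_scale f" for f v w
    using that by (rule slice_add)
  show "slice f (pm_scale c v) = pm_scale c (slice f v)" if "linear_functional pm_scale f" for f c v
    using that by (rule slice_scale)
  show "slice f (\<tau> \<one>\<^bsub>U\<^esub>) = pm_scale (f (\<tau> \<one>\<^bsub>U\<^esub>)) (\<tau> \<one>\<^bsub>U\<^esub>)" if "linear_functional pm_scale f" for f
    using that by (rule slice_one)
  show "slice f (star u v) = star u (slice (\<lambda>b. f (star u b)) v)"
    if "linear_functional pm_scale f" "u \<in> GG" for f u v
    using that slice_grp by blast
  show "slice f (star (\<tau> (x i)) v) = star (\<tau> (x i)) (slice (\<lambda>b. f (star (\<tau> (gr (g i))) b)) v) +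
      slice (\<lambda>b. f (star (\<tau> (x i)) b)) v" if "linear_functional pm_scale f" "i \<in> J" for f i v
    using that by (rule slice_x)
  show "v \<in> W" if "pm.subspace W" "\<tau> \<one>\<^bsub>U\<^esub> \<in> W"
    "\<And>u v. u \<in> GG \<Longrightarrow> v \<in> W \<Longrightarrow> star u v \<in> W" "\<And>i v. i \<in> J \<Longrightarrow>
        v \<in> W \<Longrightarrow> star (\<tau> (x i)) v \<in> W"
    "v \<in> \<tau> ` carrier U" for W v
    using U_induct[OF that(1,2)] that(3-5) by blast
  show "star (\<tau> \<one>\<^bsub>U\<^esub>) u = u" if "u \<in> GG" for u
    using that by (elim imageE) (simp only: star_\<tau> U.one_closed gr_closed U.l_one)
  show "star u (\<tau> \<one>\<^bsub>U\<^esub>) = u" if "u \<in> GG" for u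
    using that by (elim imageE) (simp only: star_\<tau> U.one_closed gr_closed U.r_one)
qed (simp_all add: star_simps star_\<tau> NN_ge_2)

section \<open>Transport of subspaces and subalgebras\<close>

lemma subspace_image:
  assumes W: "submodule W (KK :: 'k ring) U"
  shows "pm.subspace (\<tau> ` W)"
proof (rule pm.subspaceI)
  have W': "W \<subseteq> carrier U" "\<zero>\<^bsub>U\<^esub> \<in> W" "\<And>a b. a \<in> W \<Longrightarrow>
      b \<in> W \<Longrightarrow> a \<oplus>\<^bsub>U\<^esub> b \<in> W"
    "\<And>c a. a \<in> W \<Longrightarrow> c \<odot>\<^bsub>U\<^esub> a \<in> W"
    using W unfolding U.submodule_iff by blast+
  have "\<tau> \<zero>\<^bsub>U\<^esub> = 0" using \<tau>_scale[OF U.one_closed, of 0] by simp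
  then show "0 \<in> \<tau> ` W" using W'(2) by (metis imageI)
  show "u + v \<in> \<tau> ` W" if uv: "u \<in> \<tau> ` W" "v \<in> \<tau> ` W" for u v
  proof -
    obtain a b where "u = \<tau> a" "v = \<tau> b" "a \<in> W" "b \<in> W" using uv by blast
    then show ?thesis using W' \<tau>_add[of a b]
      by (intro image_eqI[of _ _ "a \<oplus>\<^bsub>U\<^esub> b"]) (auto simp: subset_iff)
  qed
  show "pm_scale c v \<in> \<tau> ` W" if v: "v \<in> \<tau> ` W" for c v
  proof -
    obtain a where "v = \<tau> a" "a \<in> W" using v by blast
    then show ?thesis using W' \<tau>_scale[of a c]
      by (intro image_eqI[of _ _ "c \<odot>\<^bsub>U\<^esub> a"]) (auto simp: subset_iff)
  qed
qed

text \<open>\<open>id \<otimes> f\<close> sends \<open>v \<otimes> w\<close> to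
  \<open>f(w) v\<close>, so it carries \<open>A \<otimes> U\<close> into \<open>A\<close>. In this
  way the coideal condition becomes stability under the operators.\<close>

lemma tensor_subspace_slice:
  assumes A: "is_subalgebra A U" and f: "linear_functional pm_scale f"
    and t: "t \<in> tensor_subspace U U A (carrier U)"
  shows "X.tensor_lift pm_scale (\<lambda>a b. pm_scale (f (\<tau> b)) (\<tau> a)) t \<in> \<tau> ` A"
proof -
  note vs = vector_space_pm_scale
  let ?L = "X.tensor_lift pm_scale (\<lambda>a b. pm_scale (f (\<tau> b)) (\<tau> a))"
  have A': "A \<subseteq> carrier U" "submodule A (KK :: 'k ring) U"
    using A unfolding is_subalgebra_def U.submodule_iff by blast+
  note add = pm.subspace_add[OF subspace_image[OF A'(2)]]
    and scale = pm.subspace_scale[OF subspace_image[OF A'(2)]]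
    and zero = pm.subspace_0[OF subspace_image[OF A'(2)]]
  note lin = X.tensor_lift_add[OF vs bilinear_slice[OF f]] X.tensor_lift_smult[OF vs bilinear_slice[OF f]]
    X.tensor_lift_zero[OF vs bilinear_slice[OF f]] X.tensor_lift_pt[OF vs bilinear_slice[OF f]]
  have "submodule {t \<in> carrier T. ?L t \<in> \<tau> ` A} (KK :: 'k ring) T"
    unfolding T.submodule_iff using add scale zero by (simp add: lin)
  moreover have "{pt v w | v w. v \<in> A \<and> w \<in> carrier U} \<subseteq> {t \<in> carrier T. ?L t \<in> \<tau> ` A}"
  proof
    fix t assume "t \<in> {pt v w | v w. v \<in> A \<and> w \<in> carrier U}"
    then obtain v w where t: "t = pt v w" "v \<in> A" "v \<in> carrier U" "w \<in> carrier U" using A'(1) by blast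
    have "?L t = pm_scale (f (\<tau> w)) (\<tau> v)" unfolding t(1) by (rule lin(4)[OF t(3,4)])
    then show "t \<in> {t \<in> carrier T. ?L t \<in> \<tau> ` A}"
      using t(2) scale[of "\<tau> v" "f (\<tau> w)"] X.pt_closed[OF t(3,4)] t(1) by simp
  qed
  ultimately have "tensor_subspace U U A (carrier U) \<subseteq> {t \<in> carrier T. ?L t \<in> \<tau> ` A}"
    unfolding tensor_subspace_def by (rule T.lin_span_minimal)
  then show ?thesis using t by blast
qed

lemma subalgebra_image:
  assumes A: "is_subalgebra A U"
  shows "pm.subspace (\<tau> ` A)" "\<tau> \<one>\<^bsub>U\<^esub> \<in> \<tau> ` A" "u \<in> \<tau> ` A \<Longrightarrow>
      v \<in> \<tau> ` A \<Longrightarrow> star u v \<in> \<tau> ` A"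
proof -
  have A': "A \<subseteq> carrier U" "\<one>\<^bsub>U\<^esub> \<in> A" "\<And>a b. a \<in> A \<Longrightarrow>
      b \<in> A \<Longrightarrow> a \<oplus>\<^bsub>U\<^esub> b \<in> A"
    "\<And>c a. a \<in> A \<Longrightarrow> c \<odot>\<^bsub>U\<^esub> a \<in> A" "\<And>a b. a \<in> A \<Longrightarrow>
        b \<in> A \<Longrightarrow> a \<otimes>\<^bsub>U\<^esub> b \<in> A"
    using A unfolding U.is_subalgebra_iff by blast+
  show "pm.subspace (\<tau> ` A)"
    using A by (intro subspace_image) (simp add: is_subalgebra_def)
  show "\<tau> \<one>\<^bsub>U\<^esub> \<in> \<tau> ` A" using A' by blast
  assume "u \<in> \<tau> ` A" "v \<in> \<tau> ` A"
  then obtain a b where "u = \<tau> a" "v = \<tau> b" "a \<in> A" "b \<in> A" by blast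
  then show "star u v \<in> \<tau> ` A" using A' star_\<tau>[of a b]
      by (intro image_eqI[of _ _ "a \<otimes>\<^bsub>U\<^esub> b"]) (auto simp: subset_iff)
qed

abbreviation "deg1 \<equiv> {gr h | h. h \<in> carrier (grp D)} \<union>
    {gr h \<otimes>\<^bsub>U\<^esub> x i | h i. h \<in> carrier (grp D) \<and> i \<in> J}"

lemma span_subset_lin_span:
  "pm.span (GG \<union> {star u (\<tau> (x i)) | u i. u \<in> GG \<and> i \<in> J}) \<subseteq> \<tau> ` lin_span U deg1"
proof (rule pm.span_minimal)
  have "deg1 \<subseteq> carrier U" by auto
  then show "pm.subspace (\<tau> ` lin_span U deg1)"
    by (intro subspace_image U.submodule_lin_span)
  show "GG \<union> {star u (\<tau> (x i)) | u i. u \<in> GG \<and> i \<in> J} \<subseteq> \<tau> ` lin_span U deg1"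
  proof
    fix v assume "v \<in> GG \<union> {star u (\<tau> (x i)) | u i. u \<in> GG \<and> i \<in> J}"
    then consider (g) h where "h \<in> carrier (grp D)" "v = \<tau> (gr h)"
      | (gx) h i where "h \<in> carrier (grp D)" "i \<in> J" "v = star (\<tau> (gr h)) (\<tau> (x i))" by blast
    then show "v \<in> \<tau> ` lin_span U deg1"
    proof cases
      case g
      then show ?thesis by (intro image_eqI[of _ _ "gr h"] U.lin_span_base) auto
    next
      case gx
      then have "v = \<tau> (gr h \<otimes>\<^bsub>U\<^esub> x i)" by (simp only: star_\<tau> gr_closed x_closed)
      then show ?thesis using gx(1,2) by (intro image_eqI[of _ _ "gr h \<otimes>\<^bsub>U\<^esub> x i"] U.lin_span_base) auto
    qed
  qed
qed

text \<open>The abstract theorem is applied to the images of \<open>A\<close> and \<open>B\<close>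
  under \<open>\<tau>\<close>; the inclusion is pulled back because \<open>\<tau>\<close> is
  injective on the carrier.\<close>

lemma subalgebra_containing_degree_one:
  assumes A: "right_coideal_subalgebra D A" and B: "is_subalgebra B U" "A \<inter> lin_span U deg1 \<subseteq> B"
  shows "A \<subseteq> B"
proof -
  have A1: "is_subalgebra A U" "comult D ` A \<subseteq> tensor_subspace U U A (carrier U)"
    using A by (simp_all only: right_coideal_subalgebra_def)
  have AU: "A \<subseteq> carrier U" using A1(1) by (simp only: U.is_subalgebra_iff)
  have BU: "B \<subseteq> carrier U" using B(1) by (simp only: U.is_subalgebra_iff)
  have LU: "lin_span U deg1 \<subseteq> carrier U"
  proof (rule U.lin_span_minimal)
    show "submodule (carrier U) (KK :: 'k ring) U" by (simp add: U.submodule_iff)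
  qed auto
  have slice: "slice f v \<in> \<tau> ` A" if f: "linear_functional pm_scale f" and v: "v \<in> \<tau> ` A" for f v
  proof -
    obtain a where a: "a \<in> A" "v = \<tau> a" using v by blast
    have "\<sigma> v = a" unfolding a(2) by (rule \<sigma>_\<tau>[OF subsetD[OF AU a(1)]])
    then show ?thesis
      unfolding slice_def using tensor_subspace_slice[OF A1(1) f subsetD[OF A1(2) imageI[OF a(1)]]] by (simp only:)
  qed
  have inj: "a = b" if "\<tau> a = \<tau> b" "a \<in> carrier U" "b \<in> carrier U" for a b
    by (metis that \<sigma>_\<tau>)
  have deg1: "\<tau> ` A \<inter> pm.span (GG \<union> {star u (\<tau> (x i)) | u i. u \<in> GG \<and>
      i \<in> J}) \<subseteq> \<tau> ` B"
  proof
    fix v assume v: "v \<in> \<tau> ` A \<inter> pm.span (GG \<union> {star u (\<tau> (x i)) | u i. u \<in> GG \<and>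
        i \<in> J})"
    from subsetD[OF span_subset_lin_span IntD2[OF v]]
    obtain b where b: "v = \<tau> b" "b \<in> lin_span U deg1" by (rule imageE)
    from IntD1[OF v] obtain a where a: "v = \<tau> a" "a \<in> A" by (rule imageE)
    have ab: "a = b"
      by (rule inj[OF trans[OF a(1)[symmetric] b(1)] subsetD[OF AU a(2)] subsetD[OF LU b(2)]])
    have "b \<in> B" by (rule subsetD[OF B(2) IntI[OF a(2)[unfolded ab] b(2)]])
    then show "v \<in> \<tau> ` B" unfolding b(1) by (rule imageI)
  qed
  have sub: "\<tau> ` A \<subseteq> \<tau> ` B"
    by (rule coideal_setting.coideal_subalgebra_subset[OF coideal_setting_U
          subalgebra_image[OF A1(1)] slice image_mono[OF AU] subalgebra_image[OF B(1)] deg1])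
  show ?thesis
  proof
    fix a assume a: "a \<in> A"
    from subsetD[OF sub imageI[OF a]] obtain b where b: "\<tau> a = \<tau> b" "b \<in> B" by (rule imageE)
    have "a = b" by (rule inj[OF b(1) subsetD[OF AU a] subsetD[OF BU b(2)]])
    then show "a \<in> B" using b(2) by (simp only:)
  qed
qed

end

theorem right_coideal_subalgebra_generated:
  assumes A: "right_coideal_subalgebra D A"
  shows "gen_subalgebra U (A \<inter> lin_span U
    ({gr h | h. h \<in> carrier (grp D)} \<union>
     {gr h \<otimes>\<^bsub>U\<^esub> x i | h i. h \<in> carrier (grp D) \<and> i \<in> J})) = A"
proof -
  \<comment> \<open>The section is auxiliary: it discharges the assumptions of the preceding context
    and does not occur in the conclusion.\<close>
  obtain \<sigma> :: "((('g + nat) list \<Rightarrow>\<^sub>0 'k) set \<Rightarrow>\<^sub>0 'k) \<Rightarrow> (('g + nat) list \<Rightarrow>\<^sub>0 'k) set" and \<tau>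
    where *: "\<And>p. \<sigma> p \<in> carrier U" "\<And>p q. \<sigma> (p + q) = \<sigma> p \<oplus>\<^bsub>U\<^esub> \<sigma> q" "\<And>c p. \<sigma> (pm_scale c p) = c \<odot>\<^bsub>U\<^esub> \<sigma> p"
    "\<And>a. a \<in> carrier U \<Longrightarrow> \<sigma> (\<tau> a) = a"
    "\<And>a b. a \<in> carrier U \<Longrightarrow> b \<in> carrier U \<Longrightarrow>
        \<tau> (a \<oplus>\<^bsub>U\<^esub> b) = \<tau> a + \<tau> b"
    "\<And>c a. a \<in> carrier U \<Longrightarrow> \<tau> (c \<odot>\<^bsub>U\<^esub> a) = pm_scale c (\<tau> a)"
    by (rule U.linear_section) blast
  have sub: "A \<subseteq> B" if "is_subalgebra B U" "A \<inter> lin_span U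
    ({gr h | h. h \<in> carrier (grp D)} \<union>
     {gr h \<otimes>\<^bsub>U\<^esub> x i | h i. h \<in> carrier (grp D) \<and> i \<in> J}) \<subseteq> B" for B
    by (rule subalgebra_containing_degree_one[of \<sigma> \<tau>]) (fact * A that)+
  show ?thesis
    unfolding gen_subalgebra_def
  \<comment> \<open>\<open>A\<close> is itself a subalgebra containing its part of degree at most
    one, and by \<open>sub\<close> it is the least one.\<close>
  proof (rule hull_unique)
    show "is_subalgebra A U" using A by (simp add: right_coideal_subalgebra_def)
  qed (simp_all add: sub)
qed

end

theorem theorem3p2:
  fixes D :: "('g, 'k::{alg_closed_field, field_char_0}) datum"
    and A :: "(('g + nat) list \<Rightarrow>\<^sub>0 'k) set set"
  assumes "is_datum D"
    and "right_coideal_subalgebra D A"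
  shows "gen_subalgebra (UU D)
      (A \<inter> lin_span (UU D)
         ({U_grp D h | h. h \<in> carrier (grp D)} \<union>
          {U_grp D h \<otimes>\<^bsub>UU D\<^esub> U_x D i | h i. h \<in> carrier (grp D) \<and> i \<in> {1..theta D}})) = A"
  using assms(2) by (rule hopf_datum.right_coideal_subalgebra_generated[OF hopf_datum.intro[OF assms(1)]])

end
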